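(* Let $ds^2$ be a product cuspidal metric for a neighborhood of the origin in $(\mathbb R^2)^{m+n}$. A curve having endpoints distinct from the origin and in distinct coordinate proper subspaces of the $y$-axes and further having the origin as an intermediate point is not $ds^2$ length-minimizing between its endpoints. There is a shorter curve (with the same endpoints) avoiding the origin.
   Context: Consider $(\mathbb R^2)^{m+n}=\mathbb R^{2m}\times\mathbb R^{2n}$ with Euclidean coordinates $(x,y)$. The $x$-axes is $\mathbb R^{2m}\times\{0\}$ and the $y$-axes is $\{0\}\times\mathbb R^{2n}$. Let $(r_j,\theta_j)$, $j=1,\dots,n$, be polar coordinates for the $2$-plane with coordinates $(y_{2j-1},y_{2j})$; $r=(r_1,\dots,r_n)$, $\|r\|$ is the Euclidean norm of the radius vector for the $y$-axes, and $dr^2+r^6d\theta^2$ abbreviates the singular metric $\sum_{j=1}^n\bigl(4\,dr_j^2+r_j^6\,d\theta_j^2\bigr)$. Definition. A continuous symmetric $2$-tensor $ds^2$ is a product cuspidal metric for a neighborhood of the origin in $(\mathbb R^2)^{m+n}$ provided: (1) $ds^2$ is a smooth Riemannian metric on $\bigcap_{j=1}^n\{r_j>0\}$; (2) the restriction of $ds^2$ to the $x$-axes is a smooth Riemannian metric $ds_x^2$; (3) $ds^2=(d\mu^2+dr^2+r^6d\theta^2)(1+O(\|r\|^2))$, where $d\mu^2$ is the pullback of $ds_x^2$ to $(\mathbb R^2)^{m+n}$ by the projection onto the $x$-axes. Lengths of curves are computed with $ds^2$. The distinct coordinate proper subspaces are the two factors of a splitting of the $y$-axes $\mathbb R^{2n}=\mathbb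 R^{2n_-}\times\mathbb R^{2n_+}$, $y=(y_-,y_+)$, $n=n_-+n_+$, $n_\pm\ge1$, obtained by partitioning the $n$ coordinate $2$-planes; one endpoint lies in $\mathbb R^{2n_-}\times\{0\}$ minus the origin and the other in $\{0\}\times\mathbb R^{2n_+}$ minus the origin. *)

theory Defs
  imports "HOL-Analysis.Analysis"
begin

text \<open>
  The space \<open>(R^2)^(m+n)\<close> is \<open>real^2^'k\<close>, where the finite type \<open>'k\<close> indexes the \<open>m + n\<close> coordinate
  2-planes. A set \<open>Y\<close> of indices selects the \<open>n\<close> planes spanning the y-axes; the remaining planes
  \<open>- Y\<close> span the x-axes, and \<open>Y = UNIV\<close> is the case \<open>m = 0\<close>.
\<close>

definition coord_subspace :: "'k::finite set \<Rightarrow> (real^2^'k) set"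
  where "coord_subspace A = {p. \<forall>i. i \<notin> A \<longrightarrow> p $ i = 0}"

abbreviation x_axes :: "'k::finite set \<Rightarrow> (real^2^'k) set"
  where "x_axes Y \<equiv> coord_subspace (- Y)"

definition proj_x :: "'k::finite set \<Rightarrow> real^2^'k \<Rightarrow> real^2^'k"
  where "proj_x Y p = (\<chi> i. if i \<in> Y then 0 else p $ i)"

definition radius_norm :: "'k::finite set \<Rightarrow> real^2^'k \<Rightarrow> real"
  where "radius_norm Y p = L2_set (\<lambda>j. norm (p $ j)) Y"

definition regular_set :: "'k::finite set \<Rightarrow> (real^2^'k) set"
  where "regular_set Y = {p. \<forall>j\<in>Y. norm (p $ j) > 0}"


subsection \<open>Smooth functions\<close>

primrec Ck_on :: "nat \<Rightarrow> ('a::euclidean_space \<Rightarrow> real) \<Rightarrow> 'a set \<Rightarrow> bool" where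
  "Ck_on 0 f S \<longleftrightarrow> continuous_on S f"
| "Ck_on (Suc k) f S \<longleftrightarrow>
     (\<forall>x\<in>S. f differentiable (at x)) \<and> (\<forall>v. Ck_on k (\<lambda>x. frechet_derivative f (at x) v) S)"

text \<open>Intended for open \<open>S\<close>.\<close>

definition smooth_on :: "('a::euclidean_space \<Rightarrow> real) \<Rightarrow> 'a set \<Rightarrow> bool"
  where "smooth_on f S \<longleftrightarrow> (\<forall>k. Ck_on k f S)"


subsection \<open>Tensors\<close>

text \<open>A 2-tensor assigns to a base point \<open>p\<close> a form in two tangent vectors.\<close>

type_synonym 'a tensor2 = "'a \<Rightarrow> 'a \<Rightarrow> 'a \<Rightarrow> real"

definition symmetric_tensor_on :: "'a::real_vector tensor2 \<Rightarrow> 'a set \<Rightarrow> bool"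
  where "symmetric_tensor_on g S \<longleftrightarrow>
    (\<forall>p\<in>S. bilinear (g p) \<and> (\<forall>u v. g p u v = g p v u))"

definition smooth_riemannian_on :: "'a::euclidean_space tensor2 \<Rightarrow> 'a set \<Rightarrow> bool"
  where "smooth_riemannian_on g S \<longleftrightarrow>
    symmetric_tensor_on g S \<and> (\<forall>p\<in>S. \<forall>u. u \<noteq> 0 \<longrightarrow> g p u u > 0) \<and>
    (\<forall>u v. smooth_on (\<lambda>p. g p u v) S)"

text \<open>The pullback of the restriction of \<open>g\<close> to the x-axes under the projection onto the x-axes.\<close>

definition pullback_x :: "'k::finite set \<Rightarrow> (real^2^'k) tensor2 \<Rightarrow> (real^2^'k) tensor2"
  where "pullback_x Y g p u v = g (proj_x Y p) (proj_x Y u) (proj_x Y v)"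

text \<open>
  Smoothness of the restriction to the linear subspace \<open>x_axes Y\<close> is expressed through its pullback,
  which lives on an open subset of the full space and depends only on the x-coordinates.
\<close>

definition x_restriction_riemannian ::
    "'k::finite set \<Rightarrow> (real^2^'k) set \<Rightarrow> (real^2^'k) tensor2 \<Rightarrow> bool"
  where "x_restriction_riemannian Y U g \<longleftrightarrow>
    (\<forall>p \<in> U \<inter> x_axes Y. \<forall>u \<in> x_axes Y. u \<noteq> 0 \<longrightarrow> g p u u > 0) \<and>
    (\<forall>u v. smooth_on (\<lambda>p. pullback_x Y g p u v) {p. proj_x Y p \<in> U})"

text \<open>The 1-forms \<open>dr\<close> and \<open>d\<theta>\<close> of a single plane, at \<open>z \<noteq> 0\<close>.\<close>

definition dr_form :: "real^2 \<Rightarrow> real^2 \<Rightarrow> real"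
  where "dr_form z v = (z \<bullet> v) / norm z"

definition dtheta_form :: "real^2 \<Rightarrow> real^2 \<Rightarrow> real"
  where "dtheta_form z v = (z $ 1 * v $ 2 - z $ 2 * v $ 1) / (norm z)\<^sup>2"

definition cusp_form :: "'k::finite set \<Rightarrow> (real^2^'k) tensor2"
  where "cusp_form Y p u v =
    (\<Sum>j\<in>Y. 4 * dr_form (p $ j) (u $ j) * dr_form (p $ j) (v $ j)
          + norm (p $ j) ^ 6 * dtheta_form (p $ j) (u $ j) * dtheta_form (p $ j) (v $ j))"


subsection \<open>Continuity up to the singular locus\<close>

text \<open>
  The model \<open>4 dr^2 + r^6 d\<theta>^2\<close> does not extend continuously over \<open>r = 0\<close> in the Cartesian frame of
  the 2-plane, since \<open>dr\<close> has direction-dependent limits there. So continuity of a tensor is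
  understood in the polar coordinates \<open>(x, r, \<theta>)\<close> with \<open>r \<ge> 0\<close>. For \<open>j \<in> Y\<close> the entry \<open>q $ j\<close> of a
  polar point \<open>q\<close> is the pair of \<open>r\<close> and \<open>\<theta>\<close> in the \<open>j\<close>-th plane.
\<close>

definition polar_map :: "'k::finite set \<Rightarrow> real^2^'k \<Rightarrow> real^2^'k"
  where "polar_map Y q =
    (\<chi> i. if i \<in> Y then vector [q $ i $ 1 * cos (q $ i $ 2), q $ i $ 1 * sin (q $ i $ 2)] else q $ i)"

definition polar_domain :: "'k::finite set \<Rightarrow> (real^2^'k) set \<Rightarrow> (real^2^'k) set"
  where "polar_domain Y U = {q. (\<forall>j\<in>Y. q $ j $ 1 \<ge> 0) \<and> polar_map Y q \<in> U}"

text \<open>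
  The vectors at \<open>p\<close> tangent to the stratum of \<open>p\<close>, i.e. to the locus where the same radii vanish.
  Only on these vectors does the value of the tensor at \<open>p\<close> matter; on a regular point they are all
  vectors. A differentiable curve has velocity tangent to the strata outside a countable set of
  times, so lengths do not depend on the other values.
\<close>

definition stratum_tangent :: "'k::finite set \<Rightarrow> real^2^'k \<Rightarrow> (real^2^'k) set"
  where "stratum_tangent Y p = {u. \<forall>j\<in>Y. p $ j = 0 \<longrightarrow> u $ j = 0}"

text \<open>
  There is a tensor \<open>h\<close> in polar coordinates, continuous up to and including the faces \<open>r = 0\<close>, that
  is the pullback of \<open>g\<close> under the polar coordinate map.
\<close>

definition polar_continuous_on ::
    "'k::finite set \<Rightarrow> (real^2^'k) tensor2 \<Rightarrow> (real^2^'k) set \<Rightarrow> bool"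
  where "polar_continuous_on Y g U \<longleftrightarrow>
    (\<exists>h :: (real^2^'k) tensor2.
       (\<forall>w w'. continuous_on (polar_domain Y U) (\<lambda>q. h q w w')) \<and>
       (\<forall>q \<in> polar_domain Y U. \<forall>w w'.
          let D = frechet_derivative (polar_map Y) (at q); p = polar_map Y q in
          D w \<in> stratum_tangent Y p \<longrightarrow> D w' \<in> stratum_tangent Y p \<longrightarrow>
          h q w w' = g p (D w) (D w')))"


subsection \<open>Product cuspidal metrics\<close>

text \<open>
  In the last condition, \<open>ds^2 = (d\<mu>^2 + dr^2 + r^6 d\<theta>^2) (1 + O(\<parallel>r\<parallel>^2))\<close> is a two-sided comparison of
  quadratic forms, uniform over tangent vectors and locally uniform along the x-axes as the radius
  vector tends to 0. It is imposed where the polar coframe is defined; by continuity it passes to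
  the strata.
\<close>

definition product_cuspidal_metric ::
    "'k::finite set \<Rightarrow> (real^2^'k) set \<Rightarrow> (real^2^'k) tensor2 \<Rightarrow> bool"
  where "product_cuspidal_metric Y U g \<longleftrightarrow>
    open U \<and> 0 \<in> U \<and>
    symmetric_tensor_on g U \<and> polar_continuous_on Y g U \<and>
    smooth_riemannian_on g (U \<inter> regular_set Y) \<and>
    x_restriction_riemannian Y U g \<and>
    (\<forall>q \<in> U \<inter> x_axes Y. \<exists>C. \<forall>\<^sub>F p in nhds q. p \<in> regular_set Y \<longrightarrow>
       (\<forall>u. let G = pullback_x Y g p u u + cusp_form Y p u u
            in \<bar>g p u u - G\<bar> \<le> C * (radius_norm Y p)\<^sup>2 * G))"


subsection \<open>Curves and lengths\<close>

definition curve_in :: "'a::real_normed_vector set \<Rightarrow> (real \<Rightarrow> 'a) \<Rightarrow> bool"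
  where "curve_in U \<gamma> \<longleftrightarrow> \<gamma> piecewise_C1_differentiable_on {0..1} \<and> path_image \<gamma> \<subseteq> U"

definition curve_length :: "'a::real_normed_vector tensor2 \<Rightarrow> (real \<Rightarrow> 'a) \<Rightarrow> ennreal"
  where "curve_length g \<gamma> =
    (\<integral>\<^sup>+ t\<in>{0..1}. ennreal (sqrt (g (\<gamma> t) (vector_derivative \<gamma> (at t)) (vector_derivative \<gamma> (at t)))) \<partial>lborel)"

definition length_minimizing ::
    "'a::real_normed_vector set \<Rightarrow> 'a tensor2 \<Rightarrow> (real \<Rightarrow> 'a) \<Rightarrow> bool"
  where "length_minimizing U g \<gamma> \<longleftrightarrow>
    (\<forall>\<sigma>. curve_in U \<sigma> \<and> pathstart \<sigma> = pathstart \<gamma> \<and> pathfinish \<sigma> = pathfinish \<gamma> \<longrightarrow>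
         curve_length g \<gamma> \<le> curve_length g \<sigma>)"

end

theory Submission
  imports Defs
begin

text \<open>
  Near a point of the x-axes the metric is, up to a factor \<open>1 + O(r^2)\<close>, the product
  \<open>d\<mu>^2 + 4 dr^2 + r^6 d\<theta>^2\<close>. Turning through any angle at radius \<open>r\<close> costs only \<open>O(r^3)\<close>, so the
  directions in the planes hardly count: a curve looks like a curve in the product of the x-axes with
  the Euclidean quadrant of vectors \<open>2 (r_j)\<close>. Two radius vectors \<open>R, R'\<close> have a nonnegative inner
  product, hence \<open>|R' - R|^2 \<le> |R|^2 + |R'|^2\<close>: a curve that descends to radius zero and rises again
  turns a corner, and cutting the corner saves length.

  The corner need not be the origin, because a curve may reach the origin along the x-axes. It is
  the point \<open>q\<close> at which the curve first meets the x-axes. Let \<open>l\<close> be the \<open>\<mu>\<close>-length of the x-part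
  of the curve measured from \<open>q\<close>, let \<open>\<rho>\<close> be the norm of the radius vector and \<open>V = sqrt (l^2 + 4 \<rho>^2)\<close>.
  Choose times before and after \<open>q\<close> with a common small value \<open>W\<close> of \<open>V\<close>, such that the maximum \<open>\<delta>\<close>
  of \<open>\<rho>\<close> between them is attained at one of them. The arc between them has at least the length
  \<open>2 W sqrt (1 - C \<delta>^2)\<close> (\<open>arc_length_ge_product\<close>). The replacement keeps the x-part, moves the radius
  vector linearly with respect to the length of the x-part and turns the angles on the way; its
  length is governed by \<open>l^2 + 4 |R' - R|^2 + K \<delta>^6\<close> (\<open>rotating_bridge\<close>), which is at most
  \<open>4 W^2 - 4 \<delta>^2 + K \<delta>^6\<close>. The gain \<open>4 \<delta>^2\<close> beats the errors \<open>C \<delta>^2 W^2\<close> and \<open>K \<delta>^6\<close> once \<open>W\<close> is small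
  (\<open>chord_gain\<close>). Since the x-part is kept, geodesics of \<open>ds_x^2\<close> never enter, and an approach to the
  x-axes that is tangential or oscillating is treated like any other. This gives
  \<open>shorten_curve_meeting_x_axes\<close>.

  The shorter curve may still pass through the origin. Points close to the origin are joined by
  arbitrarily short curves avoiding it (\<open>short_bridges_near_center\<close>), so a detour uses up only part of
  the saving (\<open>detour_around_center\<close>).

  Three technical points remain. At points where some radius vanishes the metric is given by its
  limit in polar coordinates and only on vectors tangent to the stratum; the comparison with the
  product form extends to these (\<open>product_comparison_on_strata\<close>), and the velocity of a curve is
  tangent to the strata at almost all times (\<open>AE_velocity_stratum_tangent\<close>). The length integrand is
  not known to be measurable, but the integral is a supremum over simple functions and as such still
  additive over measurable sets (\<open>nn_integral_disjoint_Un\<close>). Finally, the given curve may have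
  infinite length, since its derivative may blow up at break points and the angular part of the metric
  is uncontrolled away from the x-axes; then any connection of finite length is shorter
  (\<open>finite_length_connection\<close>).
\<close>

section \<open>Lower integrals and primitives\<close>

text \<open>
  A sum of simple functions below \<open>f\<close> and \<open>g\<close> is a simple function below \<open>f + g\<close>; no
  measurability is involved in this direction.
\<close>

lemma nn_integral_superadditive:
  "(\<integral>\<^sup>+x. f x \<partial>M) + (\<integral>\<^sup>+x. g x \<partial>M) \<le> (\<integral>\<^sup>+x. f x + g x \<partial>M)"
proof -
  let ?S = "\<lambda>f. {u. simple_function M u \<and> u \<le> f}"
  have ne: "?S h \<noteq> {}" for h :: "'a \<Rightarrow> ennreal"
    by (auto intro!: exI[of _ "\<lambda>_. 0"] simp: le_fun_def)
  have step: "integral\<^sup>S M u + integral\<^sup>S M w \<le> (\<integral>\<^sup>+x. f x + g x \<partial>M)" if "u \<in> ?S f" "w \<in> ?S g" for u w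
  proof -
    from that have "integral\<^sup>S M u + integral\<^sup>S M w = integral\<^sup>S M (\<lambda>x. u x + w x)"
      by simp
    also have "\<dots> = (\<integral>\<^sup>+x. u x + w x \<partial>M)"
      using that by (intro nn_integral_eq_simple_integral[symmetric]) auto
    also have "\<dots> \<le> (\<integral>\<^sup>+x. f x + g x \<partial>M)"
      using that by (intro nn_integral_mono add_mono) (auto simp: le_fun_def)
    finally show ?thesis .
  qed
  have "(\<integral>\<^sup>+x. f x \<partial>M) + (\<integral>\<^sup>+x. g x \<partial>M)
      = (SUP u\<in>?S f. (SUP w\<in>?S g. integral\<^sup>S M u + integral\<^sup>S M w))"
    unfolding nn_integral_def
    by (subst ennreal_SUP_add_left[symmetric, OF ne], subst ennreal_SUP_add_right[symmetric, OF ne]) simp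
  also have "\<dots> \<le> (\<integral>\<^sup>+x. f x + g x \<partial>M)"
    using step by (intro SUP_least) auto
  finally show ?thesis .
qed

text \<open>
  A simple function below \<open>f\<close> on \<open>A \<union> B\<close> can be cut along the measurable sets, which gives the
  direction that fails for sums in general. Lengths of curves are additive for this reason, although
  the metric, and with it the length integrand, is arbitrary on non-tangent vectors over the strata.
\<close>

lemma nn_integral_disjoint_Un:
  fixes f :: "'a \<Rightarrow> ennreal"
  assumes A: "A \<in> sets M" and B: "B \<in> sets M" and disj: "A \<inter> B = {}"
  shows "(\<integral>\<^sup>+x\<in>A \<union> B. f x \<partial>M) = (\<integral>\<^sup>+x\<in>A. f x \<partial>M) + (\<integral>\<^sup>+x\<in>B. f x \<partial>M)"
proof (rule antisym)
  have eq: "f x * indicator (A \<union> B) x = f x * indicator A x + f x * indicator B x" for x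
    using disj by (auto split: split_indicator)
  show "(\<integral>\<^sup>+x\<in>A. f x \<partial>M) + (\<integral>\<^sup>+x\<in>B. f x \<partial>M) \<le> (\<integral>\<^sup>+x\<in>A \<union> B. f x \<partial>M)"
    unfolding eq by (rule nn_integral_superadditive)
  show "(\<integral>\<^sup>+x\<in>A \<union> B. f x \<partial>M) \<le> (\<integral>\<^sup>+x\<in>A. f x \<partial>M) + (\<integral>\<^sup>+x\<in>B. f x \<partial>M)"
    unfolding nn_integral_def[of M "\<lambda>x. f x * indicator (A \<union> B) x"]
  proof (rule SUP_least)
    fix u assume "u \<in> {u. simple_function M u \<and> u \<le> (\<lambda>x. f x * indicator (A \<union> B) x)}"
    then have u: "simple_function M u" and le: "\<And>x. u x \<le> f x * indicator (A \<union> B) x"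
      by (auto simp: le_fun_def)
    note [measurable] = A B borel_measurable_simple_function[OF u]
    have "integral\<^sup>S M u = (\<integral>\<^sup>+x. u x \<partial>M)"
      by (simp add: nn_integral_eq_simple_integral u)
    also have "u x = u x * indicator A x + u x * indicator B x" for x
      using le[of x] disj by (auto split: split_indicator)
    then have "(\<integral>\<^sup>+x. u x \<partial>M) = (\<integral>\<^sup>+x. u x * indicator A x + u x * indicator B x \<partial>M)"
      by simp
    also have "\<dots> = (\<integral>\<^sup>+x\<in>A. u x \<partial>M) + (\<integral>\<^sup>+x\<in>B. u x \<partial>M)"
      by (rule nn_integral_add) auto
    also have "\<dots> \<le> (\<integral>\<^sup>+x\<in>A. f x \<partial>M) + (\<integral>\<^sup>+x\<in>B. f x \<partial>M)"
      using le disj by (intro add_mono nn_integral_mono)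
        (auto split: split_indicator, (metis Un_iff indicator_simps(1) mult.right_neutral)+)
    finally show "integral\<^sup>S M u \<le> \<dots>" .
  qed
qed

lemma nn_integral_Icc_eq_Ioo:
  fixes f :: "real \<Rightarrow> ennreal"
  assumes "finite S"
  shows "(\<integral>\<^sup>+t\<in>{a..b}. f t \<partial>lborel) = (\<integral>\<^sup>+t\<in>{a<..<b} - S. f t \<partial>lborel)"
proof (rule nn_integral_cong_AE)
  have "AE t in lborel. t \<notin> S \<union> {a, b}"
    using assms by (intro AE_not_in finite_imp_null_set_lborel) auto
  then show "AE t in lborel. f t * indicator {a..b} t = f t * indicator ({a<..<b} - S) t"
    by eventually_elim (auto split: split_indicator)
qed

lemma nn_integral_Icc_combine:
  fixes f :: "real \<Rightarrow> ennreal"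
  assumes "a \<le> c" "c \<le> b"
  shows "(\<integral>\<^sup>+t\<in>{a..b}. f t \<partial>lborel) = (\<integral>\<^sup>+t\<in>{a..c}. f t \<partial>lborel) + (\<integral>\<^sup>+t\<in>{c..b}. f t \<partial>lborel)"
proof -
  have "(\<integral>\<^sup>+t\<in>{a..b}. f t \<partial>lborel) = (\<integral>\<^sup>+t\<in>{a<..<b} - {c}. f t \<partial>lborel)"
    by (rule nn_integral_Icc_eq_Ioo) simp
  also have "{a<..<b} - {c} = {a<..<c} \<union> {c<..<b}"
    using assms by auto
  also have "(\<integral>\<^sup>+t\<in>{a<..<c} \<union> {c<..<b}. f t \<partial>lborel)
      = (\<integral>\<^sup>+t\<in>{a<..<c}. f t \<partial>lborel) + (\<integral>\<^sup>+t\<in>{c<..<b}. f t \<partial>lborel)"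
    by (rule nn_integral_disjoint_Un) auto
  finally show ?thesis
    using nn_integral_Icc_eq_Ioo[of "{}" f] by simp
qed

text \<open>
  The length estimates bound the integrand by an explicit derivative. The next two lemmas turn such a
  bound into one for the integral. They tolerate finitely many break points, near which the derivative
  may be unbounded.
\<close>

lemma nn_integral_le_antiderivative:
  fixes f :: "real \<Rightarrow> ennreal" and F F' :: "real \<Rightarrow> real"
  assumes "a \<le> b" "finite S" and cont: "continuous_on {a..b} F"
    and deriv: "\<And>t. t \<in> {a<..<b} - S \<Longrightarrow> (F has_real_derivative F' t) (at t)"
    and nonneg: "\<And>t. t \<in> {a<..<b} - S \<Longrightarrow> 0 \<le> F' t"
    and le: "\<And>t. t \<in> {a<..<b} - S \<Longrightarrow> f t \<le> ennreal (F' t)"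
  shows "(\<integral>\<^sup>+t\<in>{a..b}. f t \<partial>lborel) \<le> ennreal (F b - F a)"
proof -
  have "(F' has_integral (F b - F a)) {a..b}"
    using assms by (intro fundamental_theorem_of_calculus_interior_strong[of S])
      (auto simp: has_real_derivative_iff_has_vector_derivative)
  then have *: "((\<lambda>t. if t \<in> {a<..<b} - S then F' t else 0) has_integral (F b - F a)) {a..b}"
    using assms(2) by (elim has_integral_spike[of "S \<union> {a,b}", rotated 2]) auto
  have "(\<integral>\<^sup>+t\<in>{a..b}. f t \<partial>lborel) = (\<integral>\<^sup>+t\<in>{a<..<b} - S. f t \<partial>lborel)"
    by (rule nn_integral_Icc_eq_Ioo) fact
  also have "\<dots> \<le> (\<integral>\<^sup>+t\<in>{a..b}. ennreal (if t \<in> {a<..<b} - S then F' t else 0) \<partial>lborel)"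
    using le by (intro nn_integral_mono) (auto split: split_indicator)
  also have "\<dots> = ennreal (F b - F a)"
    by (rule nn_integral_has_integral_lebesgue'[OF _ *]) (use nonneg in auto)
  finally show ?thesis .
qed

lemma antiderivative_le_nn_integral:
  fixes f :: "real \<Rightarrow> ennreal" and F F' :: "real \<Rightarrow> real"
  assumes "a \<le> b" "finite S" and cont: "continuous_on {a..b} F"
    and deriv: "\<And>t. t \<in> {a<..<b} - S \<Longrightarrow> (F has_real_derivative F' t) (at t)"
    and cont': "continuous_on ({a<..<b} - S) F'"
    and le: "AE t in lborel. t \<in> {a<..<b} - S \<longrightarrow> ennreal (F' t) \<le> f t"
  shows "ennreal (F b - F a) \<le> (\<integral>\<^sup>+t\<in>{a..b}. f t \<partial>lborel)"
proof -
  \<comment> \<open>\<open>F'\<close> itself need not be Lebesgue integrable; its positive part is measurable and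
    either has infinite integral or dominates the gauge integral of \<open>F'\<close>.\<close>
  let ?m = "\<lambda>t. indicator ({a<..<b} - S) t *\<^sub>R max 0 (F' t)"
  have "open ({a<..<b} - S)"
    using assms(2) by (intro open_Diff finite_imp_closed) auto
  then have meas: "?m \<in> borel_measurable borel"
    by (intro borel_measurable_continuous_on_indicator continuous_intros cont') auto
  have "(F' has_integral (F b - F a)) {a..b}"
    using assms by (intro fundamental_theorem_of_calculus_interior_strong[of S])
      (auto simp: has_real_derivative_iff_has_vector_derivative)
  then have F: "((\<lambda>t. if t \<in> {a<..<b} - S then F' t else 0) has_integral (F b - F a)) {a..b}"
    using assms(2) by (elim has_integral_spike[of "S \<union> {a,b}", rotated 2]) auto
  have "ennreal (F b - F a) \<le> (\<integral>\<^sup>+t. ennreal (?m t) \<partial>lborel)"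
  proof (cases "(\<integral>\<^sup>+t. ennreal (?m t) \<partial>lborel) = \<infinity>")
    case False
    then have int: "integrable lborel ?m"
      using meas by (intro integrableI_nonneg) (auto simp: top.not_eq_extremum)
    have "(?m has_integral integral\<^sup>L lborel ?m) UNIV"
      by (rule has_integral_integral_lborel[OF int])
    then have "(?m has_integral integral\<^sup>L lborel ?m) {a..b}"
      by (subst has_integral_restrict_UNIV[symmetric]) (auto elim!: has_integral_eq[rotated] simp: indicator_def)
    from has_integral_le[OF F this] have "F b - F a \<le> integral\<^sup>L lborel ?m"
      by (auto simp: indicator_def)
    moreover have "(\<integral>\<^sup>+t. ennreal (?m t) \<partial>lborel) = ennreal (integral\<^sup>L lborel ?m)"
      by (rule nn_integral_eq_integral[OF int]) auto
    ultimately show ?thesis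
      by (simp add: ennreal_leI)
  qed auto
  also have "\<dots> \<le> (\<integral>\<^sup>+t\<in>{a..b}. f t \<partial>lborel)"
    using le by (intro nn_integral_mono_AE) (auto elim!: eventually_mono simp: indicator_def max_def)
  finally show ?thesis .
qed

section \<open>Projection to the x-axes and radii\<close>

text \<open>
  Continuity is known for fixed tangent vectors only; expanding both arguments in the basis makes
  the value continuous along moving vectors.
\<close>

lemma continuous_on_tensor:
  fixes t :: "'a::euclidean_space tensor2" and f u v :: "'b::topological_space \<Rightarrow> 'a"
  assumes bil: "\<And>s. s \<in> W \<Longrightarrow> bilinear (t (f s))"
    and t: "\<And>a b. continuous_on W (\<lambda>s. t (f s) a b)"
    and u: "continuous_on W u" and v: "continuous_on W v"
  shows "continuous_on W (\<lambda>s. t (f s) (u s) (v s))"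
proof -
  have eq: "t (f s) (u s) (v s) = (\<Sum>(a, b)\<in>Basis \<times> Basis. (u s \<bullet> a) * ((v s \<bullet> b) * t (f s) a b))"
    if "s \<in> W" for s
  proof -
    note b = bil[OF that]
    have "t (f s) (u s) (v s) = t (f s) (\<Sum>a\<in>Basis. (u s \<bullet> a) *\<^sub>R a) (\<Sum>b\<in>Basis. (v s \<bullet> b) *\<^sub>R b)"
      by (simp add: euclidean_representation)
    also have "\<dots> = (\<Sum>(a, b)\<in>Basis \<times> Basis. t (f s) ((u s \<bullet> a) *\<^sub>R a) ((v s \<bullet> b) *\<^sub>R b))"
      by (rule bilinear_sum[OF b])
    finally show ?thesis
      by (simp add: bilinear_lmul[OF b] bilinear_rmul[OF b] mult.left_commute)
  qed
  have "continuous_on W (\<lambda>s. \<Sum>(a, b)\<in>Basis \<times> Basis. (u s \<bullet> a) * ((v s \<bullet> b) * t (f s) a b))"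
    unfolding split_beta by (intro continuous_intros u v t)
  then show ?thesis
    by (rule continuous_on_eq) (simp add: eq)
qed

lemma smooth_on_imp_continuous_on: "smooth_on f S \<Longrightarrow> continuous_on S f"
  unfolding smooth_on_def by (metis Ck_on.simps(1))

lemma linear_proj_x: "linear (proj_x Y)"
  by (rule linearI) (auto simp: proj_x_def vec_eq_iff)

lemma bounded_linear_proj_x: "bounded_linear (proj_x Y)"
  using linear_proj_x linear_linear by blast

lemmas proj_x_simps [simp] = linear_add[OF linear_proj_x] linear_diff[OF linear_proj_x]
  linear_scale[OF linear_proj_x] linear_0[OF linear_proj_x]

lemma continuous_on_proj_x [continuous_intros]:
  "continuous_on S f \<Longrightarrow> continuous_on S (\<lambda>s. proj_x Y (f s))"
  by (rule bounded_linear.continuous_on[OF bounded_linear_proj_x])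

lemma proj_x_nth [simp]: "proj_x Y p $ i = (if i \<in> Y then 0 else p $ i)"
  by (simp add: proj_x_def)

lemma proj_x_idem [simp]: "proj_x Y (proj_x Y p) = proj_x Y p"
  by (simp add: vec_eq_iff)

lemma x_axes_iff: "p \<in> x_axes Y \<longleftrightarrow> proj_x Y p = p"
  by (auto simp: coord_subspace_def vec_eq_iff)

lemma proj_x_in_x_axes [simp]: "proj_x Y p \<in> x_axes Y"
  by (simp add: x_axes_iff)

lemma norm_proj_x_le: "norm (proj_x Y p) \<le> norm p"
  by (intro norm_le_componentwise_cart) auto

lemma radius_norm_eq: "radius_norm Y p = norm (p - proj_x Y p)"
proof -
  have "L2_set (\<lambda>j. norm ((p - proj_x Y p) $ j)) UNIV = L2_set (\<lambda>j. norm (p $ j)) Y"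
    unfolding L2_set_def
    by (auto intro!: sum.mono_neutral_cong_right arg_cong[of _ _ sqrt])
  then show ?thesis
    by (simp add: radius_norm_def norm_vec_def)
qed

lemma radius_norm_nonneg [simp]: "0 \<le> radius_norm Y p"
  by (simp add: radius_norm_eq)

lemma radius_norm_eq_0_iff: "radius_norm Y p = 0 \<longleftrightarrow> p \<in> x_axes Y"
  by (auto simp: radius_norm_eq x_axes_iff)

lemma norm_le_radius_norm: "j \<in> Y \<Longrightarrow> norm (p $ j) \<le> radius_norm Y p"
  unfolding radius_norm_def by (intro member_le_L2_set) auto

lemma continuous_on_radius_norm [continuous_intros]:
  "continuous_on S f \<Longrightarrow> continuous_on S (\<lambda>s. radius_norm Y (f s))"
  unfolding radius_norm_eq by (intro continuous_intros)

lemma radius_norm_le_dist: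
  assumes "q \<in> x_axes Y"
  shows "radius_norm Y p \<le> norm (p - q)"
proof -
  have "norm ((p - q) - proj_x Y (p - q)) \<le> norm (p - q)"
    by (rule norm_le_componentwise_cart) (simp del: proj_x_simps)
  then show ?thesis
    using assms by (simp add: radius_norm_eq x_axes_iff)
qed

lemma dist_proj_x_le:
  assumes "q \<in> x_axes Y"
  shows "dist q (proj_x Y p) \<le> dist q p"
  using norm_proj_x_le[of Y "q - p"] assms by (simp add: x_axes_iff dist_norm)

lemma bilinear_pullback_x:
  assumes "bilinear (g (proj_x Y p))" shows "bilinear (pullback_x Y g p)"
  using assms unfolding bilinear_def pullback_x_def
  by (auto intro!: linear_compose[OF linear_proj_x, unfolded o_def])

section \<open>Polar coordinates\<close>

lemma real2_polar:
  fixes z :: "real^2"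
  obtains \<theta> where "0 \<le> \<theta>" "\<theta> < 2 * pi" "z = norm z *\<^sub>R vector [cos \<theta>, sin \<theta>]"
proof (cases "z = 0")
  case False
  have "(z $ 1 / norm z)\<^sup>2 + (z $ 2 / norm z)\<^sup>2 = 1"
    using False by (simp add: power_divide norm_vec_def L2_set_def sum_2 add_divide_distrib[symmetric]
      sum_nonneg vec_eq_iff forall_2)
  from sincos_total_2pi[OF this] obtain \<theta> where \<theta>: "0 \<le> \<theta>" "\<theta> < 2 * pi"
    and cs: "z $ 1 / norm z = cos \<theta>" "z $ 2 / norm z = sin \<theta>" by metis
  have "z = norm z *\<^sub>R vector [cos \<theta>, sin \<theta>]"
    using False by (simp add: vec_eq_iff forall_2 cs[symmetric])
  with \<theta> show thesis
    by (rule that)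
next
  case True
  then show thesis
    by (intro that[of 0]) auto
qed

lemma norm_vector2: "norm (vector [a, b] :: real^2) = sqrt (a\<^sup>2 + b\<^sup>2)"
  by (simp add: norm_vec_def L2_set_def sum_2)

lemma norm_unit2 [simp]: "norm (vector [cos \<theta>, sin \<theta>] :: real^2) = 1"
  by (simp add: norm_vector2)

text \<open>
  The derivative of \<open>polar_map\<close>, written in the moving frame of each plane.
\<close>

definition polar_deriv :: "'k::finite set \<Rightarrow> real^2^'k \<Rightarrow> real^2^'k \<Rightarrow> real^2^'k"
  where "polar_deriv Y q w = (\<chi> i. if i \<in> Y then
     w $ i $ 1 *\<^sub>R vector [cos (q $ i $ 2), sin (q $ i $ 2)]
     + (q $ i $ 1 * w $ i $ 2) *\<^sub>R vector [- sin (q $ i $ 2), cos (q $ i $ 2)] else w $ i)"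

lemma polar_map_nth:
  "polar_map Y q $ i = (if i \<in> Y then q $ i $ 1 *\<^sub>R vector [cos (q $ i $ 2), sin (q $ i $ 2)] else q $ i)"
  by (simp add: polar_map_def vec_eq_iff forall_2)

lemma polar_deriv_nth:
  "polar_deriv Y q w $ i = (if i \<in> Y then
     w $ i $ 1 *\<^sub>R vector [cos (q $ i $ 2), sin (q $ i $ 2)]
     + (q $ i $ 1 * w $ i $ 2) *\<^sub>R vector [- sin (q $ i $ 2), cos (q $ i $ 2)] else w $ i)"
  by (simp add: polar_deriv_def)

lemma has_derivative_vec_componentwise:
  fixes f :: "'a::real_normed_vector \<Rightarrow> real^'n::finite^'m::finite"
  assumes "\<And>i j. ((\<lambda>x. f x $ i $ j) has_derivative (\<lambda>h. D h $ i $ j)) (at x within S)"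
  shows "(f has_derivative D) (at x within S)"
  unfolding has_derivative_componentwise_within[of f]
  using assms by (auto simp: Basis_vec_def inner_axis)

lemma has_derivative_nth_nth: "((\<lambda>x. x $ i $ j) has_derivative (\<lambda>h. h $ i $ j)) F"
  by (intro bounded_linear_imp_has_derivative bounded_linear_compose[OF bounded_linear_vec_nth bounded_linear_vec_nth])

lemma has_derivative_polar_map: "(polar_map Y has_derivative polar_deriv Y q) (at q within S)"
proof (rule has_derivative_vec_componentwise)
  fix i :: 'a and j :: 2
  have "j = 1 \<or> j = 2" by (rule exhaust_2)
  then show "((\<lambda>x. polar_map Y x $ i $ j) has_derivative (\<lambda>h. polar_deriv Y q h $ i $ j)) (at q within S)"
    by (cases "i \<in> Y") (auto simp: polar_map_nth polar_deriv_nth algebra_simps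
        intro!: derivative_eq_intros has_derivative_nth_nth)
qed

lemma frechet_derivative_polar_map: "frechet_derivative (polar_map Y) (at q) = polar_deriv Y q"
  by (rule frechet_derivative_at[OF has_derivative_polar_map, symmetric])

lemma continuous_on_polar_map [continuous_intros]:
  "continuous_on S f \<Longrightarrow> continuous_on S (\<lambda>s. polar_map Y (f s))"
  by (rule continuous_on_compose2[OF has_derivative_continuous_on[OF has_derivative_polar_map]]) auto

lemma norm_polar_map_nth: "j \<in> Y \<Longrightarrow> norm (polar_map Y q $ j) = \<bar>q $ j $ 1\<bar>"
  by (simp add: polar_map_nth)

lemma proj_x_polar_map [simp]: "proj_x Y (polar_map Y q) = proj_x Y q"
  by (simp add: vec_eq_iff polar_map_nth)

lemma proj_x_polar_deriv [simp]: "proj_x Y (polar_deriv Y q w) = proj_x Y w"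
  by (simp add: vec_eq_iff polar_deriv_nth)

text \<open>
  For positive radii this is an equality, the coordinate expression of \<open>4 dr^2 + r^6 d\<theta>^2\<close>; where a
  radius vanishes the left-hand side contributes nothing in that plane.
\<close>

lemma cusp_form_polar_map_le:
  assumes "\<And>j. j \<in> Y \<Longrightarrow> 0 \<le> q $ j $ 1"
  shows "cusp_form Y (polar_map Y q) (polar_deriv Y q w) (polar_deriv Y q w)
     \<le> (\<Sum>j\<in>Y. 4 * (w $ j $ 1)\<^sup>2 + (q $ j $ 1) ^ 6 * (w $ j $ 2)\<^sup>2)"
  unfolding cusp_form_def
proof (rule sum_mono)
  fix j assume j: "j \<in> Y"
  let ?z = "polar_map Y q $ j" and ?v = "polar_deriv Y q w $ j"
  show "4 * dr_form ?z ?v * dr_form ?z ?v + norm ?z ^ 6 * dtheta_form ?z ?v * dtheta_form ?z ?v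
      \<le> 4 * (w $ j $ 1)\<^sup>2 + (q $ j $ 1) ^ 6 * (w $ j $ 2)\<^sup>2"
  proof (cases "q $ j $ 1 = 0")
    case True
    then have "?z = 0" using j by (simp add: polar_map_nth)
    then show ?thesis by (simp add: dr_form_def)
  next
    case False
    define c s where "c = cos (q $ j $ 2)" and "s = sin (q $ j $ 2)"
    have cs: "c * c + s * s = 1" unfolding c_def s_def by (simp add: power2_eq_square[symmetric])
    have n: "norm ?z = q $ j $ 1" using assms[OF j] j by (simp add: norm_polar_map_nth)
    have "?z \<bullet> ?v = (q $ j $ 1 * w $ j $ 1) * (c * c + s * s)"
      using j by (simp add: polar_map_nth polar_deriv_nth inner_vec_def sum_2 c_def[symmetric] s_def[symmetric] algebra_simps)
    then have 1: "dr_form ?z ?v = w $ j $ 1"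
      using False by (simp add: dr_form_def n cs)
    have "?z $ 1 * ?v $ 2 - ?z $ 2 * ?v $ 1 = (q $ j $ 1)\<^sup>2 * w $ j $ 2 * (c * c + s * s)"
      using j by (simp add: polar_map_nth polar_deriv_nth c_def[symmetric] s_def[symmetric] algebra_simps power2_eq_square)
    then have 2: "dtheta_form ?z ?v = w $ j $ 2"
      using False by (simp add: dtheta_form_def n cs)
    show ?thesis unfolding 1 2 n by (simp add: power2_eq_square)
  qed
qed

section \<open>Comparison with the product form up to the strata\<close>

text \<open>
  A direction that leaves every stratum through \<open>p\<close> at once. In the planes with \<open>p $ j = 0\<close> it is
  radial at angle \<open>0\<close>, so the segment in this direction is a segment in polar coordinates too.
\<close>

definition axis_escape :: "'k::finite set \<Rightarrow> real^2^'k \<Rightarrow> real^2^'k"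
  where "axis_escape Y p = (\<chi> j. if j \<in> Y \<and> p $ j = 0 then vector [1, 0] else 0)"

lemma axis_escape_nth:
  "axis_escape Y p $ j = (if j \<in> Y \<and> p $ j = 0 then vector [1, 0] else 0)"
  by (simp add: axis_escape_def)

lemma proj_x_axis_escape [simp]: "proj_x Y (axis_escape Y p) = 0"
  by (simp add: vec_eq_iff axis_escape_nth)

lemma regular_axis_escape:
  assumes "s > 0" shows "p + s *\<^sub>R axis_escape Y p \<in> regular_set Y"
  using assms by (auto simp: regular_set_def axis_escape_nth vec_eq_iff forall_2)

lemma stratum_tangent_regular: "p \<in> regular_set Y \<Longrightarrow> u \<in> stratum_tangent Y p"
  by (auto simp: regular_set_def stratum_tangent_def)

text \<open>
  The polar lift of the segment \<open>p + s *\<^sub>R axis_escape Y p\<close> only varies the vanishing radii. If \<open>u\<close> is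
  radial in these planes, then \<open>u\<close> is the image of one and the same polar vector \<open>w\<close> all along the
  segment, and continuity of the polar tensor at the fixed vector \<open>w\<close> applies. This serves twice: for \<open>u\<close>
  tangent to the stratum it expresses \<open>g p u u\<close> as a limit of regular values, and for the direction
  of the segment itself it bounds the speed of a curve leaving the stratum.
\<close>

lemma tensor_continuous_along_escape:
  assumes pol: "polar_continuous_on Y g U"
    and U: "\<And>s. s \<in> {0..b} \<Longrightarrow> p + s *\<^sub>R axis_escape Y p \<in> U"
    and u: "\<And>j. j \<in> Y \<Longrightarrow> p $ j = 0 \<Longrightarrow> u $ j $ 2 = 0"
  obtains H where "continuous_on {0..b} H"
    "\<And>s. s \<in> {0..b} \<Longrightarrow> 0 < s \<or> u \<in> stratum_tangent Y p \<Longrightarrow> g (p + s *\<^sub>R axis_escape Y p) u u = H s"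
proof -
  let ?z = "\<lambda>j. j \<in> Y \<and> p $ j = 0"
  obtain h :: "(real^2^'a) tensor2" where
    hc: "\<And>w w'. continuous_on (polar_domain Y U) (\<lambda>q. h q w w')" and
    hg: "\<And>q w w'. q \<in> polar_domain Y U \<Longrightarrow> polar_deriv Y q w \<in> stratum_tangent Y (polar_map Y q)
          \<Longrightarrow> polar_deriv Y q w' \<in> stratum_tangent Y (polar_map Y q)
          \<Longrightarrow> h q w w' = g (polar_map Y q) (polar_deriv Y q w) (polar_deriv Y q w')"
    using pol unfolding polar_continuous_on_def Let_def frechet_derivative_polar_map by metis
  have "\<exists>\<theta>. p $ j = norm (p $ j) *\<^sub>R vector [cos \<theta>, sin \<theta>]" for j
    by (metis real2_polar)
  then obtain \<theta> where \<theta>: "\<And>j. p $ j = norm (p $ j) *\<^sub>R vector [cos (\<theta> j), sin (\<theta> j)]"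
    by metis
  define q :: "real^2^'a" where
    "q = (\<chi> j. if j \<in> Y then if p $ j = 0 then 0 else vector [norm (p $ j), \<theta> j] else p $ j)"
  define w :: "real^2^'a" where
    "w = (\<chi> j. if j \<in> Y then if p $ j = 0 then vector [u $ j $ 1, 0]
            else vector [cos (\<theta> j) * u $ j $ 1 + sin (\<theta> j) * u $ j $ 2,
                 (cos (\<theta> j) * u $ j $ 2 - sin (\<theta> j) * u $ j $ 1) / norm (p $ j)] else u $ j)"
  let ?q = "\<lambda>s. q + s *\<^sub>R axis_escape Y p" and ?p = "\<lambda>s. p + s *\<^sub>R axis_escape Y p"
  have map: "polar_map Y (?q s) = ?p s" for s
  proof -
    have "polar_map Y (?q s) $ j = ?p s $ j" for j
      by (auto simp: polar_map_nth q_def axis_escape_nth \<theta>[symmetric])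
    then show ?thesis by (simp add: vec_eq_iff)
  qed
  have deriv: "polar_deriv Y (?q s) w = u" for s
  proof -
    have "polar_deriv Y (?q s) w $ j = u $ j" for j
    proof (cases "?z j \<or> j \<notin> Y")
      case True
      then show ?thesis using u[of j]
        by (auto simp: polar_deriv_nth q_def w_def axis_escape_nth vec_eq_iff forall_2)
    next
      case False
      define c s where "c = cos (\<theta> j)" and "s = sin (\<theta> j)"
      have cs: "c * c + s * s = 1" unfolding c_def s_def by (simp add: power2_eq_square[symmetric])
      have 1: "(c * x + s * y) * c - (c * y - s * x) * s = x" for x y
        using cs by algebra
      have 2: "(c * x + s * y) * s + (c * y - s * x) * c = y" for x y
        using cs by algebra
      show ?thesis using False 1 2
        by (auto simp: polar_deriv_nth q_def w_def axis_escape_nth vec_eq_iff forall_2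
            c_def[symmetric] s_def[symmetric])
    qed
    then show ?thesis by (simp add: vec_eq_iff)
  qed
  have dom: "?q s \<in> polar_domain Y U" if "s \<in> {0..b}" for s
  proof -
    have "polar_map Y (?q s) \<in> U"
      unfolding map by (rule U[OF that])
    then show ?thesis
      using that by (auto simp: polar_domain_def q_def axis_escape_nth)
  qed
  have "continuous_on {0..b} (\<lambda>s. h (?q s) w w)"
    by (rule continuous_on_compose2[OF hc[of w w], of "{0..b}" ?q])
       (use dom in \<open>auto intro!: continuous_intros\<close>)
  moreover have "g (?p s) u u = h (?q s) w w" if "s \<in> {0..b}" "0 < s \<or> u \<in> stratum_tangent Y p" for s
  proof -
    have "u \<in> stratum_tangent Y (?p s)"
    proof (cases "0 < s")
      case True
      then show ?thesis using regular_axis_escape stratum_tangent_regular by blast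
    qed (use that in auto)
    then show ?thesis
      using hg[OF dom[OF that(1)], of w w] by (simp add: map deriv)
  qed
  ultimately show thesis by (rule that)
qed

definition product_form :: "'k::finite set \<Rightarrow> (real^2^'k) tensor2 \<Rightarrow> real^2^'k \<Rightarrow> real^2^'k \<Rightarrow> real"
  where "product_form Y g p u = pullback_x Y g p u u + cusp_form Y p u u"

lemma cusp_form_nonneg: "0 \<le> cusp_form Y p u u"
proof -
  have "0 \<le> norm z ^ 6 * dtheta_form z v * dtheta_form z v" for z v
    by (metis mult.assoc mult_nonneg_nonneg norm_ge_zero zero_le_power zero_le_square)
  then show ?thesis
    unfolding cusp_form_def by (auto intro!: sum_nonneg add_nonneg_nonneg simp: mult.assoc)
qed

lemma inner_y_part: "(p - proj_x Y p) \<bullet> u = (\<Sum>j\<in>Y. p $ j \<bullet> u $ j)"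
  unfolding inner_vec_def by (auto intro!: sum.mono_neutral_cong_right)

text \<open>
  Up to normalisation this says \<open>4 d\<rho>^2 \<le> 4 dr^2 + r^6 d\<theta>^2\<close> for the norm \<open>\<rho>\<close> of the radius vector.
  Stating it through \<open>\<rho> d\<rho> = y \<bullet> dy\<close> avoids the singularity of \<open>d\<rho>\<close> at \<open>\<rho> = 0\<close>.
\<close>

lemma cusp_form_ge_radial:
  "4 * ((p - proj_x Y p) \<bullet> u)\<^sup>2 \<le> (radius_norm Y p)\<^sup>2 * cusp_form Y p u u"
proof -
  let ?d = "\<lambda>j. dr_form (p $ j) (u $ j)"
  have "((p - proj_x Y p) \<bullet> u)\<^sup>2 = (\<Sum>j\<in>Y. norm (p $ j) * ?d j)\<^sup>2"
    unfolding inner_y_part by (auto intro!: arg_cong[of _ _ "\<lambda>x. x\<^sup>2"] sum.cong simp: dr_form_def)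
  also have "\<dots> \<le> (\<Sum>j\<in>Y. (norm (p $ j))\<^sup>2) * (\<Sum>j\<in>Y. (?d j)\<^sup>2)"
    by (rule Cauchy_Schwarz_ineq_sum)
  also have "(\<Sum>j\<in>Y. (norm (p $ j))\<^sup>2) = (radius_norm Y p)\<^sup>2"
    by (simp add: radius_norm_def L2_set_def sum_nonneg)
  finally have "4 * ((p - proj_x Y p) \<bullet> u)\<^sup>2 \<le> (radius_norm Y p)\<^sup>2 * (\<Sum>j\<in>Y. 4 * (?d j)\<^sup>2)"
    by (simp add: sum_distrib_left[symmetric])
  also have "(\<Sum>j\<in>Y. 4 * (?d j)\<^sup>2) \<le> cusp_form Y p u u"
  proof -
    have "0 \<le> norm z ^ 6 * dtheta_form z v * dtheta_form z v" for z v
      by (metis mult.assoc mult_nonneg_nonneg norm_ge_zero zero_le_power zero_le_square)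
    then show ?thesis
      unfolding cusp_form_def by (intro sum_mono) (simp add: power2_eq_square)
  qed
  finally show ?thesis
    by (simp add: mult_left_mono)
qed

text \<open>
  In the planes in which the base point moves, a stratum-tangent vector has no component.
\<close>

lemma product_form_escape:
  assumes "u \<in> stratum_tangent Y p"
  shows "product_form Y g (p + s *\<^sub>R axis_escape Y p) u = product_form Y g p u"
proof -
  have "cusp_form Y (p + s *\<^sub>R axis_escape Y p) u u = cusp_form Y p u u"
    using assms unfolding cusp_form_def stratum_tangent_def
    by (intro sum.cong) (auto simp: axis_escape_nth dr_form_def dtheta_form_def)
  then show ?thesis
    by (simp add: product_form_def pullback_x_def)
qed

lemma pullback_x_pos:
  assumes g: "product_cuspidal_metric Y U g" and p: "proj_x Y p \<in> U"
  shows "0 \<le> pullback_x Y g p u u" "pullback_x Y g p u u = 0 \<Longrightarrow> proj_x Y u = 0"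
proof -
  have b: "bilinear (g (proj_x Y p))"
    using g p by (auto simp: product_cuspidal_metric_def symmetric_tensor_on_def)
  have pos: "0 < pullback_x Y g p u u" if "proj_x Y u \<noteq> 0"
    using g p that by (auto simp: product_cuspidal_metric_def x_restriction_riemannian_def pullback_x_def)
  show "0 \<le> pullback_x Y g p u u"
    using pos bilinear_lzero[OF b] by (cases "proj_x Y u = 0") (auto simp: pullback_x_def)
  show "pullback_x Y g p u u = 0 \<Longrightarrow> proj_x Y u = 0"
    using pos by fastforce
qed

lemma product_form_nonneg:
  assumes "product_cuspidal_metric Y U g" "proj_x Y p \<in> U"
  shows "0 \<le> product_form Y g p u"
  unfolding product_form_def
  by (intro add_nonneg_nonneg pullback_x_pos(1)[OF assms] cusp_form_nonneg)

text \<open>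
  On regular points this is the third condition on the metric. At a stratum both sides are limits along
  \<open>axis_escape\<close>: the product form is constant on that segment and the metric converges by polar
  continuity. The radius is also chosen such that \<open>1 - C * \<kappa>\<^sup>2\<close> stays bounded away from zero.
\<close>

lemma product_comparison_on_strata:
  assumes g: "product_cuspidal_metric Y U g" and q: "q \<in> U" "q \<in> x_axes Y"
  obtains C \<kappa> where "0 \<le> C" "0 < \<kappa>" "C * \<kappa>\<^sup>2 \<le> 1/2" "cball q \<kappa> \<subseteq> U"
    "\<And>p u. p \<in> cball q \<kappa> \<Longrightarrow> u \<in> stratum_tangent Y p \<Longrightarrow>
       \<bar>g p u u - product_form Y g p u\<bar> \<le> C * (radius_norm Y p)\<^sup>2 * product_form Y g p u"
proof -
  from g q obtain C0 where "\<forall>\<^sub>F p in nhds q. p \<in> regular_set Y \<longrightarrow>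
       (\<forall>u. \<bar>g p u u - product_form Y g p u\<bar> \<le> C0 * (radius_norm Y p)\<^sup>2 * product_form Y g p u)"
    unfolding product_cuspidal_metric_def product_form_def Let_def by blast
  then obtain d0 where d0: "d0 > 0" "\<And>p u. dist p q < d0 \<Longrightarrow> p \<in> regular_set Y \<Longrightarrow>
       \<bar>g p u u - product_form Y g p u\<bar> \<le> C0 * (radius_norm Y p)\<^sup>2 * product_form Y g p u"
    unfolding eventually_nhds_metric by blast
  have "open U" and pol: "polar_continuous_on Y g U"
    using g by (auto simp: product_cuspidal_metric_def)
  then obtain d1 where d1: "d1 > 0" "cball q d1 \<subseteq> U"
    using q open_contains_cball by blast
  define C where "C = max C0 1"
  define \<kappa> where "\<kappa> = Min {d0 / 2, d1, 1, 1 / (2 * C)}"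
  have C: "C \<ge> 1" "C \<ge> C0" by (auto simp: C_def)
  have \<kappa>: "0 < \<kappa>" "\<kappa> < d0" "\<kappa> \<le> d1" "\<kappa> \<le> 1" "\<kappa> \<le> 1 / (2 * C)"
    using d0(1) d1(1) C by (auto simp: \<kappa>_def min_less_iff_disj min_le_iff_disj)
  have *: "\<bar>g p u u - product_form Y g p u\<bar> \<le> C * (radius_norm Y p)\<^sup>2 * product_form Y g p u"
    if p: "p \<in> cball q \<kappa>" and u: "u \<in> stratum_tangent Y p" for p u
  proof -
    have "isCont (\<lambda>s::real. p + s *\<^sub>R axis_escape Y p) 0" by (intro continuous_intros)
    then have lim: "((\<lambda>s::real. p + s *\<^sub>R axis_escape Y p) \<longlongrightarrow> p) (at 0)"
      by (simp add: isCont_def)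
    have "p \<in> ball q d0 \<inter> U"
      using p \<kappa> d1 by (auto simp: dist_commute)
    then have "\<forall>\<^sub>F s in at 0. p + s *\<^sub>R axis_escape Y p \<in> ball q d0 \<inter> U"
      using \<open>open U\<close> by (intro topological_tendstoD[OF lim]) auto
    then obtain b0 where b0: "b0 > 0"
      "\<And>s. s \<noteq> 0 \<Longrightarrow> dist s 0 < b0 \<Longrightarrow> p + s *\<^sub>R axis_escape Y p \<in> ball q d0 \<inter> U"
      unfolding eventually_at by blast
    define b where "b = b0 / 2"
    have in_U: "p + s *\<^sub>R axis_escape Y p \<in> ball q d0 \<inter> U" if "s \<in> {0..b}" for s
    proof (cases "s = 0")
      case True
      then show ?thesis using \<open>p \<in> ball q d0 \<inter> U\<close> by simp
    next
      case False
      then show ?thesis using that b0 by (intro b0(2)) (auto simp: b_def)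
    qed
    have b: "b > 0" using b0 by (simp add: b_def)
    have in_U': "p + s *\<^sub>R axis_escape Y p \<in> U" if "s \<in> {0..b}" for s
      using in_U[OF that] by simp
    have u2: "u $ j $ 2 = 0" if "j \<in> Y" "p $ j = 0" for j
      using u that by (simp add: stratum_tangent_def)
    obtain H where H1: "continuous_on {0..b} H" and
      H2: "\<And>s. s \<in> {0..b} \<Longrightarrow> 0 < s \<or> u \<in> stratum_tangent Y p \<Longrightarrow> g (p + s *\<^sub>R axis_escape Y p) u u = H s"
      by (rule tensor_continuous_along_escape[OF pol in_U' u2]) auto
    have H: "g (p + s *\<^sub>R axis_escape Y p) u u = H s" if "s \<in> {0..b}" for s
      by (rule H2[OF that]) (use u in simp)
    let ?G = "product_form Y g p u"
    have *: "\<bar>H s - ?G\<bar> \<le> C * (radius_norm Y (p + s *\<^sub>R axis_escape Y p))\<^sup>2 * ?G"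
      if s: "s \<in> {0<..b}" for s
    proof -
      have "proj_x Y p \<in> U"
        using dist_proj_x_le[OF q(2), of p] p \<kappa> d1 by auto
      note G = product_form_nonneg[OF g this, of u]
      have "\<bar>H s - ?G\<bar> \<le> C0 * (radius_norm Y (p + s *\<^sub>R axis_escape Y p))\<^sup>2 * ?G"
        using d0(2)[of "p + s *\<^sub>R axis_escape Y p" u] in_U[of s] s regular_axis_escape[of s p Y] H[of s]
        by (auto simp: product_form_escape[OF u] dist_commute)
      also have "\<dots> \<le> C * (radius_norm Y (p + s *\<^sub>R axis_escape Y p))\<^sup>2 * ?G"
        using C G by (intro mult_right_mono) auto
      finally show ?thesis .
    qed
    have "continuous (at 0 within {0..b}) H"
      using H1 b by (simp add: continuous_on_eq_continuous_within)
    then have "(H \<longlongrightarrow> H 0) (at 0 within {0..b})"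
      by (simp add: continuous_within)
    then have "(H \<longlongrightarrow> H 0) (at_right 0)"
      using b by (simp add: at_within_Icc_at_right)
    then have l1: "((\<lambda>s. \<bar>H s - ?G\<bar>) \<longlongrightarrow> \<bar>H 0 - ?G\<bar>) (at_right 0)"
      by (intro tendsto_intros)
    let ?R = "\<lambda>s. C * (radius_norm Y (p + s *\<^sub>R axis_escape Y p))\<^sup>2 * ?G"
    have "continuous_on UNIV ?R"
      by (intro continuous_intros)
    then have "continuous (at 0) ?R"
      by (simp add: continuous_on_eq_continuous_at)
    then have "(?R \<longlongrightarrow> ?R 0) (at_right 0)"
      by (rule continuous_within[THEN iffD1, OF continuous_at_imp_continuous_at_within])
    then have l2: "(?R \<longlongrightarrow> C * (radius_norm Y p)\<^sup>2 * ?G) (at_right 0)"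
      by (simp only: scaleR_zero_left add_0_right)
    have ev: "\<forall>\<^sub>F s in at_right 0. \<bar>H s - ?G\<bar> \<le> ?R s"
      unfolding eventually_at_right[OF b] using b * by (intro exI[of _ b]) auto
    have "\<bar>H 0 - ?G\<bar> \<le> C * (radius_norm Y p)\<^sup>2 * ?G"
      by (rule tendsto_le[OF _ l2 l1 ev]) simp
    then show ?thesis using H[of 0] b by simp
  qed
  have "C * \<kappa>\<^sup>2 \<le> C * (1 * (1 / (2 * C)))"
    unfolding power2_eq_square using C \<kappa> by (intro mult_left_mono mult_mono) auto
  then have "C * \<kappa>\<^sup>2 \<le> 1/2" using C by simp
  then show thesis
    by (intro that[of C \<kappa>] *) (use C \<kappa> d1 in auto)
qed

section \<open>Lengths and splicing of curves\<close>

text \<open>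
  Putting the end points into the exceptional set makes the set of smooth times open, so that curves
  can be modified locally without regard to one-sided derivatives.
\<close>

lemma piecewise_C1_on_Icc_iff:
  "f piecewise_C1_differentiable_on {a..b::real} \<longleftrightarrow>
     continuous_on {a..b} f \<and> (\<exists>S. finite S \<and> f C1_differentiable_on ({a<..<b} - S))"
proof -
  have "f C1_differentiable_on ({a<..<b} - S)" if "f C1_differentiable_on ({a..b} - S)" for S
    using that by (rule C1_differentiable_on_subset) auto
  moreover have "f C1_differentiable_on ({a..b} - (S \<union> {a, b}))" if "f C1_differentiable_on ({a<..<b} - S)" for S
    using that by (rule C1_differentiable_on_subset) auto
  ultimately show ?thesis
    unfolding piecewise_C1_differentiable_on_def by (meson finite.emptyI finite_UnI finite_insert)
qed

text \<open>
  A countable base assigns to every point a basic open set isolating it.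
\<close>

lemma countable_if_no_limit_point_inside:
  fixes T :: "'a::second_countable_topology set"
  assumes "\<And>t. t \<in> T \<Longrightarrow> \<not> t islimpt T"
  shows "countable T"
proof -
  obtain \<B> :: "'a set set" where \<B>: "countable \<B>"
    "\<And>S. open S \<Longrightarrow> \<exists>\<U>. \<U> \<subseteq> \<B> \<and> S = \<Union>\<U>"
    by (metis univ_second_countable)
  have "\<exists>C\<in>\<B>. C \<inter> T = {t}" if t: "t \<in> T" for t
  proof -
    have "\<exists>W. t \<in> W \<and> open W \<and> (\<forall>y\<in>T. y \<in> W \<longrightarrow> y = t)"
      using assms[OF t] by (simp add: islimpt_def)
    then obtain W where W: "open W" "t \<in> W" "\<forall>y\<in>T. y \<in> W \<longrightarrow> y = t"
      by blast
    obtain \<U> where \<U>: "\<U> \<subseteq> \<B>" "W = \<Union>\<U>"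
      using \<B>(2)[OF W(1)] by blast
    then obtain C where C: "C \<in> \<U>" "t \<in> C"
      using W(2) by blast
    then have "C \<subseteq> W"
      unfolding \<U>(2) by (simp add: Union_upper)
    have "C \<inter> T \<subseteq> {t}"
    proof
      fix y assume "y \<in> C \<inter> T"
      with \<open>C \<subseteq> W\<close> have "y \<in> T" "y \<in> W" by auto
      with W(3) show "y \<in> {t}" by blast
    qed
    then have "C \<inter> T = {t}"
      using C(2) t by blast
    then show ?thesis
      using C \<U>(1) by blast
  qed
  then have *: "\<And>t. t \<in> T \<Longrightarrow> \<exists>C\<in>\<B>. C \<inter> T = {t}" .
  have "T \<subseteq> (\<lambda>C. the_elem (C \<inter> T)) ` \<B>"
  proof
    fix t assume "t \<in> T"
    from *[OF this] obtain C where "C \<in> \<B>" "C \<inter> T = {t}" ..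
    then show "t \<in> (\<lambda>C. the_elem (C \<inter> T)) ` \<B>"
      by (intro image_eqI[of _ _ C]) simp_all
  qed
  then show ?thesis
    using \<B>(1) countable_subset by blast
qed

lemma countable_simple_zeros:
  fixes f :: "real \<Rightarrow> real"
  shows "countable {t. f t = 0 \<and> (\<exists>d. d \<noteq> 0 \<and> (f has_real_derivative d) (at t))}" (is "countable ?T")
proof (rule countable_if_no_limit_point_inside)
  fix t assume "t \<in> ?T"
  then obtain d where d: "f t = 0" "d \<noteq> 0" "(f has_real_derivative d) (at t)"
    by auto
  then have "((\<lambda>s. (f s - f t) / (s - t)) \<longlongrightarrow> d) (at t)"
    by (simp add: has_field_derivative_iff)
  then have "\<forall>\<^sub>F s in at t. (f s - f t) / (s - t) \<noteq> 0"
    using d(2) by (rule tendsto_imp_eventually_ne)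
  then have "\<forall>\<^sub>F s in at t. s \<notin> ?T"
    by eventually_elim (use d(1) in auto)
  then show "\<not> t islimpt ?T"
    by (simp add: islimpt_iff_eventually)
qed

text \<open>
  A coordinate that vanishes at some time with nonzero derivative does not vanish at nearby times;
  such times are isolated and hence countable.
\<close>

lemma AE_velocity_stratum_tangent:
  fixes \<gamma> :: "real \<Rightarrow> real^2^'k::finite"
  assumes diff: "\<And>t. t \<in> T \<Longrightarrow> \<gamma> differentiable at t"
  shows "AE t in lborel. t \<in> T \<longrightarrow> vector_derivative \<gamma> (at t) \<in> stratum_tangent Y (\<gamma> t)"
proof -
  let ?Z = "\<lambda>j k. {t. \<gamma> t $ j $ k = 0 \<and> (\<exists>d. d \<noteq> 0 \<and> ((\<lambda>t. \<gamma> t $ j $ k) has_real_derivative d) (at t))}"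
  have "countable (\<Union>j. \<Union>k. ?Z j k)"
    by (intro countable_UN countable_simple_zeros) auto
  then have "AE t in lborel. t \<notin> (\<Union>j. \<Union>k. ?Z j k)"
    by (intro AE_not_in countable_imp_null_set_lborel)
  then show ?thesis
  proof eventually_elim
    case (elim t)
    show ?case
    proof
      assume t: "t \<in> T"
      let ?v = "vector_derivative \<gamma> (at t)"
      have v: "(\<gamma> has_vector_derivative ?v) (at t)"
        using diff[OF t] vector_derivative_works by blast
      have "?v $ j = 0" if "\<gamma> t $ j = 0" for j
      proof -
        have "?v $ j $ k = 0" for k
        proof (rule ccontr)
          assume nz: "?v $ j $ k \<noteq> 0"
          have "((\<lambda>t. \<gamma> t $ j $ k) has_vector_derivative ?v $ j $ k) (at t)"
            by (rule bounded_linear.has_vector_derivative[OF _ v])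
              (intro bounded_linear_compose[OF bounded_linear_vec_nth bounded_linear_vec_nth])
          then have "t \<in> ?Z j k"
            using that nz by (auto simp: has_real_derivative_iff_has_vector_derivative)
          with elim show False by blast
        qed
        then show ?thesis by (simp add: vec_eq_iff)
      qed
      then show "?v \<in> stratum_tangent Y (\<gamma> t)"
        by (simp add: stratum_tangent_def)
    qed
  qed
qed

definition arc_length :: "'a::real_normed_vector tensor2 \<Rightarrow> (real \<Rightarrow> 'a) \<Rightarrow> real \<Rightarrow> real \<Rightarrow> ennreal"
  where "arc_length g \<gamma> a b =
    (\<integral>\<^sup>+ t\<in>{a..b}. ennreal (sqrt (g (\<gamma> t) (vector_derivative \<gamma> (at t)) (vector_derivative \<gamma> (at t)))) \<partial>lborel)"

lemma curve_length_eq_arc_length: "curve_length g \<gamma> = arc_length g \<gamma> 0 1"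
  by (simp add: curve_length_def arc_length_def)

lemma arc_length_combine:
  "a \<le> c \<Longrightarrow> c \<le> b \<Longrightarrow> arc_length g \<gamma> a b = arc_length g \<gamma> a c + arc_length g \<gamma> c b"
  unfolding arc_length_def by (rule nn_integral_Icc_combine)

lemma vector_derivative_cong_on_open:
  assumes "open T" "t \<in> T" "\<And>s. s \<in> T \<Longrightarrow> f s = h s"
  shows "vector_derivative f (at t) = vector_derivative h (at t)"
proof -
  have "(f has_vector_derivative v) (at t) \<longleftrightarrow> (h has_vector_derivative v) (at t)" for v
    using has_vector_derivative_transform_within_open[OF _ assms(1,2)] assms(3) by metis
  then show ?thesis
    by (simp add: vector_derivative_def)
qed

lemma arc_length_cong:
  assumes "\<And>t. t \<in> {a<..<b} \<Longrightarrow> \<gamma> t = \<sigma> t"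
  shows "arc_length g \<gamma> a b = arc_length g \<sigma> a b"
proof -
  have "vector_derivative \<gamma> (at t) = vector_derivative \<sigma> (at t)" if "t \<in> {a<..<b}" for t
    using assms that by (intro vector_derivative_cong_on_open[of "{a<..<b}"]) auto
  then show ?thesis
    unfolding arc_length_def nn_integral_Icc_eq_Ioo[of "{}", simplified]
    using assms by (intro nn_integral_cong) (auto split: split_indicator)
qed

lemma C1_differentiable_on_cong_open:
  assumes "open T" "\<And>t. t \<in> T \<Longrightarrow> f t = h t" "f C1_differentiable_on T"
  shows "h C1_differentiable_on T"
  using assms unfolding C1_differentiable_on_def
  by (metis has_vector_derivative_transform_within_open)

lemma C1_differentiable_on_Un_open:
  assumes "open S" "open T" "f C1_differentiable_on S" "f C1_differentiable_on T"
  shows "f C1_differentiable_on (S \<union> T)"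
  using assms unfolding C1_differentiable_on_eq by (auto intro: continuous_on_open_Un)

lemma replace_subarc:
  fixes \<gamma> \<tau> :: "real \<Rightarrow> 'a::real_normed_vector"
  assumes \<gamma>: "curve_in U \<gamma>" and ab: "0 \<le> a" "a < b" "b \<le> 1"
    and S: "finite S" and \<tau>: "continuous_on {a..b} \<tau>" "\<tau> C1_differentiable_on ({a<..<b} - S)"
    and ends: "\<tau> a = \<gamma> a" "\<tau> b = \<gamma> b" and U: "\<tau> ` {a..b} \<subseteq> U"
  defines "\<sigma> \<equiv> \<lambda>t. if t \<in> {a..b} then \<tau> t else \<gamma> t"
  shows "curve_in U \<sigma>" "pathstart \<sigma> = pathstart \<gamma>" "pathfinish \<sigma> = pathfinish \<gamma>"
    "curve_length g \<gamma> = arc_length g \<gamma> 0 a + arc_length g \<gamma> a b + arc_length g \<gamma> b 1"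
    "curve_length g \<sigma> = arc_length g \<gamma> 0 a + arc_length g \<tau> a b + arc_length g \<gamma> b 1"
proof -
  obtain S0 where \<gamma>c: "continuous_on {0..1} \<gamma>" and S0: "finite S0" "\<gamma> C1_differentiable_on ({0<..<1} - S0)"
    using \<gamma> unfolding curve_in_def piecewise_C1_on_Icc_iff by blast
  show "pathstart \<sigma> = pathstart \<gamma>" "pathfinish \<sigma> = pathfinish \<gamma>"
    using ab ends by (auto simp: \<sigma>_def pathstart_def pathfinish_def)
  have split: "curve_length g f = arc_length g f 0 a + arc_length g f a b + arc_length g f b 1" for f
    unfolding curve_length_eq_arc_length
    using arc_length_combine[of 0 a 1 g f] arc_length_combine[of a b 1 g f] ab by (simp add: add.assoc)
  show "curve_length g \<gamma> = arc_length g \<gamma> 0 a + arc_length g \<gamma> a b + arc_length g \<gamma> b 1"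
    by (rule split)
  have "arc_length g \<sigma> 0 a = arc_length g \<gamma> 0 a" "arc_length g \<sigma> a b = arc_length g \<tau> a b"
    "arc_length g \<sigma> b 1 = arc_length g \<gamma> b 1"
    by (auto intro!: arc_length_cong simp: \<sigma>_def)
  then show "curve_length g \<sigma> = arc_length g \<gamma> 0 a + arc_length g \<tau> a b + arc_length g \<gamma> b 1"
    by (simp add: split)
  have "continuous_on ({0..a} \<union> ({a..b} \<union> {b..1})) \<sigma>"
  proof (intro continuous_on_closed_Un)
    show "continuous_on {0..a} \<sigma>"
      by (rule continuous_on_eq[of _ \<gamma>]) (use ab ends in \<open>auto simp: \<sigma>_def intro: continuous_on_subset[OF \<gamma>c]\<close>)
    show "continuous_on {a..b} \<sigma>"
      by (rule continuous_on_eq[OF \<tau>(1)]) (auto simp: \<sigma>_def)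
    show "continuous_on {b..1} \<sigma>"
      by (rule continuous_on_eq[of _ \<gamma>]) (use ab ends in \<open>auto simp: \<sigma>_def intro: continuous_on_subset[OF \<gamma>c]\<close>)
  qed auto
  moreover have "{0..a} \<union> ({a..b} \<union> {b..1}) = {0..1}"
    using ab by auto
  ultimately have "continuous_on {0..1} \<sigma>" by simp
  moreover have "\<sigma> C1_differentiable_on (({a<..<b} - S) \<union> (({0<..<a} - S0) \<union> ({b<..<1} - S0)))"
  proof (intro C1_differentiable_on_Un_open)
    show "\<sigma> C1_differentiable_on ({a<..<b} - S)"
      by (rule C1_differentiable_on_cong_open[OF _ _ \<tau>(2)])
        (use S in \<open>auto simp: \<sigma>_def intro!: open_Diff finite_imp_closed\<close>)
    show "\<sigma> C1_differentiable_on ({0<..<a} - S0)"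
      by (rule C1_differentiable_on_cong_open[of _ \<gamma>])
        (use S0 ab in \<open>auto simp: \<sigma>_def intro!: open_Diff finite_imp_closed intro: C1_differentiable_on_subset\<close>)
    show "\<sigma> C1_differentiable_on ({b<..<1} - S0)"
      by (rule C1_differentiable_on_cong_open[of _ \<gamma>])
        (use S0 ab in \<open>auto simp: \<sigma>_def intro!: open_Diff finite_imp_closed intro: C1_differentiable_on_subset\<close>)
  qed (use S S0 in \<open>auto intro!: open_Diff finite_imp_closed\<close>)
  then have "\<sigma> C1_differentiable_on ({0<..<1} - (S \<union> S0 \<union> {a, b}))"
    by (rule C1_differentiable_on_subset) auto
  ultimately have "\<sigma> piecewise_C1_differentiable_on {0..1}"
    unfolding piecewise_C1_on_Icc_iff using S S0 by (metis finite.emptyI finite_UnI finite_insert)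
  moreover have "path_image \<sigma> \<subseteq> U"
    using \<gamma> U by (force simp: curve_in_def path_image_def \<sigma>_def)
  ultimately show "curve_in U \<sigma>"
    by (simp add: curve_in_def)
qed

lemma nonneg_deriv_mono:
  fixes F :: "real \<Rightarrow> real"
  assumes "a \<le> b" "finite S" "continuous_on {a..b} F"
    and "\<And>t. t \<in> {a<..<b} - S \<Longrightarrow> (F has_real_derivative F' t) (at t)"
    and "\<And>t. t \<in> {a<..<b} - S \<Longrightarrow> 0 \<le> F' t"
  shows "F a \<le> F b"
proof -
  have "(F' has_integral (F b - F a)) {a..b}"
    using assms by (intro fundamental_theorem_of_calculus_interior_strong[of S])
      (auto simp: has_real_derivative_iff_has_vector_derivative)
  then have "((\<lambda>t. if t \<in> {a<..<b} - S then F' t else 0) has_integral (F b - F a)) {a..b}"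
    using assms(2) by (elim has_integral_spike[of "S \<union> {a,b}", rotated 2]) auto
  then have "0 \<le> F b - F a"
    by (rule has_integral_nonneg) (use assms(5) in auto)
  then show ?thesis by simp
qed

lemma continuous_on_vector2 [continuous_intros]:
  fixes f h :: "'a::topological_space \<Rightarrow> real"
  assumes "continuous_on S f" "continuous_on S h"
  shows "continuous_on S (\<lambda>s. vector [f s, h s] :: real^2)"
proof -
  have "vector [f s, h s] = f s *\<^sub>R axis 1 1 + h s *\<^sub>R (axis 2 1 :: real^2)" for s
    by (simp add: vec_eq_iff forall_2 axis_def)
  then show ?thesis
    using assms by (auto intro!: continuous_intros)
qed

lemma continuous_on_polar_deriv [continuous_intros]:
  fixes f h :: "'a::t2_space \<Rightarrow> real^2^'k::finite"
  assumes "continuous_on S f" "continuous_on S h"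
  shows "continuous_on S (\<lambda>s. polar_deriv Y (f s) (h s))"
  unfolding polar_deriv_def
proof (intro continuous_on_vec_lambda)
  fix i
  show "continuous_on S (\<lambda>s. if i \<in> Y then h s $ i $ 1 *\<^sub>R vector [cos (f s $ i $ 2), sin (f s $ i $ 2)] +
            (f s $ i $ 1 * h s $ i $ 2) *\<^sub>R vector [- sin (f s $ i $ 2), cos (f s $ i $ 2)] else h s $ i)"
    by (cases "i \<in> Y"; simp only: if_True if_False; intro continuous_intros assms)
qed

section \<open>Length estimates near a point of the x-axes\<close>

text \<open>
  A closed ball about a point of the x-axes on which metric and product form are uniformly
  comparable. The bound \<open>1/2\<close> keeps \<open>sqrt (1 - C * \<delta>\<^sup>2)\<close> real and away from zero for \<open>\<delta> \<le> \<kappa>\<close>.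
\<close>

locale cuspidal_ball =
  fixes Y :: "'k::finite set" and U :: "(real^2^'k) set" and g :: "(real^2^'k) tensor2"
    and q :: "real^2^'k" and \<kappa> C :: real
  assumes metric: "product_cuspidal_metric Y U g"
    and q_axes: "q \<in> x_axes Y"
    and C_nonneg: "0 \<le> C" and \<kappa>_pos: "0 < \<kappa>" and C\<kappa>: "C * \<kappa>\<^sup>2 \<le> 1/2"
    and ball: "cball q \<kappa> \<subseteq> U"
    and compare: "\<And>p u. p \<in> cball q \<kappa> \<Longrightarrow> u \<in> stratum_tangent Y p \<Longrightarrow>
       \<bar>g p u u - product_form Y g p u\<bar> \<le> C * (radius_norm Y p)\<^sup>2 * product_form Y g p u"

lemma cuspidal_ball_exists:
  assumes "product_cuspidal_metric Y U g" "q \<in> U" "q \<in> x_axes Y"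
  obtains \<kappa> C where "cuspidal_ball Y U g q \<kappa> C"
proof -
  obtain C \<kappa> where *: "0 \<le> C" "0 < \<kappa>" "C * \<kappa>\<^sup>2 \<le> 1/2" "cball q \<kappa> \<subseteq> U"
    "\<And>p u. p \<in> cball q \<kappa> \<Longrightarrow> u \<in> stratum_tangent Y p \<Longrightarrow>
       \<bar>g p u u - product_form Y g p u\<bar> \<le> C * (radius_norm Y p)\<^sup>2 * product_form Y g p u"
    using product_comparison_on_strata[OF assms] by metis
  show thesis
    by (rule that[of \<kappa> C], unfold_locales) (use assms * in auto)
qed

context cuspidal_ball begin

lemma proj_x_in_ball: "p \<in> cball q r \<Longrightarrow> proj_x Y p \<in> cball q r"
  using dist_proj_x_le[OF q_axes, of p] by auto

lemma proj_x_in_U: "p \<in> cball q \<kappa> \<Longrightarrow> proj_x Y p \<in> U"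
  using proj_x_in_ball ball by blast

lemma continuous_on_pullback:
  fixes f :: "'b::topological_space \<Rightarrow> real^2^'k"
  assumes f: "continuous_on W f" and u: "continuous_on W u" and W: "\<And>s. s \<in> W \<Longrightarrow> f s \<in> cball q \<kappa>"
  shows "continuous_on W (\<lambda>s. pullback_x Y g (f s) (u s) (u s))"
proof (rule continuous_on_tensor[where t = "pullback_x Y g" and f = f, OF _ _ u u])
  show "bilinear (pullback_x Y g (f s))" if "s \<in> W" for s
    using metric proj_x_in_U[OF W[OF that]]
    by (auto intro!: bilinear_pullback_x simp: product_cuspidal_metric_def symmetric_tensor_on_def)
  show "continuous_on W (\<lambda>s. pullback_x Y g (f s) a b)" for a b
  proof (rule continuous_on_compose2[OF smooth_on_imp_continuous_on f])
    show "smooth_on (\<lambda>p. pullback_x Y g p a b) {p. proj_x Y p \<in> U}"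
      using metric by (auto simp: product_cuspidal_metric_def x_restriction_riemannian_def)
    show "f ` W \<subseteq> {p. proj_x Y p \<in> U}"
      using W proj_x_in_U by blast
  qed
qed

lemma tensor_between_product_forms:
  assumes "p \<in> cball q \<kappa>" "u \<in> stratum_tangent Y p" "radius_norm Y p \<le> \<delta>"
  shows "g p u u \<le> (1 + C * \<delta>\<^sup>2) * product_form Y g p u"
    and "(1 - C * \<delta>\<^sup>2) * product_form Y g p u \<le> g p u u"
proof -
  have "(radius_norm Y p)\<^sup>2 \<le> \<delta>\<^sup>2"
    using assms(3) by (intro power_mono) auto
  then have "C * (radius_norm Y p)\<^sup>2 * product_form Y g p u \<le> C * \<delta>\<^sup>2 * product_form Y g p u"
    using C_nonneg product_form_nonneg[OF metric proj_x_in_U[OF assms(1)]]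
    by (intro mult_right_mono mult_left_mono) auto
  then have "\<bar>g p u u - product_form Y g p u\<bar> \<le> C * \<delta>\<^sup>2 * product_form Y g p u"
    using compare[OF assms(1,2)] by linarith
  then show "g p u u \<le> (1 + C * \<delta>\<^sup>2) * product_form Y g p u"
    and "(1 - C * \<delta>\<^sup>2) * product_form Y g p u \<le> g p u u"
    by (auto simp: abs_le_iff algebra_simps)
qed

text \<open>
  Each plane of a bridge turns by at most \<open>2 * pi\<close>, at a radius of at most \<open>\<delta>\<close>; summed over the planes the
  angular part of the metric is at most this constant times \<open>\<delta> ^ 6\<close>.
\<close>

definition cusp_const :: real where "cusp_const = 4 * pi\<^sup>2 * card Y"

text \<open>
  The upper estimate. The bridge lies over the given x-curve \<open>\<xi>\<close>, whose length is controlled by \<open>l\<close>. In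
  polar coordinates its radii and angles move linearly in a parameter \<open>lam\<close> that is essentially the
  length of the x-part; this is the straight line from \<open>(l a, R0)\<close> to \<open>(l b, R1)\<close> in the flat product of
  an interval with the quadrant of radii, and explains the shape of the bound. The number \<open>\<Lambda>\<close> exceeds the
  x-length in order to make \<open>lam\<close> strictly increasing even if the x-part is constant. Thus a radius
  vanishes inside only if it vanishes at both ends, which keeps the velocity stratum-tangent.
\<close>

lemma rotating_bridge:
  fixes \<xi> \<xi>' :: "real \<Rightarrow> real^2^'k" and l l' :: "real \<Rightarrow> real"
  assumes ab: "a < b" and S: "finite S"
    and \<xi>: "continuous_on {a..b} \<xi>" "\<And>t. t \<in> {a<..<b} - S \<Longrightarrow> (\<xi> has_vector_derivative \<xi>' t) (at t)"
      "continuous_on ({a<..<b} - S) \<xi>'"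
    and \<xi>x: "\<And>t. t \<in> {a..b} \<Longrightarrow> proj_x Y (\<xi> t) = \<xi> t"
      "\<And>t. t \<in> {a<..<b} - S \<Longrightarrow> proj_x Y (\<xi>' t) = \<xi>' t"
    and \<xi>q: "\<And>t. t \<in> {a..b} \<Longrightarrow> dist q (\<xi> t) \<le> \<kappa> / 2"
    and l: "continuous_on {a..b} l" "\<And>t. t \<in> {a<..<b} - S \<Longrightarrow> (l has_real_derivative l' t) (at t)"
      "continuous_on ({a<..<b} - S) l'"
    and ll: "\<And>t. t \<in> {a<..<b} - S \<Longrightarrow> sqrt (pullback_x Y g (\<xi> t) (\<xi>' t) (\<xi>' t)) \<le> l' t"
    and p0: "proj_x Y p0 = \<xi> a" "radius_norm Y p0 \<le> \<delta>"
    and p1: "proj_x Y p1 = \<xi> b" "radius_norm Y p1 \<le> \<delta>"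
    and \<delta>: "\<delta> \<le> \<kappa> / 2" and \<Lambda>: "l b - l a < \<Lambda>"
  obtains \<tau> where "continuous_on {a..b} \<tau>" "\<tau> C1_differentiable_on ({a<..<b} - S)"
    "\<tau> a = p0" "\<tau> b = p1" "\<tau> ` {a..b} \<subseteq> cball q \<kappa>"
    "\<And>t j. t \<in> {a<..<b} \<Longrightarrow> j \<in> Y \<Longrightarrow> p0 $ j \<noteq> 0 \<or> p1 $ j \<noteq> 0 \<Longrightarrow> \<tau> t $ j \<noteq> 0"
    "arc_length g \<tau> a b \<le> ennreal (sqrt (1 + C * \<delta>\<^sup>2) *
       sqrt (\<Lambda>\<^sup>2 + 4 * (\<Sum>j\<in>Y. (norm (p1 $ j) - norm (p0 $ j))\<^sup>2) + cusp_const * \<delta> ^ 6))"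
proof -
  have op: "open ({a<..<b} - S)"
    using S by (intro open_Diff finite_imp_closed) auto
  have inb: "proj_x Y (\<xi> t) \<in> U" if "t \<in> {a..b}" for t
    using \<xi>q[OF that] \<kappa>_pos by (intro proj_x_in_U) auto
  have l'_nonneg: "0 \<le> l' t" if "t \<in> {a<..<b} - S" for t
  proof -
    have "0 \<le> sqrt (pullback_x Y g (\<xi> t) (\<xi>' t) (\<xi>' t))"
      using that by (intro real_sqrt_ge_zero pullback_x_pos(1)[OF metric] inb) auto
    with ll[OF that] show ?thesis by linarith
  qed
  have l_mono: "l s \<le> l t" if "a \<le> s" "s \<le> t" "t \<le> b" for s t
    by (rule nonneg_deriv_mono[of s t S l l'])
      (use that S l(2) l'_nonneg in \<open>auto intro: continuous_on_subset[OF l(1)]\<close>)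
  \<comment> \<open>The excess of \<open>\<Lambda>\<close> is spread evenly over the interval, so that \<open>lam\<close> rises from \<open>0\<close> to \<open>1\<close>
    with speed at least \<open>\<eta> / \<Lambda>\<close>.\<close>
  define \<eta> where "\<eta> = (\<Lambda> - (l b - l a)) / (b - a)"
  have \<eta>: "\<eta> > 0" "\<eta> * (b - a) = \<Lambda> - (l b - l a)"
    using ab \<Lambda> by (auto simp: \<eta>_def)
  have \<Lambda>_pos: "\<Lambda> > 0" using \<Lambda> l_mono[of a b] ab by auto
  define lam where "lam t = (l t - l a + \<eta> * (t - a)) / \<Lambda>" for t
  define lam' where "lam' t = (l' t + \<eta>) / \<Lambda>" for t
  have lam_ends: "lam a = 0" "lam b = 1"
    using \<eta>(2) \<Lambda>_pos by (auto simp: lam_def)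
  have lam_c: "continuous_on {a..b} lam"
    unfolding lam_def using \<Lambda>_pos by (intro continuous_intros l(1)) auto
  have lam'_c: "continuous_on ({a<..<b} - S) lam'"
    unfolding lam'_def using \<Lambda>_pos by (intro continuous_intros l(3)) auto
  have lam_d: "(lam has_real_derivative lam' t) (at t)" if "t \<in> {a<..<b} - S" for t
    unfolding lam_def lam'_def using \<Lambda>_pos by (auto intro!: derivative_eq_intros l(2)[OF that])
  have lam_pos: "0 < lam t" if "t \<in> {a<..b}" for t
    using l_mono[of a t] that \<eta>(1) \<Lambda>_pos by (auto simp: lam_def intro!: divide_pos_pos add_nonneg_pos)
  have lam_lt: "lam t < 1" if "t \<in> {a..<b}" for t
  proof -
    have "\<eta> * (t - a) < \<eta> * (b - a)" using that \<eta>(1) by simp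
    then show ?thesis
      using l_mono[of t b] that \<eta>(2) \<Lambda>_pos by (auto simp: lam_def field_simps)
  qed
  have lam_01: "0 \<le> lam t" "lam t \<le> 1" if "t \<in> {a..b}" for t
    using lam_pos[of t] lam_lt[of t] lam_ends that by (cases "t = a"; cases "t = b"; force)+
  have lam'_nonneg: "0 \<le> lam' t" "l' t \<le> \<Lambda> * lam' t" if "t \<in> {a<..<b} - S" for t
    using l'_nonneg[OF that] \<eta>(1) \<Lambda>_pos by (auto simp: lam'_def)

  have "\<exists>\<theta>. 0 \<le> \<theta> \<and> \<theta> < 2 * pi \<and> z = norm z *\<^sub>R vector [cos \<theta>, sin \<theta>]" for z :: "real^2"
    by (metis real2_polar)
  then obtain ang :: "real^2 \<Rightarrow> real" where
    ang: "\<And>z. 0 \<le> ang z" "\<And>z. ang z < 2 * pi" "\<And>z. norm z *\<^sub>R vector [cos (ang z), sin (ang z)] = z"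
    by metis
  define lift :: "real^2^'k \<Rightarrow> real^2^'k" where
    "lift p = (\<chi> j. if j \<in> Y then vector [norm (p $ j), ang (p $ j)] else 0)" for p
  have lift_nth: "lift p $ j = (if j \<in> Y then vector [norm (p $ j), ang (p $ j)] else 0)" for p j
    by (simp add: lift_def)
  have proj_lift: "proj_x Y (lift p) = 0" for p
    by (simp add: vec_eq_iff lift_nth)
  let ?d = "lift p1 - lift p0"
  define Q where "Q t = \<xi> t + lift p0 + lam t *\<^sub>R ?d" for t
  define Q' where "Q' t = \<xi>' t + lam' t *\<^sub>R ?d" for t
  define \<tau> where "\<tau> = polar_map Y \<circ> Q"
  have \<xi>0: "\<xi> t $ j = 0" if "t \<in> {a..b}" "j \<in> Y" for t j
    using arg_cong[OF \<xi>x(1)[OF that(1)], of "\<lambda>p. p $ j"] that by simp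
  have \<xi>'0: "\<xi>' t $ j = 0" if "t \<in> {a<..<b} - S" "j \<in> Y" for t j
    using arg_cong[OF \<xi>x(2)[OF that(1)], of "\<lambda>p. p $ j"] that by simp
  let ?r = "\<lambda>t j. (1 - lam t) * norm (p0 $ j) + lam t * norm (p1 $ j)"
  have Q1: "Q t $ j $ 1 = ?r t j" if "t \<in> {a..b}" "j \<in> Y" for t j
    using \<xi>0[OF that] that by (simp add: Q_def lift_nth algebra_simps)
  have Q'1: "Q' t $ j $ 1 = lam' t * (norm (p1 $ j) - norm (p0 $ j))" if "t \<in> {a<..<b} - S" "j \<in> Y" for t j
    using \<xi>'0[OF that] that by (simp add: Q'_def lift_nth algebra_simps)
  have Q'2: "Q' t $ j $ 2 = lam' t * (ang (p1 $ j) - ang (p0 $ j))" if "t \<in> {a<..<b} - S" "j \<in> Y" for t j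
    using \<xi>'0[OF that] that by (simp add: Q'_def lift_nth algebra_simps)
  have r_nonneg: "0 \<le> ?r t j" if "t \<in> {a..b}" for t j
    using lam_01[OF that] by auto
  have norm_\<tau>: "norm (\<tau> t $ j) = ?r t j" if "t \<in> {a..b}" "j \<in> Y" for t j
    using Q1[OF that] r_nonneg[OF that(1), of j] that by (simp add: \<tau>_def norm_polar_map_nth)
  have proj_\<tau>: "proj_x Y (\<tau> t) = \<xi> t" if "t \<in> {a..b}" for t
    by (simp add: \<tau>_def Q_def proj_lift \<xi>x(1)[OF that])
  have \<rho>_\<tau>: "radius_norm Y (\<tau> t) \<le> \<delta>" if t: "t \<in> {a..b}" for t
  proof -
    have "radius_norm Y (\<tau> t) = L2_set (\<lambda>j. (1 - lam t) * norm (p0 $ j) + lam t * norm (p1 $ j)) Y"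
      unfolding radius_norm_def by (intro L2_set_cong refl norm_\<tau>[OF t])
    also have "\<dots> \<le> L2_set (\<lambda>j. (1 - lam t) * norm (p0 $ j)) Y + L2_set (\<lambda>j. lam t * norm (p1 $ j)) Y"
      by (rule L2_set_triangle_ineq)
    also have "\<dots> = (1 - lam t) * radius_norm Y p0 + lam t * radius_norm Y p1"
      using lam_01[OF t] by (simp add: L2_set_right_distrib radius_norm_def)
    also have "\<dots> \<le> (1 - lam t) * \<delta> + lam t * \<delta>"
      using lam_01[OF t] p0 p1 by (intro add_mono mult_left_mono) auto
    also have "\<dots> = \<delta>" by (simp add: algebra_simps)
    finally show ?thesis .
  qed
  have \<tau>_ball: "\<tau> t \<in> cball q \<kappa>" if t: "t \<in> {a..b}" for t
  proof -
    have "dist q (\<tau> t) \<le> dist q (proj_x Y (\<tau> t)) + dist (proj_x Y (\<tau> t)) (\<tau> t)"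
      by (rule dist_triangle)
    also have "dist (proj_x Y (\<tau> t)) (\<tau> t) = radius_norm Y (\<tau> t)"
      by (simp add: radius_norm_eq dist_norm norm_minus_commute)
    finally show ?thesis
      using \<rho>_\<tau>[OF t] \<xi>q[OF t] \<delta> by (simp add: proj_\<tau>[OF t])
  qed
  have Q_c: "continuous_on {a..b} Q"
    unfolding Q_def by (intro continuous_intros \<xi>(1) lam_c)
  have Q_d: "(Q has_vector_derivative Q' t) (at t)" if "t \<in> {a<..<b} - S" for t
    unfolding Q_def Q'_def
    by (auto intro!: derivative_eq_intros \<xi>(2)[OF that]
          lam_d[OF that])
  have Q'_c: "continuous_on ({a<..<b} - S) Q'"
    unfolding Q'_def by (intro continuous_intros \<xi>(3) lam'_c)
  let ?u = "\<lambda>t. polar_deriv Y (Q t) (Q' t)"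
  have \<tau>_d: "(\<tau> has_vector_derivative ?u t) (at t)" if "t \<in> {a<..<b} - S" for t
    unfolding \<tau>_def by (rule vector_derivative_diff_chain_within[OF Q_d[OF that] has_derivative_polar_map])
  have \<tau>_c: "continuous_on {a..b} \<tau>"
    unfolding \<tau>_def o_def by (intro continuous_intros Q_c)
  have \<tau>_C1: "\<tau> C1_differentiable_on ({a<..<b} - S)"
    unfolding C1_differentiable_on_def
  proof (intro exI[of _ ?u] conjI ballI)
    show "continuous_on ({a<..<b} - S) ?u"
      by (intro continuous_intros Q'_c continuous_on_subset[OF Q_c]) auto
  qed (rule \<tau>_d)
  have ends: "\<tau> a = p0" "\<tau> b = p1"
  proof -
    have "\<tau> a $ j = p0 $ j" "\<tau> b $ j = p1 $ j" for j
      using ab \<xi>0[of a j] \<xi>0[of b j] lam_ends arg_cong[OF p0(1), of "\<lambda>p. p $ j"] arg_cong[OF p1(1), of "\<lambda>p. p $ j"]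
      by (auto simp: \<tau>_def Q_def polar_map_nth lift_nth ang split: if_splits)
    then show "\<tau> a = p0" "\<tau> b = p1" by (auto simp: vec_eq_iff)
  qed
  have nonzero: "\<tau> t $ j \<noteq> 0" if "t \<in> {a<..<b}" "j \<in> Y" "p0 $ j \<noteq> 0 \<or> p1 $ j \<noteq> 0" for t j
  proof -
    have "0 < ?r t j"
      using lam_pos[of t] lam_lt[of t] that by (auto intro: add_pos_nonneg add_nonneg_pos)
    then show ?thesis using norm_\<tau>[of t j] that by force
  qed
  define D where "D = (\<Sum>j\<in>Y. (norm (p1 $ j) - norm (p0 $ j))\<^sup>2)"
  have \<delta>0: "0 \<le> \<delta>" using radius_norm_nonneg p0(2) by (rule order_trans)
  define M where "M = \<Lambda>\<^sup>2 + 4 * D + cusp_const * \<delta> ^ 6"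
  have "0 \<le> M"
    unfolding M_def D_def cusp_const_def using \<delta>0 by (intro add_nonneg_nonneg mult_nonneg_nonneg sum_nonneg) auto
  have bound: "sqrt (g (\<tau> t) (?u t) (?u t)) \<le> lam' t * (sqrt (1 + C * \<delta>\<^sup>2) * sqrt M)"
    if t: "t \<in> {a<..<b} - S" for t
  proof -
    have t': "t \<in> {a..b}" using t by auto
    have tang: "?u t \<in> stratum_tangent Y (\<tau> t)"
      unfolding stratum_tangent_def
    proof (intro CollectI ballI impI)
      fix j assume j: "j \<in> Y" "\<tau> t $ j = 0"
      have "p0 $ j = 0" "p1 $ j = 0" using nonzero[of t j] j t by auto
      then show "?u t $ j = 0"
        using j Q'1[OF t j(1)] Q1[OF t' j(1)] by (simp add: polar_deriv_nth)
    qed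
    have "pullback_x Y g (\<tau> t) (?u t) (?u t) = pullback_x Y g (\<xi> t) (\<xi>' t) (\<xi>' t)"
      using proj_\<tau>[OF t'] \<xi>x(1)[OF t'] \<xi>x(2)[OF t]
      by (simp add: pullback_x_def Q'_def proj_lift)
    also have "\<dots> \<le> (l' t)\<^sup>2"
      using ll[OF t] by (rule sqrt_le_D)
    \<comment> \<open>Dropping \<open>\<eta>\<close> makes every term a multiple of \<open>lam' t\<close>, so the bound has the primitive \<open>lam\<close>.\<close>
    also have "\<dots> \<le> (\<Lambda> * lam' t)\<^sup>2"
      using lam'_nonneg[OF t] l'_nonneg[OF t] by (intro power_mono) auto
    finally have 1: "pullback_x Y g (\<tau> t) (?u t) (?u t) \<le> \<Lambda>\<^sup>2 * (lam' t)\<^sup>2"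
      by (simp add: power_mult_distrib)
    have "cusp_form Y (\<tau> t) (?u t) (?u t)
        \<le> (\<Sum>j\<in>Y. 4 * (Q' t $ j $ 1)\<^sup>2 + (Q t $ j $ 1) ^ 6 * (Q' t $ j $ 2)\<^sup>2)"
      unfolding \<tau>_def o_def by (rule cusp_form_polar_map_le) (simp add: Q1[OF t'] r_nonneg[OF t'])
    also have "\<dots> \<le> (\<Sum>j\<in>Y. (4 * (norm (p1 $ j) - norm (p0 $ j))\<^sup>2 + 4 * pi\<^sup>2 * \<delta> ^ 6) * (lam' t)\<^sup>2)"
    proof (rule sum_mono)
      fix j assume j: "j \<in> Y"
      have "\<bar>ang (p1 $ j) - ang (p0 $ j)\<bar> \<le> 2 * pi"
        using ang(1,2)[of "p1 $ j"] ang(1,2)[of "p0 $ j"] by (simp add: abs_le_iff)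
      then have "(ang (p1 $ j) - ang (p0 $ j))\<^sup>2 \<le> (2 * pi)\<^sup>2"
        by (rule power2_le_iff_abs_le[THEN iffD2, rotated]) simp
      moreover have "(Q t $ j $ 1) ^ 6 \<le> \<delta> ^ 6"
      proof (rule power_mono)
        show "Q t $ j $ 1 \<le> \<delta>"
          using norm_le_radius_norm[OF j, of "\<tau> t"] \<rho>_\<tau>[OF t'] Q1[OF t' j] norm_\<tau>[OF t' j] by linarith
      qed (simp add: Q1[OF t' j] r_nonneg[OF t'])
      ultimately have "(Q t $ j $ 1) ^ 6 * (Q' t $ j $ 2)\<^sup>2 \<le> \<delta> ^ 6 * ((lam' t)\<^sup>2 * (2 * pi)\<^sup>2)"
        unfolding Q'2[OF t j] power_mult_distrib using \<delta>0
        by (intro mult_mono mult_left_mono) (auto simp: power_mult_distrib[symmetric])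
      then show "4 * (Q' t $ j $ 1)\<^sup>2 + (Q t $ j $ 1) ^ 6 * (Q' t $ j $ 2)\<^sup>2
          \<le> (4 * (norm (p1 $ j) - norm (p0 $ j))\<^sup>2 + 4 * pi\<^sup>2 * \<delta> ^ 6) * (lam' t)\<^sup>2"
        unfolding Q'1[OF t j] distrib_right power_mult_distrib by (simp add: mult_ac)
    qed
    also have "\<dots> = (4 * D + cusp_const * \<delta> ^ 6) * (lam' t)\<^sup>2"
      unfolding D_def cusp_const_def
      by (simp add: sum_distrib_right[symmetric] sum.distrib sum_distrib_left)
    finally have 2: "product_form Y g (\<tau> t) (?u t) \<le> M * (lam' t)\<^sup>2"
      using 1 unfolding product_form_def M_def by (simp add: algebra_simps)
    have "g (\<tau> t) (?u t) (?u t) \<le> (1 + C * \<delta>\<^sup>2) * product_form Y g (\<tau> t) (?u t)"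
      by (rule tensor_between_product_forms(1)[OF \<tau>_ball[OF t'] tang \<rho>_\<tau>[OF t']])
    also have "\<dots> \<le> (1 + C * \<delta>\<^sup>2) * (M * (lam' t)\<^sup>2)"
      using 2 C_nonneg by (intro mult_left_mono) auto
    finally have "sqrt (g (\<tau> t) (?u t) (?u t)) \<le> sqrt ((1 + C * \<delta>\<^sup>2) * (M * (lam' t)\<^sup>2))"
      by (rule real_sqrt_le_mono)
    also have "\<dots> = lam' t * (sqrt (1 + C * \<delta>\<^sup>2) * sqrt M)"
      using lam'_nonneg[OF t] by (simp add: real_sqrt_mult)
    finally show ?thesis .
  qed
  have "arc_length g \<tau> a b \<le> ennreal (lam b * (sqrt (1 + C * \<delta>\<^sup>2) * sqrt M) - lam a * (sqrt (1 + C * \<delta>\<^sup>2) * sqrt M))"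
    unfolding arc_length_def
  proof (rule nn_integral_le_antiderivative[where F' = "\<lambda>t. lam' t * (sqrt (1 + C * \<delta>\<^sup>2) * sqrt M)"])
    fix t assume t: "t \<in> {a<..<b} - S"
    show "((\<lambda>t. lam t * (sqrt (1 + C * \<delta>\<^sup>2) * sqrt M)) has_real_derivative lam' t * (sqrt (1 + C * \<delta>\<^sup>2) * sqrt M)) (at t)"
      by (rule DERIV_cmult_right[OF lam_d[OF t]])
    show "ennreal (sqrt (g (\<tau> t) (vector_derivative \<tau> (at t)) (vector_derivative \<tau> (at t))))
        \<le> ennreal (lam' t * (sqrt (1 + C * \<delta>\<^sup>2) * sqrt M))"
      unfolding vector_derivative_at[OF \<tau>_d[OF t]] by (intro ennreal_leI bound t)
    show "0 \<le> lam' t * (sqrt (1 + C * \<delta>\<^sup>2) * sqrt M)"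
      using lam'_nonneg[OF t] C_nonneg \<open>0 \<le> M\<close> by auto
  qed (use ab S in \<open>auto intro!: continuous_intros lam_c\<close>)
  then have "arc_length g \<tau> a b \<le> ennreal (sqrt (1 + C * \<delta>\<^sup>2) * sqrt M)"
    by (simp add: lam_ends)
  then show thesis
    using that[OF \<tau>_c \<tau>_C1 ends _ nonzero] \<tau>_ball unfolding M_def D_def by blast
qed


text \<open>
  The lower estimate: in the plane with coordinates \<open>(l, 2 \<rho>)\<close> the curve is at least as long as the
  segment between its ends. The speed is bounded below by its component in the direction \<open>(A, Z) / V\<close> of
  that segment, which is the derivative of an explicit function.
\<close>

lemma arc_length_ge_product:
  fixes \<gamma> :: "real \<Rightarrow> real^2^'k" and l l' :: "real \<Rightarrow> real"
  assumes ab: "a \<le> b" and S: "finite S"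
    and \<gamma>: "continuous_on {a..b} \<gamma>" "\<gamma> C1_differentiable_on ({a<..<b} - S)"
    and \<gamma>q: "\<gamma> ` {a..b} \<subseteq> cball q \<kappa>" and \<rho>\<delta>: "\<And>t. t \<in> {a..b} \<Longrightarrow> radius_norm Y (\<gamma> t) \<le> \<delta>"
    and \<delta>: "\<delta> \<le> \<kappa>"
    and l: "continuous_on {a..b} l" "\<And>t. t \<in> {a<..<b} - S \<Longrightarrow> (l has_real_derivative l' t) (at t)"
      "continuous_on ({a<..<b} - S) l'"
    and l'0: "\<And>t. t \<in> {a<..<b} - S \<Longrightarrow> 0 \<le> l' t"
    and ll: "\<And>t. t \<in> {a<..<b} - S \<Longrightarrow>
       l' t \<le> sqrt (pullback_x Y g (\<gamma> t) (vector_derivative \<gamma> (at t)) (vector_derivative \<gamma> (at t)))"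
  shows "ennreal (sqrt (1 - C * \<delta>\<^sup>2) *
       sqrt ((l b - l a)\<^sup>2 + 4 * (radius_norm Y (\<gamma> b) - radius_norm Y (\<gamma> a))\<^sup>2)) \<le> arc_length g \<gamma> a b"
proof -
  let ?\<gamma>' = "\<lambda>t. vector_derivative \<gamma> (at t)" and ?\<rho> = "\<lambda>t. radius_norm Y (\<gamma> t)"
  define A where "A = l b - l a"
  define Z where "Z = 2 * (?\<rho> b - ?\<rho> a)"
  define V where "V = sqrt (A\<^sup>2 + Z\<^sup>2)"
  define c where "c = sqrt (1 - C * \<delta>\<^sup>2)"
  have \<delta>0: "0 \<le> \<delta>" by (rule order_trans[OF radius_norm_nonneg \<rho>\<delta>[of a]]) (use ab in auto)
  have "C * \<delta>\<^sup>2 \<le> C * \<kappa>\<^sup>2"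
    using \<delta> \<delta>0 C_nonneg by (intro mult_left_mono power_mono) auto
  then have C\<delta>: "C * \<delta>\<^sup>2 \<le> 1/2" using C\<kappa> by linarith
  have c0: "0 \<le> c" using C\<delta> by (simp add: c_def)
  have V_eq: "V = sqrt ((l b - l a)\<^sup>2 + 4 * (?\<rho> b - ?\<rho> a)\<^sup>2)"
    unfolding V_def A_def Z_def power_mult_distrib by simp
  have V0: "0 \<le> V" by (simp add: V_def)
  show ?thesis
  proof (cases "V = 0 \<or> arc_length g \<gamma> a b = \<infinity>")
    case True
    then show ?thesis unfolding V_eq[symmetric] by auto
  next
    case False
    then have Vpos: "V > 0" and fin: "arc_length g \<gamma> a b \<noteq> \<infinity>" using V0 by auto
    then obtain L where L: "0 \<le> L" "arc_length g \<gamma> a b = ennreal L"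
      by (cases "arc_length g \<gamma> a b") auto
    have \<gamma>_d: "(\<gamma> has_vector_derivative ?\<gamma>' t) (at t)" if "t \<in> {a<..<b} - S" for t
      using \<gamma>(2) that by (auto simp: C1_differentiable_on_eq vector_derivative_works)
    have \<gamma>'_c: "continuous_on ({a<..<b} - S) ?\<gamma>'"
      using \<gamma>(2) by (simp add: C1_differentiable_on_eq)
    let ?y = "\<lambda>t. \<gamma> t - proj_x Y (\<gamma> t)"
    have y_c: "continuous_on {a..b} ?y"
      by (intro continuous_intros \<gamma>(1))
    have *: "c / V * (A * A + Z * (2 * (sqrt ((?\<rho> b)\<^sup>2 + \<epsilon>\<^sup>2) - sqrt ((?\<rho> a)\<^sup>2 + \<epsilon>\<^sup>2)))) \<le> L"
      if \<epsilon>: "\<epsilon> > 0" for \<epsilon>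
    proof -
      \<comment> \<open>\<open>\<rho>\<close> is not differentiable where the curve meets the x-axes; this smoothing is, its derivative is
        still dominated by the cuspidal form, and \<open>\<epsilon>\<close> tends to zero at the end.\<close>
      define R where "R t = sqrt (?y t \<bullet> ?y t + \<epsilon>\<^sup>2)" for t
      define R' where "R' t = (?y t \<bullet> ?\<gamma>' t) / R t" for t
      have R_eq: "R t = sqrt ((?\<rho> t)\<^sup>2 + \<epsilon>\<^sup>2)" for t
        by (simp add: R_def radius_norm_eq power2_norm_eq_inner)
      have arg_pos: "0 < ?y t \<bullet> ?y t + \<epsilon>\<^sup>2" for t
        using \<epsilon> by (intro add_nonneg_pos) auto
      have R_pos: "R t > 0" for t
        using arg_pos by (simp add: R_def)
      have R_c: "continuous_on {a..b} R"
        unfolding R_def by (intro continuous_intros \<gamma>(1))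
      have R_d: "(R has_real_derivative R' t) (at t)" if t: "t \<in> {a<..<b} - S" for t
      proof -
        have y_d: "(?y has_vector_derivative (?\<gamma>' t - proj_x Y (?\<gamma>' t))) (at t)"
          by (intro has_vector_derivative_diff \<gamma>_d[OF t]
              bounded_linear.has_vector_derivative[OF bounded_linear_proj_x])
        have orth: "?y t \<bullet> proj_x Y v = 0" for v
          unfolding inner_y_part by (rule sum.neutral) auto
        have "((\<lambda>t. ?y t \<bullet> ?y t) has_vector_derivative
            (?y t \<bullet> (?\<gamma>' t - proj_x Y (?\<gamma>' t)) + (?\<gamma>' t - proj_x Y (?\<gamma>' t)) \<bullet> ?y t)) (at t)"
          by (rule bounded_bilinear.has_vector_derivative[OF bounded_bilinear_inner y_d y_d])
        then have "((\<lambda>t. ?y t \<bullet> ?y t) has_real_derivative 2 * (?y t \<bullet> ?\<gamma>' t)) (at t)"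
          by (simp add: has_real_derivative_iff_has_vector_derivative inner_diff_right[of "?y t"] orth
              inner_commute[of "?\<gamma>' t - proj_x Y (?\<gamma>' t)"])
        then show ?thesis
          unfolding R_def R'_def using arg_pos[of t]
          by (auto intro!: derivative_eq_intros simp: field_simps)
      qed
      have R'_c: "continuous_on ({a<..<b} - S) R'"
        unfolding R'_def using R_pos
        by (intro continuous_intros \<gamma>'_c continuous_on_subset[OF R_c] continuous_on_subset[OF \<gamma>(1)])
          (auto simp: less_imp_neq[symmetric])
      let ?F = "\<lambda>t. c / V * (A * l t + Z * (2 * R t))" and ?F' = "\<lambda>t. c / V * (A * l' t + Z * (2 * R' t))"
      have "ennreal (?F b - ?F a) \<le> arc_length g \<gamma> a b"
        unfolding arc_length_def
      proof (rule antiderivative_le_nn_integral[where F' = ?F'])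
        show "continuous_on {a..b} ?F"
          by (intro continuous_intros l(1) R_c)
        show "continuous_on ({a<..<b} - S) ?F'"
          by (intro continuous_intros l(3) R'_c)
        show "(?F has_real_derivative ?F' t) (at t)" if "t \<in> {a<..<b} - S" for t
          by (intro DERIV_cmult DERIV_add l(2) R_d that)
        have "AE t in lborel. t \<in> {a<..<b} - S \<longrightarrow> ?\<gamma>' t \<in> stratum_tangent Y (\<gamma> t)"
          by (rule AE_velocity_stratum_tangent)
            (use \<gamma>(2) in \<open>auto simp: C1_differentiable_on_eq\<close>)
        then show "AE t in lborel. t \<in> {a<..<b} - S \<longrightarrow> ennreal (?F' t) \<le> ennreal (sqrt (g (\<gamma> t) (?\<gamma>' t) (?\<gamma>' t)))"
        proof eventually_elim
          case (elim t)
          show ?case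
          proof
            assume t: "t \<in> {a<..<b} - S"
            then have t': "t \<in> {a..b}" by auto
            have in_ball: "\<gamma> t \<in> cball q \<kappa>" using \<gamma>q t' by blast
            have "4 * (?y t \<bullet> ?\<gamma>' t)\<^sup>2 \<le> (?\<rho> t)\<^sup>2 * cusp_form Y (\<gamma> t) (?\<gamma>' t) (?\<gamma>' t)"
              by (rule cusp_form_ge_radial)
            also have "\<dots> \<le> (R t)\<^sup>2 * cusp_form Y (\<gamma> t) (?\<gamma>' t) (?\<gamma>' t)"
              by (intro mult_right_mono cusp_form_nonneg) (simp add: R_eq)
            finally have "(2 * R' t)\<^sup>2 \<le> cusp_form Y (\<gamma> t) (?\<gamma>' t) (?\<gamma>' t)"
              using R_pos[of t] by (simp add: R'_def power_mult_distrib power_divide divide_le_eq mult.commute)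
            moreover have "(l' t)\<^sup>2 \<le> pullback_x Y g (\<gamma> t) (?\<gamma>' t) (?\<gamma>' t)"
              using ll[OF t] l'0[OF t] pullback_x_pos(1)[OF metric proj_x_in_U[OF in_ball]]
              by (metis real_sqrt_le_iff real_sqrt_unique real_sqrt_abs abs_of_nonneg)
            ultimately have G: "(l' t)\<^sup>2 + (2 * R' t)\<^sup>2 \<le> product_form Y g (\<gamma> t) (?\<gamma>' t)"
              by (simp add: product_form_def)
            have "(A * l' t + Z * (2 * R' t))\<^sup>2 + (A * (2 * R' t) - Z * l' t)\<^sup>2
                = (A\<^sup>2 + Z\<^sup>2) * ((l' t)\<^sup>2 + (2 * R' t)\<^sup>2)"
              by algebra
            then have "(A * l' t + Z * (2 * R' t))\<^sup>2 \<le> (A\<^sup>2 + Z\<^sup>2) * ((l' t)\<^sup>2 + (2 * R' t)\<^sup>2)"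
              by (metis le_add_same_cancel1 zero_le_power2)
            then have "A * l' t + Z * (2 * R' t) \<le> V * sqrt ((l' t)\<^sup>2 + (2 * R' t)\<^sup>2)"
              unfolding V_def real_sqrt_mult[symmetric] by (rule real_le_rsqrt)
            also have "\<dots> \<le> V * sqrt (product_form Y g (\<gamma> t) (?\<gamma>' t))"
              using G V0 by (intro mult_left_mono real_sqrt_le_mono) auto
            finally have "?F' t \<le> c / V * (V * sqrt (product_form Y g (\<gamma> t) (?\<gamma>' t)))"
              using c0 V0 by (intro mult_left_mono) auto
            also have "\<dots> = sqrt ((1 - C * \<delta>\<^sup>2) * product_form Y g (\<gamma> t) (?\<gamma>' t))"
              using Vpos by (simp add: c_def real_sqrt_mult)
            also have "\<dots> \<le> sqrt (g (\<gamma> t) (?\<gamma>' t) (?\<gamma>' t))"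
              using tensor_between_product_forms(2)[OF in_ball _ \<rho>\<delta>[OF t']] elim t by (intro real_sqrt_le_mono) auto
            finally show "ennreal (?F' t) \<le> ennreal (sqrt (g (\<gamma> t) (?\<gamma>' t) (?\<gamma>' t)))"
              by (rule ennreal_leI)
          qed
        qed
      qed (use ab S in auto)
      then have "?F b - ?F a \<le> L"
        unfolding L(2) using L(1) by (simp add: ennreal_le_iff)
      also have "?F b - ?F a = c / V * (A * A + Z * (2 * (R b - R a)))"
        unfolding A_def by (simp add: algebra_simps)
      finally show ?thesis unfolding R_eq .
    qed
    have lim: "((\<lambda>\<epsilon>. c / V * (A * A + Z * (2 * (sqrt ((?\<rho> b)\<^sup>2 + \<epsilon>\<^sup>2) - sqrt ((?\<rho> a)\<^sup>2 + \<epsilon>\<^sup>2)))))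
       \<longlongrightarrow> c / V * (A * A + Z * (2 * (sqrt ((?\<rho> b)\<^sup>2 + 0\<^sup>2) - sqrt ((?\<rho> a)\<^sup>2 + 0\<^sup>2))))) (at_right 0)"
      by (intro tendsto_intros)
    have lim_eq: "c / V * (A * A + Z * (2 * (sqrt ((?\<rho> b)\<^sup>2 + 0\<^sup>2) - sqrt ((?\<rho> a)\<^sup>2 + 0\<^sup>2)))) = c * V"
    proof -
      have "A * A + Z * (2 * (?\<rho> b - ?\<rho> a)) = V * V"
        by (simp add: V_def Z_def power2_eq_square)
      then show ?thesis using Vpos by simp
    qed
    have ev: "\<forall>\<^sub>F \<epsilon> in at_right 0. c / V * (A * A + Z * (2 * (sqrt ((?\<rho> b)\<^sup>2 + \<epsilon>\<^sup>2) - sqrt ((?\<rho> a)\<^sup>2 + \<epsilon>\<^sup>2)))) \<le> L"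
      using * by (auto simp: eventually_at_right_less eventually_at_filter)
    have "c * V \<le> L"
      by (rule tendsto_upperbound[OF lim[unfolded lim_eq] ev]) simp
    then show ?thesis
      unfolding L(2) V_eq[symmetric] c_def by (rule ennreal_leI)
  qed
qed

lemma sqrt_pullback_le_norm:
  obtains M where "0 \<le> M" "\<And>p u. p \<in> cball q \<kappa> \<Longrightarrow> sqrt (pullback_x Y g p u u) \<le> M * norm u"
proof -
  let ?K = "cball q \<kappa> \<times> sphere (0 :: real^2^'k) 1"
  have "continuous_on ?K (\<lambda>s. pullback_x Y g (fst s) (snd s) (snd s))"
    by (rule continuous_on_pullback) (auto intro!: continuous_intros)
  then have "compact ((\<lambda>s. pullback_x Y g (fst s) (snd s) (snd s)) ` ?K)"
    by (intro compact_continuous_image compact_Times compact_cball compact_sphere)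
  then obtain B where B: "\<And>p u. p \<in> cball q \<kappa> \<Longrightarrow> norm u = 1 \<Longrightarrow> pullback_x Y g p u u \<le> B"
    using bounded_imp_bdd_above[OF compact_imp_bounded] unfolding bdd_above_def by fastforce
  define M where "M = sqrt (max B 0)"
  have "sqrt (pullback_x Y g p u u) \<le> M * norm u" if p: "p \<in> cball q \<kappa>" for p u
  proof -
    have bil: "bilinear (pullback_x Y g p)"
      using metric proj_x_in_U[OF p]
      by (auto intro!: bilinear_pullback_x simp: product_cuspidal_metric_def symmetric_tensor_on_def)
    show ?thesis
    proof (cases "u = 0")
      case True
      then show ?thesis by (simp add: bilinear_lzero[OF bil])
    next
      case False
      let ?v = "u /\<^sub>R norm u"
      have "pullback_x Y g p u u = pullback_x Y g p (norm u *\<^sub>R ?v) (norm u *\<^sub>R ?v)"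
        using False by simp
      also have "\<dots> = (norm u)\<^sup>2 * pullback_x Y g p ?v ?v"
        unfolding bilinear_lmul[OF bil] bilinear_rmul[OF bil] by (simp add: power2_eq_square)
      also have "\<dots> \<le> (norm u)\<^sup>2 * max B 0"
        using B[OF p, of ?v] False by (intro mult_left_mono) auto
      finally have "sqrt (pullback_x Y g p u u) \<le> sqrt ((norm u)\<^sup>2 * max B 0)"
        by (rule real_sqrt_le_mono)
      also have "\<dots> = M * norm u"
        by (simp add: real_sqrt_mult M_def)
      finally show ?thesis .
    qed
  qed
  moreover have "0 \<le> M" by (simp add: M_def)
  ultimately show thesis using that by blast
qed

end

section \<open>Detours around the origin\<close>

lemma concat_arcs:
  fixes \<tau>1 \<tau>2 :: "real \<Rightarrow> 'a::real_normed_vector"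
  assumes "a < c" "c < b" and S: "finite S" "finite T"
    and \<tau>1: "continuous_on {a..c} \<tau>1" "\<tau>1 C1_differentiable_on ({a<..<c} - S)"
    and \<tau>2: "continuous_on {c..b} \<tau>2" "\<tau>2 C1_differentiable_on ({c<..<b} - T)"
    and eq: "\<tau>1 c = \<tau>2 c"
  defines "\<tau> \<equiv> \<lambda>t. if t \<le> c then \<tau>1 t else \<tau>2 t"
  shows "continuous_on {a..b} \<tau>" "\<tau> C1_differentiable_on ({a<..<b} - (S \<union> T \<union> {c}))"
    "arc_length g \<tau> a b = arc_length g \<tau>1 a c + arc_length g \<tau>2 c b"
proof -
  have "continuous_on ({a..c} \<union> {c..b}) \<tau>"
  proof (rule continuous_on_closed_Un)
    show "continuous_on {a..c} \<tau>"
      by (rule continuous_on_eq[OF \<tau>1(1)]) (auto simp: \<tau>_def)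
    show "continuous_on {c..b} \<tau>"
      by (rule continuous_on_eq[OF \<tau>2(1)]) (use eq in \<open>auto simp: \<tau>_def\<close>)
  qed auto
  moreover have "{a..c} \<union> {c..b} = {a..b}" using assms(1,2) by auto
  ultimately show "continuous_on {a..b} \<tau>" by simp
  have "\<tau> C1_differentiable_on (({a<..<c} - S) \<union> ({c<..<b} - T))"
  proof (rule C1_differentiable_on_Un_open)
    show "\<tau> C1_differentiable_on ({a<..<c} - S)"
      by (rule C1_differentiable_on_cong_open[OF _ _ \<tau>1(2)])
        (use S in \<open>auto simp: \<tau>_def intro!: open_Diff finite_imp_closed\<close>)
    show "\<tau> C1_differentiable_on ({c<..<b} - T)"
      by (rule C1_differentiable_on_cong_open[OF _ _ \<tau>2(2)])
        (use S in \<open>auto simp: \<tau>_def intro!: open_Diff finite_imp_closed\<close>)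
  qed (use S in \<open>auto intro!: open_Diff finite_imp_closed\<close>)
  then show "\<tau> C1_differentiable_on ({a<..<b} - (S \<union> T \<union> {c}))"
    by (rule C1_differentiable_on_subset) auto
  have "arc_length g \<tau> a c = arc_length g \<tau>1 a c" "arc_length g \<tau> c b = arc_length g \<tau>2 c b"
    by (auto intro!: arc_length_cong simp: \<tau>_def)
  then show "arc_length g \<tau> a b = arc_length g \<tau>1 a c + arc_length g \<tau>2 c b"
    using arc_length_combine[of a c b g \<tau>] assms(1,2) by simp
qed

context cuspidal_ball begin

text \<open>
  The parameter interval is arbitrary so that a bridge can replace a subarc without changing the
  parametrisation of the rest. The clause on vanishing components is what keeps a detour off the
  centre.
\<close>

definition short_bridges :: "real \<Rightarrow> real \<Rightarrow> bool" where
  "short_bridges e s \<longleftrightarrow> (\<forall>p0 p1. \<forall>a b::real. a < b \<longrightarrow> dist q p0 \<le> s \<longrightarrow> dist q p1 \<le> s \<longrightarrow>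
      (\<exists>\<tau>. continuous_on {a..b} \<tau> \<and> \<tau> C1_differentiable_on {a<..<b} \<and> \<tau> a = p0 \<and> \<tau> b = p1 \<and>
        \<tau> ` {a..b} \<subseteq> cball q \<kappa> \<and>
        (\<forall>t\<in>{a<..<b}. \<forall>j\<in>Y. p0 $ j \<noteq> 0 \<or> p1 $ j \<noteq> 0 \<longrightarrow> \<tau> t $ j \<noteq> 0) \<and>
        arc_length g \<tau> a b \<le> ennreal e))"

text \<open>
  Take the straight segment between the x-parts. All quantities in the bound of \<open>rotating_bridge\<close> are
  then of the order of the distance \<open>s\<close> of the end points from the centre.
\<close>

lemma short_bridges_near_center:
  assumes "0 < e"
  obtains s where "0 < s" "s \<le> \<kappa>" "short_bridges e s"
proof -
  obtain M where M: "0 \<le> M" "\<And>p u. p \<in> cball q \<kappa> \<Longrightarrow> sqrt (pullback_x Y g p u u) \<le> M * norm u"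
    by (rule sqrt_pullback_le_norm) auto
  \<comment> \<open>With \<open>\<Lambda> = 2 * M * s + s\<close> the bridge has at most the length \<open>2 * (s * N)\<close>.\<close>
  define N where "N = sqrt ((2 * M + 1)\<^sup>2 + 4 * card Y + cusp_const)"
  have K0: "0 \<le> cusp_const" by (simp add: cusp_const_def)
  have N0: "0 \<le> N" by (simp add: N_def K0)
  define s where "s = Min {\<kappa> / 2, 1, e / (2 * N + 1)}"
  have "0 < s" using \<kappa>_pos assms N0 by (auto simp: s_def)
  have s: "s \<le> \<kappa> / 2" "s \<le> 1" "s \<le> e / (2 * N + 1)"
    unfolding s_def by (rule Min_le; simp)+
  have se: "2 * (s * N) \<le> e"
  proof -
    have "s * (2 * N + 1) \<le> e" using s(3) N0 by (simp add: le_divide_eq)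
    then show ?thesis using \<open>0 < s\<close> by (simp add: algebra_simps)
  qed
  show thesis
  proof (rule that[of s], unfold short_bridges_def, safe)
    fix p0 p1 :: "real^2^'k" and a b :: real
    assume ab: "a < b" and p: "dist q p0 \<le> s" "dist q p1 \<le> s"
    let ?x0 = "proj_x Y p0" and ?x1 = "proj_x Y p1"
    have x: "dist q ?x0 \<le> s" "dist q ?x1 \<le> s"
      using p dist_proj_x_le[OF q_axes, of p0] dist_proj_x_le[OF q_axes, of p1] by auto
    have \<rho>: "radius_norm Y p0 \<le> s" "radius_norm Y p1 \<le> s"
      using p radius_norm_le_dist[OF q_axes, of p0] radius_norm_le_dist[OF q_axes, of p1]
      by (auto simp: dist_norm norm_minus_commute)
    define \<xi> where "\<xi> t = ?x0 + ((t - a) / (b - a)) *\<^sub>R (?x1 - ?x0)" for t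
    define v where "v = (1 / (b - a)) *\<^sub>R (?x1 - ?x0)"
    have \<xi>_d: "(\<xi> has_vector_derivative v) (at t)" for t
      unfolding \<xi>_def v_def using ab by (auto intro!: derivative_eq_intros)
    have \<xi>q: "dist q (\<xi> t) \<le> s" if "t \<in> {a..b}" for t
    proof -
      have "\<xi> t = (1 - (t - a) / (b - a)) *\<^sub>R ?x0 + ((t - a) / (b - a)) *\<^sub>R ?x1"
        by (simp add: \<xi>_def algebra_simps)
      moreover have "\<dots> \<in> cball q s"
        by (rule convexD_alt[OF convex_cball]) (use x that ab in \<open>auto simp: divide_le_eq\<close>)
      ultimately show ?thesis by simp
    qed
    have v: "norm v \<le> 2 * s / (b - a)"
    proof -
      have "norm (?x1 - ?x0) \<le> 2 * s"
        using dist_triangle2[of ?x1 ?x0 q] x by (simp add: dist_norm norm_minus_commute)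
      then show ?thesis using ab by (simp add: v_def divide_right_mono)
    qed
    define l where "l t = M * (2 * s / (b - a)) * (t - a)" for t
    obtain \<tau> where \<tau>: "continuous_on {a..b} \<tau>" "\<tau> C1_differentiable_on ({a<..<b} - {})"
      "\<tau> a = p0" "\<tau> b = p1" "\<tau> ` {a..b} \<subseteq> cball q \<kappa>"
      "\<And>t j. t \<in> {a<..<b} \<Longrightarrow> j \<in> Y \<Longrightarrow> p0 $ j \<noteq> 0 \<or> p1 $ j \<noteq> 0 \<Longrightarrow> \<tau> t $ j \<noteq> 0"
      and len: "arc_length g \<tau> a b \<le> ennreal (sqrt (1 + C * s\<^sup>2) *
       sqrt ((2 * M * s + s)\<^sup>2 + 4 * (\<Sum>j\<in>Y. (norm (p1 $ j) - norm (p0 $ j))\<^sup>2) + cusp_const * s ^ 6))"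
    proof (rule rotating_bridge[of a b "{}" \<xi> "\<lambda>_. v" l "\<lambda>_. M * (2 * s / (b - a))" p0 s p1 "2 * M * s + s"])
      show "continuous_on {a..b} \<xi>"
        unfolding \<xi>_def using ab by (intro continuous_intros) auto
      show "continuous_on {a..b} l"
        unfolding l_def by (intro continuous_intros)
      show "proj_x Y (\<xi> t) = \<xi> t" for t by (simp add: \<xi>_def)
      show "proj_x Y v = v" by (simp add: v_def)
      show "dist q (\<xi> t) \<le> \<kappa> / 2" if "t \<in> {a..b}" for t using \<xi>q[OF that] s by simp
      show "(l has_real_derivative M * (2 * s / (b - a))) (at t)" for t
        unfolding l_def using ab by (auto intro!: derivative_eq_intros)
      show "sqrt (pullback_x Y g (\<xi> t) v v) \<le> M * (2 * s / (b - a))" if "t \<in> {a<..<b} - {}" for t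
      proof -
        have "sqrt (pullback_x Y g (\<xi> t) v v) \<le> M * norm v"
          using \<xi>q[of t] that s(1) \<kappa>_pos by (intro M(2)) auto
        also have "\<dots> \<le> M * (2 * s / (b - a))"
          using v M(1) by (rule mult_left_mono)
        finally show ?thesis .
      qed
      show "proj_x Y p0 = \<xi> a" "proj_x Y p1 = \<xi> b" using ab by (auto simp: \<xi>_def)
      show "l b - l a < 2 * M * s + s" using ab \<open>0 < s\<close> by (simp add: l_def)
    qed (use ab \<rho> s \<xi>_d in auto)
    have "sqrt (1 + C * s\<^sup>2) \<le> 2"
    proof -
      have "C * s\<^sup>2 \<le> C * \<kappa>\<^sup>2" using s \<kappa>_pos \<open>0 < s\<close> C_nonneg by (intro mult_left_mono power_mono) auto
      then have "1 + C * s\<^sup>2 \<le> 2\<^sup>2" using C\<kappa> by simp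
      then have "sqrt (1 + C * s\<^sup>2) \<le> sqrt (2\<^sup>2)" by (rule real_sqrt_le_mono)
      then show ?thesis by simp
    qed
    moreover have "sqrt ((2 * M * s + s)\<^sup>2 + 4 * (\<Sum>j\<in>Y. (norm (p1 $ j) - norm (p0 $ j))\<^sup>2) + cusp_const * s ^ 6) \<le> s * N"
    proof -
      have "(norm (p1 $ j) - norm (p0 $ j))\<^sup>2 \<le> s\<^sup>2" if "j \<in> Y" for j
      proof -
        have "norm (p1 $ j) \<le> s" "norm (p0 $ j) \<le> s"
          using norm_le_radius_norm[OF that] \<rho> order_trans by blast+
        then have "\<bar>norm (p1 $ j) - norm (p0 $ j)\<bar> \<le> s"
          using norm_ge_zero[of "p1 $ j"] norm_ge_zero[of "p0 $ j"] by linarith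
        then show ?thesis using \<open>0 < s\<close> by (intro power2_le_iff_abs_le[THEN iffD2]) auto
      qed
      then have "(\<Sum>j\<in>Y. (norm (p1 $ j) - norm (p0 $ j))\<^sup>2) \<le> card Y * s\<^sup>2"
        using sum_bounded_above[of Y "\<lambda>j. (norm (p1 $ j) - norm (p0 $ j))\<^sup>2" "s\<^sup>2"] by simp
      moreover have "cusp_const * s ^ 6 \<le> cusp_const * s\<^sup>2"
        using s \<open>0 < s\<close> K0 by (intro mult_left_mono power_decreasing) auto
      moreover have "(2 * M * s + s)\<^sup>2 = (2 * M + 1)\<^sup>2 * s\<^sup>2"
        by (simp add: power_mult_distrib[symmetric] algebra_simps)
      ultimately have "(2 * M * s + s)\<^sup>2 + 4 * (\<Sum>j\<in>Y. (norm (p1 $ j) - norm (p0 $ j))\<^sup>2) + cusp_const * s ^ 6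
          \<le> s\<^sup>2 * ((2 * M + 1)\<^sup>2 + 4 * card Y + cusp_const)"
        by (simp add: algebra_simps)
      then have "sqrt ((2 * M * s + s)\<^sup>2 + 4 * (\<Sum>j\<in>Y. (norm (p1 $ j) - norm (p0 $ j))\<^sup>2) + cusp_const * s ^ 6)
          \<le> sqrt (s\<^sup>2 * ((2 * M + 1)\<^sup>2 + 4 * card Y + cusp_const))"
        by (rule real_sqrt_le_mono)
      also have "\<dots> = s * N" using \<open>0 < s\<close> by (simp add: N_def real_sqrt_mult)
      finally show ?thesis .
    qed
    ultimately have "sqrt (1 + C * s\<^sup>2) *
       sqrt ((2 * M * s + s)\<^sup>2 + 4 * (\<Sum>j\<in>Y. (norm (p1 $ j) - norm (p0 $ j))\<^sup>2) + cusp_const * s ^ 6) \<le> 2 * (s * N)"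
      using C_nonneg K0 by (intro mult_mono) (auto intro!: real_sqrt_ge_zero add_nonneg_nonneg mult_nonneg_nonneg sum_nonneg)
    with len se have "arc_length g \<tau> a b \<le> ennreal e"
      by (meson ennreal_leI order_trans)
    moreover have "\<tau> C1_differentiable_on {a<..<b}" using \<tau>(2) by simp
    ultimately show "\<exists>\<tau>. continuous_on {a..b} \<tau> \<and> \<tau> C1_differentiable_on {a<..<b} \<and> \<tau> a = p0 \<and> \<tau> b = p1 \<and>
        \<tau> ` {a..b} \<subseteq> cball q \<kappa> \<and>
        (\<forall>t\<in>{a<..<b}. \<forall>j\<in>Y. p0 $ j \<noteq> 0 \<or> p1 $ j \<noteq> 0 \<longrightarrow> \<tau> t $ j \<noteq> 0) \<and>
        arc_length g \<tau> a b \<le> ennreal e"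
      by (intro exI[of _ \<tau>] conjI ballI impI \<tau>(1,3,4,5)) (assumption | rule \<tau>(6))+
  qed (use \<open>0 < s\<close> s \<kappa>_pos in auto)
qed

text \<open>
  The part of the curve between its first and its last visit to the origin is replaced. The detour
  passes through a point with a nonzero component in some plane of \<open>Y\<close>; this component persists on
  both halves, even if the points at which the detour starts and ends lie on the x-axes.
\<close>

lemma detour_around_center:
  assumes q0: "q = 0" and Y: "Y \<noteq> {}" and e: "0 < e" and \<sigma>: "curve_in U \<sigma>"
    and ends: "pathstart \<sigma> \<noteq> 0" "pathfinish \<sigma> \<noteq> 0"
  shows "\<exists>\<sigma>'. curve_in U \<sigma>' \<and> pathstart \<sigma>' = pathstart \<sigma> \<and> pathfinish \<sigma>' = pathfinish \<sigma> \<and>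
      0 \<notin> path_image \<sigma>' \<and> curve_length g \<sigma>' \<le> curve_length g \<sigma> + ennreal e"
proof (cases "0 \<in> path_image \<sigma>")
  case True
  obtain s where s: "0 < s" "s \<le> \<kappa>" "short_bridges (e / 2) s"
    by (rule short_bridges_near_center[OF half_gt_zero[OF e]])
  note br = s(3)[unfolded short_bridges_def, rule_format]
  have c: "continuous_on {0..1} \<sigma>"
    using \<sigma> by (simp add: curve_in_def piecewise_C1_on_Icc_iff)
  define Zs where "Zs = {t \<in> {0..1}. \<sigma> t = 0}"
  have "closed Zs"
    unfolding Zs_def by (rule continuous_closed_preimage_constant[OF c]) auto
  moreover have "bounded Zs"
    by (rule bounded_subset[of "{0..1}"]) (auto simp: Zs_def)
  ultimately have "compact Zs"
    by (simp add: compact_eq_bounded_closed)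
  have ne: "Zs \<noteq> {}" using True by (auto simp: Zs_def path_image_def)
  obtain s0 where s0: "s0 \<in> Zs" "\<And>t. t \<in> Zs \<Longrightarrow> s0 \<le> t"
    using compact_attains_inf[OF \<open>compact Zs\<close> ne] by blast
  obtain s1 where s1: "s1 \<in> Zs" "\<And>t. t \<in> Zs \<Longrightarrow> t \<le> s1"
    using compact_attains_sup[OF \<open>compact Zs\<close> ne] by blast
  have s01: "0 < s0" "s0 \<le> s1" "s1 < 1" "\<sigma> s0 = 0" "\<sigma> s1 = 0"
    using s0 s1 ends by (auto simp: Zs_def pathstart_def pathfinish_def less_le)
  have near: "\<exists>d>0. \<forall>t\<in>{0..1}. \<bar>t - r\<bar> < d \<longrightarrow> norm (\<sigma> t) < s" if "\<sigma> r = 0" "r \<in> {0..1}" for r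
    using continuous_on_iff[THEN iffD1, OF c, rule_format, OF that(2) s(1)] that(1)
    by (simp add: dist_real_def)
  obtain d0 where d0: "d0 > 0" "\<And>t. t \<in> {0..1} \<Longrightarrow> \<bar>t - s0\<bar> < d0 \<Longrightarrow> norm (\<sigma> t) < s"
    using near[of s0] s01 by auto
  obtain d1 where d1: "d1 > 0" "\<And>t. t \<in> {0..1} \<Longrightarrow> \<bar>t - s1\<bar> < d1 \<Longrightarrow> norm (\<sigma> t) < s"
    using near[of s1] s01 by auto
  define a where "a = max 0 (s0 - d0 / 2)"
  define b where "b = min 1 (s1 + d1 / 2)"
  have a: "0 \<le> a" "a < s0" "norm (\<sigma> a) < s" and b: "s1 < b" "b \<le> 1" "norm (\<sigma> b) < s"
    using d0(1) d1(1) s01 d0(2)[of a] d1(2)[of b] by (auto simp: a_def b_def)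
  define m where "m = (a + b) / 2"
  have m: "a < m" "m < b" using a b s01 by (auto simp: m_def)
  obtain j where j: "j \<in> Y" using Y by blast
  define p where "p = s *\<^sub>R axis j (axis 1 1 :: real^2)"
  have "axis j (axis 1 1 :: real^2) \<in> (Basis :: (real^2^'k) set)"
    by (simp add: axis_in_Basis_iff)
  then have p: "norm p = s" "p $ j \<noteq> 0"
    using s(1) by (auto simp: p_def)
  obtain \<tau>1 where \<tau>1: "continuous_on {a..m} \<tau>1" "\<tau>1 C1_differentiable_on {a<..<m}"
    "\<tau>1 a = \<sigma> a" "\<tau>1 m = p" "\<tau>1 ` {a..m} \<subseteq> cball q \<kappa>" "\<And>t. t \<in> {a<..<m} \<Longrightarrow> \<tau>1 t $ j \<noteq> 0"
    "arc_length g \<tau>1 a m \<le> ennreal (e / 2)"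
    using br[of a m "\<sigma> a" p] m(1) a p j q0 by (auto simp: dist_norm)
  obtain \<tau>2 where \<tau>2: "continuous_on {m..b} \<tau>2" "\<tau>2 C1_differentiable_on {m<..<b}"
    "\<tau>2 m = p" "\<tau>2 b = \<sigma> b" "\<tau>2 ` {m..b} \<subseteq> cball q \<kappa>" "\<And>t. t \<in> {m<..<b} \<Longrightarrow> \<tau>2 t $ j \<noteq> 0"
    "arc_length g \<tau>2 m b \<le> ennreal (e / 2)"
    using br[of m b p "\<sigma> b"] m(2) b p j q0 by (auto simp: dist_norm)
  define \<tau> where "\<tau> = (\<lambda>t. if t \<le> m then \<tau>1 t else \<tau>2 t)"
  have \<tau>12: "\<tau>1 m = \<tau>2 m" by (simp add: \<tau>1 \<tau>2)
  note \<tau> = concat_arcs[OF m, of "{}" "{}" \<tau>1 \<tau>2, folded \<tau>_def]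
  define \<sigma>' where "\<sigma>' = (\<lambda>t. if t \<in> {a..b} then \<tau> t else \<sigma> t)"
  have \<tau>_ends: "\<tau> a = \<sigma> a" "\<tau> b = \<sigma> b"
    using m \<tau>1 \<tau>2 by (auto simp: \<tau>_def)
  have \<tau>_U: "\<tau> ` {a..b} \<subseteq> U"
  proof (rule image_subsetI)
    fix t assume "t \<in> {a..b}"
    then have "\<tau> t \<in> \<tau>1 ` {a..m} \<union> \<tau>2 ` {m..b}"
      by (cases "t \<le> m") (simp_all add: \<tau>_def)
    then show "\<tau> t \<in> U"
      using ball \<tau>1(5) \<tau>2(5) by blast
  qed
  have \<tau>_C: "continuous_on {a..b} \<tau>" "\<tau> C1_differentiable_on ({a<..<b} - {m})"
    using \<tau>(1,2) \<tau>1 \<tau>2 by auto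
  have "a < b" using m by simp
  note R = replace_subarc[OF \<sigma> a(1) \<open>a < b\<close> b(2) _ \<tau>_C \<tau>_ends \<tau>_U, folded \<sigma>'_def, simplified]
  have "arc_length g \<tau> a b \<le> ennreal (e / 2) + ennreal (e / 2)"
    using \<tau>(3) \<tau>1 \<tau>2 by (auto intro: add_mono)
  also have "\<dots> = ennreal e" using e by (simp flip: ennreal_plus)
  finally have "curve_length g \<sigma>' \<le> arc_length g \<sigma> 0 a + ennreal e + arc_length g \<sigma> b 1"
    unfolding R(5) by (intro add_mono) auto
  also have "\<dots> \<le> curve_length g \<sigma> + ennreal e"
    unfolding R(4)[of g] by (auto intro!: add_mono simp: add_ac)
  finally have "curve_length g \<sigma>' \<le> curve_length g \<sigma> + ennreal e" .
  moreover have "\<sigma>' t \<noteq> 0" if t: "t \<in> {0..1}" for t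
  proof (cases "t \<in> {a..b}")
    case True
    have "\<sigma> a \<noteq> 0" "\<sigma> b \<noteq> 0"
      using s0(2)[of a] s1(2)[of b] a b s01 by (auto simp: Zs_def)
    moreover have "p \<noteq> 0" using p by auto
    moreover have "t = a \<or> t \<in> {a<..<m} \<or> t = m \<or> t \<in> {m<..<b} \<or> t = b"
      using True by auto
    moreover have "\<tau>1 t \<noteq> 0" if "t \<in> {a<..<m}"
      using \<tau>1(6)[OF that] by auto
    moreover have "\<tau>2 t \<noteq> 0" if "t \<in> {m<..<b}"
      using \<tau>2(6)[OF that] by auto
    ultimately have "\<tau> t \<noteq> 0"
      using m \<tau>1(3,4) \<tau>_ends(2) unfolding \<tau>_def by (elim disjE) simp_all
    then show ?thesis using True by (simp add: \<sigma>'_def)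
  next
    case False
    then have "t \<notin> Zs" using s0(2)[of t] s1(2)[of t] a b s01 by auto
    then show ?thesis using False t by (auto simp: \<sigma>'_def Zs_def)
  qed
  then have "0 \<notin> path_image \<sigma>'" by (auto simp: path_image_def)
  ultimately show ?thesis using R by blast
qed (use \<sigma> in auto)

end

section \<open>Cutting the corner at the x-axes\<close>

text \<open>
  Both legs have the length \<open>V\<close> in the plane of \<open>(l, 2 r)\<close>. From \<open>(l1 * l2)\<^sup>2 \<le> (V\<^sup>2 - 4 * \<delta>\<^sup>2) * V\<^sup>2\<close> follows
  \<open>l1 * l2 \<le> V\<^sup>2 - 2 * \<delta>\<^sup>2\<close>, so the square of the chord is at most \<open>4 * V\<^sup>2 - 4 * \<delta>\<^sup>2\<close>. A quarter of this gain
  pays for \<open>K * \<delta> ^ 6\<close>, and what is left pays for the distortion \<open>C * \<delta>\<^sup>2\<close>. Equal legs matter: if one leg were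
  much shorter than the other, the gain could fall below the distortion.
\<close>

lemma chord_gain:
  fixes l1 l2 r1 r2 V \<delta> C K D :: real
  assumes V: "l1\<^sup>2 + 4 * r1\<^sup>2 = V\<^sup>2" "l2\<^sup>2 + 4 * r2\<^sup>2 = V\<^sup>2" "0 \<le> V"
    and nonneg: "0 \<le> l1" "0 \<le> l2" "0 \<le> r1" "0 \<le> r2" "0 \<le> C" "0 \<le> K"
    and \<delta>: "\<delta> = max r1 r2" "0 < \<delta>" and D: "D \<le> r1\<^sup>2 + r2\<^sup>2"
    and small: "16 * C * V\<^sup>2 \<le> 1" "K * V ^ 4 \<le> 1"
  shows "(1 + C * \<delta>\<^sup>2) * ((l1 + l2)\<^sup>2 + 4 * D + K * \<delta> ^ 6) < (1 - C * \<delta>\<^sup>2) * (4 * V\<^sup>2)"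
proof -
  have rV: "4 * r1\<^sup>2 \<le> V\<^sup>2" "4 * r2\<^sup>2 \<le> V\<^sup>2"
    using V(1,2) zero_le_power2[of l1] zero_le_power2[of l2] by linarith+
  then have \<delta>V: "4 * \<delta>\<^sup>2 \<le> V\<^sup>2"
    unfolding \<delta> by (simp add: max_def)
  have lV: "l1\<^sup>2 \<le> V\<^sup>2" "l2\<^sup>2 \<le> V\<^sup>2"
    using V(1,2) zero_le_power2[of r1] zero_le_power2[of r2] by linarith+
  have "(l1 * l2)\<^sup>2 \<le> (V\<^sup>2 - 4 * \<delta>\<^sup>2) * V\<^sup>2"
  proof (cases "r1 \<le> r2")
    case True
    have "(l1 * l2)\<^sup>2 = l2\<^sup>2 * l1\<^sup>2" by (simp add: power_mult_distrib)
    also have "\<dots> \<le> (V\<^sup>2 - 4 * \<delta>\<^sup>2) * V\<^sup>2"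
      using V(1,2) \<delta> True lV rV by (intro mult_mono) (auto simp: max_def)
    finally show ?thesis .
  next
    case False
    have "(l1 * l2)\<^sup>2 = l1\<^sup>2 * l2\<^sup>2" by (simp add: power_mult_distrib)
    also have "\<dots> \<le> (V\<^sup>2 - 4 * \<delta>\<^sup>2) * V\<^sup>2"
      using V(1,2) \<delta> False lV rV by (intro mult_mono) (auto simp: max_def)
    finally show ?thesis .
  qed
  also have "\<dots> \<le> (V\<^sup>2 - 2 * \<delta>\<^sup>2)\<^sup>2"
  proof -
    have "(V\<^sup>2 - 2 * \<delta>\<^sup>2)\<^sup>2 = (V\<^sup>2 - 4 * \<delta>\<^sup>2) * V\<^sup>2 + 4 * (\<delta>\<^sup>2)\<^sup>2"
      by algebra
    then show ?thesis by simp
  qed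
  finally have "l1 * l2 \<le> V\<^sup>2 - 2 * \<delta>\<^sup>2"
    by (rule power2_le_imp_le) (use \<delta>V zero_le_power2[of \<delta>] in linarith)
  then have 1: "(l1 + l2)\<^sup>2 + 4 * D \<le> 4 * V\<^sup>2 - 4 * \<delta>\<^sup>2"
    using V D by (simp add: power2_sum)
  have "K * \<delta> ^ 6 \<le> \<delta>\<^sup>2"
  proof -
    have "\<delta>\<^sup>2 \<le> V\<^sup>2" using \<delta>V by (smt (verit) zero_le_power2)
    then have "\<delta> \<le> V" using V(3) by (rule power2_le_imp_le)
    then have "K * \<delta> ^ 4 \<le> K * V ^ 4" using \<delta> nonneg by (intro mult_left_mono power_mono) auto
    then have "K * \<delta> ^ 4 \<le> 1" using small by linarith
    then have "(K * \<delta> ^ 4) * \<delta>\<^sup>2 \<le> 1 * \<delta>\<^sup>2" by (intro mult_right_mono) auto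
    moreover have "K * \<delta> ^ 6 = (K * \<delta> ^ 4) * \<delta>\<^sup>2" by (simp add: power_add[symmetric])
    ultimately show ?thesis by linarith
  qed
  with 1 have "(l1 + l2)\<^sup>2 + 4 * D + K * \<delta> ^ 6 \<le> 4 * V\<^sup>2 - 3 * \<delta>\<^sup>2" by linarith
  then have "(1 + C * \<delta>\<^sup>2) * ((l1 + l2)\<^sup>2 + 4 * D + K * \<delta> ^ 6) \<le> (1 + C * \<delta>\<^sup>2) * (4 * V\<^sup>2 - 3 * \<delta>\<^sup>2)"
    using nonneg by (intro mult_left_mono) auto
  also have "\<dots> < (1 - C * \<delta>\<^sup>2) * (4 * V\<^sup>2)"
  proof -
    have 2: "(16 * C * V\<^sup>2) * \<delta>\<^sup>2 \<le> 1 * \<delta>\<^sup>2" using small by (intro mult_right_mono) auto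
    have 3: "0 < \<delta>\<^sup>2" and 4: "0 \<le> C * \<delta>\<^sup>2 * \<delta>\<^sup>2" using \<delta> nonneg by auto
    have "(1 - C * \<delta>\<^sup>2) * (4 * V\<^sup>2) - (1 + C * \<delta>\<^sup>2) * (4 * V\<^sup>2 - 3 * \<delta>\<^sup>2)
        = 3 * \<delta>\<^sup>2 + 3 * (C * \<delta>\<^sup>2 * \<delta>\<^sup>2) - (1 / 2) * ((16 * C * V\<^sup>2) * \<delta>\<^sup>2)"
      by algebra
    with 2 3 4 show ?thesis by linarith
  qed
  finally show ?thesis .
qed

lemma first_crossing:
  fixes f :: "real \<Rightarrow> real"
  assumes "a \<le> b" "continuous_on {a..b} f" "f a < m" "m \<le> f b"
  obtains c where "a < c" "c \<le> b" "f c = m" "\<And>t. t \<in> {a..c} \<Longrightarrow> f t \<le> m"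
proof -
  let ?Z = "{t \<in> {a..b}. f t = m}"
  have "closed ?Z"
    by (rule continuous_closed_preimage_constant[OF assms(2)]) auto
  moreover have "bounded ?Z"
    by (rule bounded_subset[of "{a..b}"]) auto
  ultimately have comp: "compact ?Z"
    by (simp add: compact_eq_bounded_closed)
  have ne: "?Z \<noteq> {}"
    using IVT'[of f a m b] assms by auto
  obtain c where c: "c \<in> ?Z" "\<forall>t\<in>?Z. c \<le> t"
    using compact_attains_inf[OF comp ne] by blast
  have "f t \<le> m" if t: "t \<in> {a..c}" for t
  proof (rule ccontr)
    assume "\<not> f t \<le> m"
    then obtain t' where "a \<le> t'" "t' \<le> t" "f t' = m"
      using IVT'[of f a m t] assms(3) t c(1) continuous_on_subset[OF assms(2), of "{a..t}"] by auto
    moreover have "c \<le> t'" using c t calculation by auto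
    ultimately have "t' = t" using t by simp
    with \<open>f t' = m\<close> \<open>\<not> f t \<le> m\<close> show False by simp
  qed
  moreover have "a \<noteq> c" using c(1) assms(3) by auto
  ultimately show thesis
    using that[of c] c(1) by auto
qed

lemma last_crossing:
  fixes f :: "real \<Rightarrow> real"
  assumes "a \<le> b" "continuous_on {a..b} f" "f b < m" "m \<le> f a"
  obtains c where "a \<le> c" "c < b" "f c = m" "\<And>t. t \<in> {c..b} \<Longrightarrow> f t \<le> m"
proof -
  have "continuous_on {-b..-a} (\<lambda>t. f (- t))"
    by (rule continuous_on_compose2[OF assms(2)]) (auto intro!: continuous_intros)
  then obtain c where c: "- b < c" "c \<le> - a" "f (- c) = m" "\<And>t. t \<in> {-b..c} \<Longrightarrow> f (- t) \<le> m"
    using first_crossing[of "-b" "-a" "\<lambda>t. f (- t)" m] assms by auto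
  show thesis
  proof (rule that[of "- c"])
    show "f t \<le> m" if "t \<in> {- c..b}" for t
      using c(4)[of "- t"] that by auto
  qed (use c in auto)
qed

context cuspidal_ball begin

text \<open>
  The derivative of a piecewise smooth curve may be unbounded near a break point, so the length of the
  x-part exists only because it is dominated by the length of the curve, which is assumed to be finite.
\<close>

lemma finite_length_x_arclength:
  fixes \<gamma> :: "real \<Rightarrow> real^2^'k"
  defines "l' \<equiv> \<lambda>t. sqrt (pullback_x Y g (\<gamma> t) (vector_derivative \<gamma> (at t)) (vector_derivative \<gamma> (at t)))"
  assumes S: "finite S"
    and \<gamma>: "continuous_on {a..b} \<gamma>" "\<gamma> C1_differentiable_on ({a<..<b} - S)"
    and \<gamma>q: "\<gamma> ` {a..b} \<subseteq> cball q \<kappa>" and fin: "arc_length g \<gamma> a b < \<infinity>"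
  obtains l where "continuous_on {a..b} l"
    "\<forall>t \<in> {a<..<b} - S. (l has_real_derivative l' t) (at t)"
    "continuous_on ({a<..<b} - S) l'"
proof -
  have \<gamma>q': "\<gamma> t \<in> cball q \<kappa>" if "t \<in> {a..b}" for t
    by (rule subsetD[OF \<gamma>q imageI[OF that]])
  let ?T = "{a<..<b} - S" and ?\<gamma>' = "\<lambda>t. vector_derivative \<gamma> (at t)"
  have op: "open ?T" using S by (intro open_Diff finite_imp_closed) auto
  have l'_c: "continuous_on ?T l'"
    unfolding l'_def
  proof (intro continuous_intros continuous_on_pullback)
    show "continuous_on ?T \<gamma>" by (rule continuous_on_subset[OF \<gamma>(1)]) auto
    show "continuous_on ?T ?\<gamma>'" using \<gamma>(2) by (simp add: C1_differentiable_on_eq)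
    show "\<gamma> t \<in> cball q \<kappa>" if "t \<in> ?T" for t using \<gamma>q'[of t] that by simp
  qed
  have l'0: "0 \<le> l' t" if "t \<in> ?T" for t
    unfolding l'_def using that
    by (intro real_sqrt_ge_zero pullback_x_pos(1)[OF metric] proj_x_in_U \<gamma>q') auto
  \<comment> \<open>\<open>m / 2\<close> is below the length integrand because \<open>1 - C * \<kappa>\<^sup>2 \<ge> 1/2 \<ge> 1/4\<close>.\<close>
  define m where "m t = indicator ?T t *\<^sub>R l' t" for t
  have meas: "m \<in> borel_measurable borel"
    unfolding m_def using op by (intro borel_measurable_continuous_on_indicator l'_c) auto
  have m0: "0 \<le> m t" for t
    using l'0 by (auto simp: m_def indicator_def)
  have "AE t in lborel. t \<in> ?T \<longrightarrow> ?\<gamma>' t \<in> stratum_tangent Y (\<gamma> t)"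
    by (rule AE_velocity_stratum_tangent) (use \<gamma>(2) in \<open>auto simp: C1_differentiable_on_eq\<close>)
  then have "AE t in lborel. ennreal (m t / 2) \<le> ennreal (sqrt (g (\<gamma> t) (?\<gamma>' t) (?\<gamma>' t))) * indicator {a..b} t"
  proof eventually_elim
    case (elim t)
    show ?case
    proof (cases "t \<in> ?T")
      case True
      have in_ball: "\<gamma> t \<in> cball q \<kappa>" using True \<gamma>q'[of t] by simp
      have "radius_norm Y (\<gamma> t) \<le> \<kappa>"
        using radius_norm_le_dist[OF q_axes, of "\<gamma> t"] in_ball by (simp add: dist_norm norm_minus_commute)
      then have 1: "(1 - C * \<kappa>\<^sup>2) * product_form Y g (\<gamma> t) (?\<gamma>' t) \<le> g (\<gamma> t) (?\<gamma>' t) (?\<gamma>' t)"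
        using elim True by (intro tensor_between_product_forms(2) in_ball) auto
      have G0: "0 \<le> product_form Y g (\<gamma> t) (?\<gamma>' t)"
        by (rule product_form_nonneg[OF metric proj_x_in_U[OF in_ball]])
      have "(l' t)\<^sup>2 = pullback_x Y g (\<gamma> t) (?\<gamma>' t) (?\<gamma>' t)"
        unfolding l'_def using pullback_x_pos(1)[OF metric proj_x_in_U[OF in_ball]] by simp
      also have "\<dots> \<le> product_form Y g (\<gamma> t) (?\<gamma>' t)"
        by (simp add: product_form_def cusp_form_nonneg)
      finally have "(l' t)\<^sup>2 \<le> product_form Y g (\<gamma> t) (?\<gamma>' t)" .
      moreover have "1 / 2 * product_form Y g (\<gamma> t) (?\<gamma>' t) \<le> (1 - C * \<kappa>\<^sup>2) * product_form Y g (\<gamma> t) (?\<gamma>' t)"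
        using G0 C\<kappa> by (intro mult_right_mono) auto
      ultimately have "(l' t / 2)\<^sup>2 \<le> g (\<gamma> t) (?\<gamma>' t) (?\<gamma>' t)"
        using 1 G0 by (simp add: power_divide)
      then have "l' t / 2 \<le> sqrt (g (\<gamma> t) (?\<gamma>' t) (?\<gamma>' t))"
        by (rule real_le_rsqrt)
      then show ?thesis
        using True by (auto simp: m_def indicator_def intro!: ennreal_leI)
    qed (simp add: m_def)
  qed
  then have "(\<integral>\<^sup>+t. ennreal (m t / 2) \<partial>lborel) \<le> arc_length g \<gamma> a b"
    unfolding arc_length_def by (rule nn_integral_mono_AE)
  then have "integrable lborel (\<lambda>t. m t / 2)"
    using fin meas m0 by (intro integrableI_nonneg) auto
  then have "integrable lborel (\<lambda>t. 2 * (m t / 2))"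
    by (intro integrable_mult_right)
  then have "integrable lborel m" by simp
  then have "m integrable_on UNIV" by (rule integrable_on_lborel)
  then have int: "m integrable_on {a..b}"
    by (rule integrable_on_subinterval) auto
  show thesis
  proof (rule that[of "\<lambda>u. integral {a..u} m"])
    show "continuous_on {a..b} (\<lambda>u. integral {a..u} m)"
      by (rule indefinite_integral_continuous_1[OF int])
    show "\<forall>t\<in>?T. ((\<lambda>u. integral {a..u} m) has_real_derivative l' t) (at t)"
    proof
      fix t assume t: "t \<in> ?T"
      have eq: "{a..b} - (S \<union> {a, b}) = ?T" by auto
      have "continuous_on ?T m"
        by (rule continuous_on_eq[OF l'_c]) (auto simp: m_def)
      then have "continuous (at t within ({a..b} - (S \<union> {a, b}))) m"
        unfolding eq using t by (simp add: continuous_on_eq_continuous_within)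
      then have "((\<lambda>u. integral {a..u} m) has_vector_derivative m t) (at t within ({a..b} - (S \<union> {a, b})))"
        by (intro integral_has_vector_derivative_continuous_at[OF int]) (use t S in auto)
      then show "((\<lambda>u. integral {a..u} m) has_real_derivative l' t) (at t)"
        using t unfolding eq at_within_open[OF t op]
        by (simp add: has_real_derivative_iff_has_vector_derivative m_def)
    qed
  qed (rule l'_c)
qed

lemma x_arclength_0_imp_x_constant:
  fixes \<gamma> :: "real \<Rightarrow> real^2^'k"
  defines "l' \<equiv> \<lambda>t. sqrt (pullback_x Y g (\<gamma> t) (vector_derivative \<gamma> (at t)) (vector_derivative \<gamma> (at t)))"
  assumes S: "finite S" and ab: "a \<le> b"
    and \<gamma>: "continuous_on {a..b} \<gamma>" "\<gamma> C1_differentiable_on ({a<..<b} - S)"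
    and \<gamma>q: "\<gamma> ` {a..b} \<subseteq> cball q \<kappa>"
    and l: "continuous_on {a..b} l" "\<And>t. t \<in> {a<..<b} - S \<Longrightarrow> (l has_real_derivative l' t) (at t)"
    and eq: "l a = l b"
  shows "proj_x Y (\<gamma> a) = proj_x Y (\<gamma> b)"
proof -
  have U: "proj_x Y (\<gamma> t) \<in> U" if "t \<in> {a..b}" for t
    by (rule proj_x_in_U[OF subsetD[OF \<gamma>q imageI[OF that]]])
  have l'0: "0 \<le> l' t" if "t \<in> {a<..<b} - S" for t
    unfolding l'_def using that by (intro real_sqrt_ge_zero pullback_x_pos(1)[OF metric] U) auto
  have mono: "l s \<le> l t" if "a \<le> s" "s \<le> t" "t \<le> b" for s t
    by (rule nonneg_deriv_mono[of s t S l l'])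
      (use that S l(2) l'0 in \<open>auto intro: continuous_on_subset[OF l(1)]\<close>)
  have const: "l t = l a" if "t \<in> {a<..<b}" for t
    using mono[of a t] mono[of t b] that eq by auto
  have deriv: "((\<lambda>t. proj_x Y (\<gamma> t)) has_vector_derivative 0) (at t)" if t: "t \<in> {a<..<b} - S" for t
  proof -
    have "((\<lambda>_. l a) has_real_derivative l' t) (at t)"
      by (rule DERIV_cong_ev[OF refl _ refl, THEN iffD1, OF _ l(2)[OF t]])
        (use t const in \<open>auto intro!: eventually_nhds_in_open[of "{a<..<b}", THEN eventually_mono]\<close>)
    then have "l' t = 0" using DERIV_const DERIV_unique by blast
    then have "proj_x Y (vector_derivative \<gamma> (at t)) = 0"
      using pullback_x_pos(2)[OF metric U[of t], of "vector_derivative \<gamma> (at t)"] t by (simp add: l'_def)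
    moreover have "(\<gamma> has_vector_derivative vector_derivative \<gamma> (at t)) (at t)"
      using \<gamma>(2) t by (auto simp: C1_differentiable_on_eq vector_derivative_works)
    ultimately show ?thesis
      using bounded_linear.has_vector_derivative[OF bounded_linear_proj_x] by metis
  qed
  have "((\<lambda>_. 0) has_integral (proj_x Y (\<gamma> b) - proj_x Y (\<gamma> a))) {a..b}"
    by (rule fundamental_theorem_of_calculus_interior_strong[OF S ab])
      (use deriv in \<open>auto intro!: continuous_intros \<gamma>(1)\<close>)
  then have "proj_x Y (\<gamma> b) - proj_x Y (\<gamma> a) = 0"
    using has_integral_0 has_integral_unique by blast
  then show ?thesis by simp
qed

end

lemma ennreal_add_less_middle:
  fixes A B x y :: ennreal
  assumes "x < y" "A < \<infinity>" "B < \<infinity>"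
  shows "A + x + B < A + y + B"
proof (cases "y = \<infinity>")
  case True
  then show ?thesis using assms by (simp add: less_top[symmetric])
next
  case False
  obtain a where a: "A = ennreal a" "0 \<le> a" using assms(2) by (cases A) auto
  obtain b where b: "B = ennreal b" "0 \<le> b" using assms(3) by (cases B) auto
  obtain v where v: "y = ennreal v" "0 \<le> v" using False by (cases y) auto
  obtain u where u: "x = ennreal u" "0 \<le> u" using assms(1) v by (cases x) auto
  have "u < v" using assms(1) u v by (simp add: ennreal_less_iff)
  then show ?thesis
    unfolding a b u v using a b u v by (simp add: ennreal_less_iff flip: ennreal_plus)
qed

context cuspidal_ball begin

text \<open>
  The corner-cutting argument at the point \<open>q\<close> that the curve reaches at time \<open>ts\<close> from outside the x-axes.
  The function \<open>V\<close> is the length of a leg in the plane of \<open>(l, 2 \<rho>)\<close>. It vanishes at \<open>ts\<close> and is positive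
  at \<open>t1\<close> and \<open>t2\<close>, so all small values are attained on both sides of \<open>ts\<close>. The curve may stay in
  the x-axes for a while after \<open>ts\<close>; the leg on that side may then simply have radius zero.
\<close>

lemma shorten_through_center:
  assumes \<gamma>: "curve_in U \<gamma>" and fin: "curve_length g \<gamma> < \<infinity>"
    and ts: "0 \<le> t1" "t1 < ts" "ts < t2" "t2 \<le> 1"
    and center: "\<gamma> ts = q" and near: "\<And>t. t \<in> {t1..t2} \<Longrightarrow> dist q (\<gamma> t) \<le> \<kappa> / 2"
    and far: "\<gamma> t1 \<noteq> q" "\<gamma> t2 \<noteq> q"
    and off: "\<And>t. t \<in> {t1..<ts} \<Longrightarrow> 0 < radius_norm Y (\<gamma> t)"
  shows "\<exists>\<sigma>. curve_in U \<sigma> \<and> pathstart \<sigma> = pathstart \<gamma> \<and> pathfinish \<sigma> = pathfinish \<gamma> \<and>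
      curve_length g \<sigma> < curve_length g \<gamma>"
proof -
  let ?\<rho> = "\<lambda>t. radius_norm Y (\<gamma> t)" and ?\<gamma>' = "\<lambda>t. vector_derivative \<gamma> (at t)"
  let ?l' = "\<lambda>t. sqrt (pullback_x Y g (\<gamma> t) (?\<gamma>' t) (?\<gamma>' t))"
  obtain S where \<gamma>c01: "continuous_on {0..1} \<gamma>" and S: "finite S" and \<gamma>C01: "\<gamma> C1_differentiable_on ({0<..<1} - S)"
    using \<gamma> unfolding curve_in_def piecewise_C1_on_Icc_iff by blast
  have \<gamma>c: "continuous_on {a..b} \<gamma>" if "t1 \<le> a" "b \<le> t2" for a b
    by (rule continuous_on_subset[OF \<gamma>c01]) (use that ts in auto)
  have \<gamma>C: "\<gamma> C1_differentiable_on ({a<..<b} - S)" if "t1 \<le> a" "b \<le> t2" for a b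
    by (rule C1_differentiable_on_subset[OF \<gamma>C01]) (use that ts in auto)
  have \<gamma>q: "\<gamma> ` {a..b} \<subseteq> cball q \<kappa>" if "t1 \<le> a" "b \<le> t2" for a b
  proof (rule image_subsetI)
    fix t assume "t \<in> {a..b}"
    then have "dist q (\<gamma> t) \<le> \<kappa> / 2" by (intro near) (use that in auto)
    then show "\<gamma> t \<in> cball q \<kappa>" using \<kappa>_pos by simp
  qed
  have "arc_length g \<gamma> t1 t2 \<le> curve_length g \<gamma>"
    unfolding curve_length_eq_arc_length
    using arc_length_combine[of 0 t1 1 g \<gamma>] arc_length_combine[of t1 t2 1 g \<gamma>] ts
    by (simp add: add_increasing add_increasing2)
  then have "arc_length g \<gamma> t1 t2 < \<infinity>" using fin by (rule le_less_trans)
  then obtain l where lc: "continuous_on {t1..t2} l"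
    and ld0: "\<forall>t \<in> {t1<..<t2} - S. (l has_real_derivative ?l' t) (at t)"
    and l'c: "continuous_on ({t1<..<t2} - S) ?l'"
    by (rule finite_length_x_arclength[OF S \<gamma>c[OF order_refl order_refl] \<gamma>C[OF order_refl order_refl] \<gamma>q[OF order_refl order_refl]])
  have ld: "(l has_real_derivative ?l' t) (at t)" if "t \<in> {t1<..<t2} - S" for t
    using ld0 that by blast
  have l'0: "0 \<le> ?l' t" if "t \<in> {t1..t2}" for t
    using \<gamma>q[OF order_refl order_refl] that
    by (intro real_sqrt_ge_zero pullback_x_pos(1)[OF metric] proj_x_in_U) blast
  have l_mono: "l s \<le> l t" if "t1 \<le> s" "s \<le> t" "t \<le> t2" for s t
    by (rule nonneg_deriv_mono[of s t S l ?l'])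
      (use that S ld l'0 in \<open>auto intro: continuous_on_subset[OF lc]\<close>)
  define V where "V t = sqrt ((l t - l ts)\<^sup>2 + 4 * (?\<rho> t)\<^sup>2)" for t
  have V2: "(V t)\<^sup>2 = (l t - l ts)\<^sup>2 + 4 * (?\<rho> t)\<^sup>2" for t
    by (simp add: V_def)
  have V0: "0 \<le> V t" for t by (simp add: V_def)
  have \<rho>ts: "?\<rho> ts = 0" using q_axes by (simp add: center radius_norm_eq_0_iff)
  have Vts: "V ts = 0" by (simp add: V_def \<rho>ts)
  have Vc: "continuous_on {t1..t2} V"
    unfolding V_def by (intro continuous_intros lc \<gamma>c) auto
  have V_pos: "0 < V t" if "t = t1 \<or> t = t2" for t
  proof (rule ccontr)
    assume "\<not> 0 < V t"
    then have "V t = 0" using V0[of t] by simp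
    then have z: "l t = l ts" "?\<rho> t = 0" by (auto simp: V_def add_nonneg_eq_0_iff)
    have "proj_x Y (\<gamma> t) = proj_x Y (\<gamma> ts)"
    proof (cases "t = t1")
      case True
      show ?thesis unfolding True
        by (rule x_arclength_0_imp_x_constant[OF S _ \<gamma>c \<gamma>C \<gamma>q, of t1 ts l])
          (use ts z True ld in \<open>auto intro: continuous_on_subset[OF lc]\<close>)
    next
      case False
      then have t: "t = t2" using that by simp
      show ?thesis unfolding t
        by (rule x_arclength_0_imp_x_constant[OF S _ \<gamma>c \<gamma>C \<gamma>q, of ts t2 l, symmetric])
          (use ts z t ld in \<open>auto intro: continuous_on_subset[OF lc]\<close>)
    qed
    moreover have "proj_x Y (\<gamma> t) = \<gamma> t" "proj_x Y (\<gamma> ts) = \<gamma> ts"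
      using z(2) \<rho>ts by (simp_all add: radius_norm_eq_0_iff x_axes_iff)
    ultimately show False using far that center by auto
  qed
  have K0: "0 \<le> cusp_const" by (simp add: cusp_const_def)
  \<comment> \<open>For \<open>W \<le> m0\<close> the smallness conditions of \<open>chord_gain\<close> hold.\<close>
  define N where "N = 16 * C + cusp_const + 1"
  define m0 where "m0 = 1 / N"
  have N: "1 \<le> N" using C_nonneg K0 by (simp add: N_def)
  then have m0: "0 < m0" "m0 \<le> 1" "N * m0 \<le> 1"
    by (auto simp: m0_def)

  \<comment> \<open>Two times with legs of equal length \<open>W\<close>, the larger radius being maximal between them.\<close>
  have key: ?thesis
    if t': "t' \<in> {t1..ts}" and t'': "t'' \<in> {ts..t2}" and W: "V t' = W" "V t'' = W" "W \<le> m0"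
      and \<delta>: "\<And>t. t \<in> {t'..t''} \<Longrightarrow> ?\<rho> t \<le> \<delta>" "\<delta> = max (?\<rho> t') (?\<rho> t'')" "0 < \<delta>"
    for t' t'' W \<delta>
  proof -
    have W0: "0 \<le> W" using V0 W by auto
    have W2: "(l ts - l t')\<^sup>2 + 4 * (?\<rho> t')\<^sup>2 = W\<^sup>2" "(l t'' - l ts)\<^sup>2 + 4 * (?\<rho> t'')\<^sup>2 = W\<^sup>2"
      using V2[of t'] V2[of t''] by (simp_all add: W power2_commute)
    have "0 < W"
    proof (rule ccontr)
      assume "\<not> 0 < W"
      then have "W = 0" using W0 by simp
      then have "?\<rho> t' = 0" "?\<rho> t'' = 0" using W2 by (simp_all add: add_nonneg_eq_0_iff)
      then show False using \<delta> by simp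
    qed
    have lt: "t' < ts" "ts < t''"
      using t' t'' W Vts \<open>0 < W\<close> by (auto simp: less_le)
    have small: "16 * C * W\<^sup>2 \<le> 1" "cusp_const * W ^ 4 \<le> 1"
    proof -
      have W1: "W \<le> 1" using W(3) m0 by linarith
      have W2': "W\<^sup>2 \<le> m0" "W ^ 4 \<le> m0"
        using power_decreasing[of 1 2 W] power_decreasing[of 1 4 W] W1 W0 W(3) by auto
      have sum: "16 * C * m0 + cusp_const * m0 + m0 \<le> 1" using m0(3) by (simp add: N_def algebra_simps)
      have nn: "0 \<le> C * m0" "0 \<le> cusp_const * m0" using m0 C_nonneg K0 by auto
      have "16 * C * W\<^sup>2 \<le> 16 * C * m0" using W2' C_nonneg by (intro mult_left_mono) auto
      then show "16 * C * W\<^sup>2 \<le> 1" using sum nn m0(1) by linarith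
      have "cusp_const * W ^ 4 \<le> cusp_const * m0" using W2' K0 by (intro mult_left_mono) auto
      then show "cusp_const * W ^ 4 \<le> 1" using sum nn m0(1) by linarith
    qed
    have \<rho>_near: "?\<rho> t \<le> \<kappa> / 2" if "t \<in> {t1..t2}" for t
      using radius_norm_le_dist[OF q_axes, of "\<gamma> t"] near[OF that] by (simp add: dist_norm norm_minus_commute)
    have \<delta>\<kappa>: "\<delta> \<le> \<kappa> / 2"
      using \<rho>_near[of t'] \<rho>_near[of t''] t' t'' ts by (auto simp: \<delta>(2))
    have \<delta>\<kappa>': "\<delta> \<le> \<kappa>" using \<delta>\<kappa> \<kappa>_pos by linarith
    define D where "D = (\<Sum>j\<in>Y. (norm (\<gamma> t'' $ j) - norm (\<gamma> t' $ j))\<^sup>2)"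
    have "D \<le> (\<Sum>j\<in>Y. (norm (\<gamma> t' $ j))\<^sup>2 + (norm (\<gamma> t'' $ j))\<^sup>2)"
      unfolding D_def
    proof (rule sum_mono)
      fix j
      have "0 \<le> norm (\<gamma> t'' $ j) * norm (\<gamma> t' $ j)" by simp
      then show "(norm (\<gamma> t'' $ j) - norm (\<gamma> t' $ j))\<^sup>2 \<le> (norm (\<gamma> t' $ j))\<^sup>2 + (norm (\<gamma> t'' $ j))\<^sup>2"
        unfolding power2_diff by linarith
    qed
    also have "\<dots> = (?\<rho> t')\<^sup>2 + (?\<rho> t'')\<^sup>2"
      by (simp add: sum.distrib radius_norm_def L2_set_def sum_nonneg)
    finally have D: "D \<le> (?\<rho> t')\<^sup>2 + (?\<rho> t'')\<^sup>2" .
    \<comment> \<open>The strict inequality at the x-length of the arc survives the small excess of \<open>\<Lambda>\<close> that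
      the bridge needs.\<close>
    let ?f = "\<lambda>\<Lambda>. (1 + C * \<delta>\<^sup>2) * (\<Lambda>\<^sup>2 + 4 * D + cusp_const * \<delta> ^ 6)"
    let ?X = "(1 - C * \<delta>\<^sup>2) * (4 * W\<^sup>2)"
    have "?f ((l ts - l t') + (l t'' - l ts)) < ?X"
      by (rule chord_gain[OF W2 W0 _ _ _ _ C_nonneg K0 \<delta>(2,3) D small])
        (use l_mono[of t' ts] l_mono[of ts t''] t' t'' ts in auto)
    then have "?f (l t'' - l t') < ?X" by simp
    moreover have "(?f \<longlongrightarrow> ?f (l t'' - l t')) (at_right (l t'' - l t'))"
      by (intro tendsto_intros)
    ultimately have "\<forall>\<^sub>F \<Lambda> in at_right (l t'' - l t'). ?f \<Lambda> < ?X"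
      by (rule order_tendstoD(2)[rotated])
    moreover have "\<forall>\<^sub>F \<Lambda> in at_right (l t'' - l t'). l t'' - l t' < \<Lambda>"
      by (rule eventually_at_right_less)
    ultimately have "\<exists>\<Lambda>. ?f \<Lambda> < ?X \<and> l t'' - l t' < \<Lambda>"
      using eventually_happens'[OF trivial_limit_at_right_real] eventually_conj by blast
    then obtain \<Lambda> where \<Lambda>: "?f \<Lambda> < ?X" "l t'' - l t' < \<Lambda>" by blast
    have "t' < t''" using lt by simp
    have sub: "{t'<..<t''} - S \<subseteq> {t1<..<t2} - S" using t' t'' by auto
    obtain \<tau> where \<tau>: "continuous_on {t'..t''} \<tau>" "\<tau> C1_differentiable_on ({t'<..<t''} - S)"
      "\<tau> t' = \<gamma> t'" "\<tau> t'' = \<gamma> t''" "\<tau> ` {t'..t''} \<subseteq> cball q \<kappa>"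
      and \<tau>_len: "arc_length g \<tau> t' t'' \<le> ennreal (sqrt (1 + C * \<delta>\<^sup>2) *
       sqrt (\<Lambda>\<^sup>2 + 4 * (\<Sum>j\<in>Y. (norm (\<gamma> t'' $ j) - norm (\<gamma> t' $ j))\<^sup>2) + cusp_const * \<delta> ^ 6))"
    proof (rule rotating_bridge[of t' t'' S "\<lambda>t. proj_x Y (\<gamma> t)" "\<lambda>t. proj_x Y (?\<gamma>' t)" l ?l' "\<gamma> t'" \<delta> "\<gamma> t''" \<Lambda>])
      show "continuous_on {t'..t''} (\<lambda>t. proj_x Y (\<gamma> t))"
        by (intro continuous_intros \<gamma>c) (use t' t'' in auto)
      show "((\<lambda>t. proj_x Y (\<gamma> t)) has_vector_derivative proj_x Y (?\<gamma>' t)) (at t)" if "t \<in> {t'<..<t''} - S" for t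
      proof (rule bounded_linear.has_vector_derivative[OF bounded_linear_proj_x])
        show "(\<gamma> has_vector_derivative ?\<gamma>' t) (at t)"
          using \<gamma>C[of t' t''] that t' t'' by (auto simp: C1_differentiable_on_eq vector_derivative_works)
      qed
      show "continuous_on ({t'<..<t''} - S) (\<lambda>t. proj_x Y (?\<gamma>' t))"
        using \<gamma>C[of t' t''] t' t'' by (intro continuous_intros) (simp add: C1_differentiable_on_eq)
      show "dist q (proj_x Y (\<gamma> t)) \<le> \<kappa> / 2" if "t \<in> {t'..t''}" for t
        using dist_proj_x_le[OF q_axes, of "\<gamma> t"] near[of t] that t' t'' by auto
      show "continuous_on {t'..t''} l"
        by (rule continuous_on_subset[OF lc]) (use t' t'' in auto)
      show "(l has_real_derivative ?l' t) (at t)" if "t \<in> {t'<..<t''} - S" for t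
        by (rule ld) (use that sub in blast)
      show "continuous_on ({t'<..<t''} - S) ?l'"
        by (rule continuous_on_subset[OF l'c sub])
      show "?\<rho> t' \<le> \<delta>" "?\<rho> t'' \<le> \<delta>" by (simp_all add: \<delta>(2))
      show "sqrt (pullback_x Y g (proj_x Y (\<gamma> t)) (proj_x Y (?\<gamma>' t)) (proj_x Y (?\<gamma>' t))) \<le> ?l' t" for t
        by (simp add: pullback_x_def)
    qed (use \<open>t' < t''\<close> S \<delta>\<kappa> \<Lambda>(2) in auto)
    have lower: "ennreal (sqrt (1 - C * \<delta>\<^sup>2) * sqrt ((l b - l a)\<^sup>2 + 4 * (?\<rho> b - ?\<rho> a)\<^sup>2)) \<le> arc_length g \<gamma> a b"
      if "t' \<le> a" "a \<le> b" "b \<le> t''" for a b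
    proof (rule arc_length_ge_product[OF that(2) S \<gamma>c \<gamma>C \<gamma>q _ \<delta>\<kappa>', where l' = ?l'])
      show "continuous_on {a..b} l"
        by (rule continuous_on_subset[OF lc]) (use that t' t'' in auto)
      show "continuous_on ({a<..<b} - S) ?l'"
        by (rule continuous_on_subset[OF l'c]) (use that t' t'' in auto)
      show "(l has_real_derivative ?l' t) (at t)" if "t \<in> {a<..<b} - S" for t
        by (rule ld) (use that \<open>t' \<le> a\<close> \<open>b \<le> t''\<close> t' t'' in auto)
      show "0 \<le> ?l' t" if "t \<in> {a<..<b} - S" for t
        by (rule l'0) (use that \<open>t' \<le> a\<close> \<open>b \<le> t''\<close> t' t'' in auto)
      show "?\<rho> t \<le> \<delta>" if "t \<in> {a..b}" for t
        by (rule \<delta>(1)) (use that \<open>t' \<le> a\<close> \<open>b \<le> t''\<close> in auto)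
    qed (use that t' t'' in auto)
    have "\<tau> ` {t'..t''} \<subseteq> U" using \<tau>(5) ball by blast
    note R = replace_subarc[OF \<gamma> _ \<open>t' < t''\<close> _ S \<tau>(1,2,3,4) this]
    have len_\<gamma>: "ennreal (2 * (sqrt (1 - C * \<delta>\<^sup>2) * W)) \<le> arc_length g \<gamma> t' t''"
    proof -
      have "ennreal (sqrt (1 - C * \<delta>\<^sup>2) * W) \<le> arc_length g \<gamma> t' ts"
        using lower[of t' ts] lt W2(1) W0 by (simp add: \<rho>ts)
      moreover have "ennreal (sqrt (1 - C * \<delta>\<^sup>2) * W) \<le> arc_length g \<gamma> ts t''"
        using lower[of ts t''] lt W2(2) W0 by (simp add: \<rho>ts)
      moreover have "0 \<le> sqrt (1 - C * \<delta>\<^sup>2) * W"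
      proof -
        have "C * \<delta>\<^sup>2 \<le> C * \<kappa>\<^sup>2" using \<delta>\<kappa>' \<delta>(3) C_nonneg by (intro mult_left_mono power_mono) auto
        then show ?thesis using W0 C\<kappa> by simp
      qed
      ultimately show ?thesis
        using arc_length_combine[of t' ts t'' g \<gamma>] lt
        by (simp only: mult_2 ennreal_plus) (auto intro: add_mono)
    qed
    have "sqrt (1 + C * \<delta>\<^sup>2) * sqrt (\<Lambda>\<^sup>2 + 4 * D + cusp_const * \<delta> ^ 6) = sqrt (?f \<Lambda>)"
      by (simp add: real_sqrt_mult)
    also have "\<dots> < sqrt ?X" using \<Lambda>(1) by (rule real_sqrt_less_mono)
    also have "sqrt ?X = 2 * (sqrt (1 - C * \<delta>\<^sup>2) * W)" using W0 by (simp add: real_sqrt_mult)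
    finally have less: "sqrt (1 + C * \<delta>\<^sup>2) * sqrt (\<Lambda>\<^sup>2 + 4 * D + cusp_const * \<delta> ^ 6)
        < 2 * (sqrt (1 - C * \<delta>\<^sup>2) * W)" .
    have "0 \<le> D" unfolding D_def by (rule sum_nonneg) simp
    moreover have "0 \<le> cusp_const * \<delta> ^ 6" using K0 by simp
    ultimately have "0 \<le> sqrt (1 + C * \<delta>\<^sup>2) * sqrt (\<Lambda>\<^sup>2 + 4 * D + cusp_const * \<delta> ^ 6)"
      using C_nonneg by simp
    with less have "ennreal (sqrt (1 + C * \<delta>\<^sup>2) * sqrt (\<Lambda>\<^sup>2 + 4 * D + cusp_const * \<delta> ^ 6))
        < ennreal (2 * (sqrt (1 - C * \<delta>\<^sup>2) * W))"
      by (intro ennreal_lessI) linarith+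
    with \<tau>_len len_\<gamma> have strict: "arc_length g \<tau> t' t'' < arc_length g \<gamma> t' t''"
      unfolding D_def[symmetric] by (meson le_less_trans less_le_trans)
    have *: "0 \<le> t'" "t'' \<le> 1" using t' t'' ts by auto
    note R = R[OF *]
    have "arc_length g \<gamma> 0 t' < \<infinity>" "arc_length g \<gamma> t'' 1 < \<infinity>"
      using fin unfolding R(4)[of g] by (auto simp: less_top[symmetric])
    then have "curve_length g (\<lambda>t. if t \<in> {t'..t''} then \<tau> t else \<gamma> t) < curve_length g \<gamma>"
      unfolding R(4,5)[of g] by (intro ennreal_add_less_middle strict)
    with R(1-3) show ?thesis by blast
  qed

  \<comment> \<open>Restrict to the times around \<open>ts\<close> with \<open>V \<le> m\<close>, take the point \<open>s\<close> of largest radius there, and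
    find the time with the same \<open>V\<close> on the other side of \<open>ts\<close>.\<close>
  define m where "m = min m0 (min (V t1) (V t2))"
  have m: "0 < m" "m \<le> m0" "m \<le> V t1" "m \<le> V t2"
    using m0 V_pos by (auto simp: m_def)
  obtain c1 where c1: "t1 \<le> c1" "c1 < ts" "V c1 = m" "\<And>t. t \<in> {c1..ts} \<Longrightarrow> V t \<le> m"
    using last_crossing[of t1 ts V m] continuous_on_subset[OF Vc, of "{t1..ts}"] ts m Vts by auto
  obtain c2 where c2: "ts < c2" "c2 \<le> t2" "V c2 = m" "\<And>t. t \<in> {ts..c2} \<Longrightarrow> V t \<le> m"
    using first_crossing[of ts t2 V m] continuous_on_subset[OF Vc, of "{ts..t2}"] ts m Vts by auto
  have "continuous_on {c1..c2} ?\<rho>"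
    using c1 c2 by (intro continuous_intros \<gamma>c) auto
  then obtain s where s: "s \<in> {c1..c2}" "\<And>t. t \<in> {c1..c2} \<Longrightarrow> ?\<rho> t \<le> ?\<rho> s"
    using continuous_attains_sup[of "{c1..c2}" ?\<rho>] c1 c2 by auto
  have "0 < ?\<rho> c1" using off[of c1] c1 by auto
  also have "\<dots> \<le> ?\<rho> s" using s(2)[of c1] c1 c2 by auto
  finally have \<rho>s: "0 < ?\<rho> s" .
  show ?thesis
  proof (cases "s \<le> ts")
    case True
    have Vs: "V s \<le> m" using c1(4)[of s] s True by auto
    obtain t'' where t'': "ts \<le> t''" "t'' \<le> c2" "V t'' = V s"
      using IVT'[of V ts "V s" c2] Vs c2 Vts V0[of s] continuous_on_subset[OF Vc, of "{ts..c2}"] ts by auto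
    show ?thesis
    proof (rule key[of s t'' "V s" "?\<rho> s"])
      show "s \<in> {t1..ts}" using s(1) c1 True by auto
      show "t'' \<in> {ts..t2}" using t'' c2 by auto
      show "?\<rho> t \<le> ?\<rho> s" if "t \<in> {s..t''}" for t
        by (rule s(2)) (use that s(1) t'' in auto)
      show "?\<rho> s = max (?\<rho> s) (?\<rho> t'')"
        using s(2)[of t''] t'' c1 by simp
      show "V s \<le> m0" using Vs m(2) by linarith
    qed (use t'' \<rho>s in auto)
  next
    case False
    have Vs: "V s \<le> m" using c2(4)[of s] s False by auto
    obtain t' where t': "c1 \<le> t'" "t' \<le> ts" "V t' = V s"
      using IVT2'[of V ts "V s" c1] Vs c1 Vts V0[of s] continuous_on_subset[OF Vc, of "{c1..ts}"] ts by auto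
    show ?thesis
    proof (rule key[of t' s "V s" "?\<rho> s"])
      show "s \<in> {ts..t2}" using s(1) c2 False by auto
      show "t' \<in> {t1..ts}" using t' c1 by auto
      show "?\<rho> t \<le> ?\<rho> s" if "t \<in> {t'..s}" for t
        by (rule s(2)) (use that s(1) t' in auto)
      show "?\<rho> s = max (?\<rho> t') (?\<rho> s)"
        using s(2)[of t'] t' c2 by simp
      show "V s \<le> m0" using Vs m(2) by linarith
    qed (use t' \<rho>s in auto)
  qed
qed

end

text \<open>
  Apply the corner cutting at the first point on the x-axes. Before that time the radius is positive,
  and leaving a ball about the point on either side supplies the times at which \<open>V\<close> is positive.
\<close>

lemma shorten_curve_meeting_x_axes:
  fixes \<gamma> :: "real \<Rightarrow> real^2^'k::finite"
  assumes g: "product_cuspidal_metric Y U g" and \<gamma>: "curve_in U \<gamma>" and fin: "curve_length g \<gamma> < \<infinity>"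
    and ends: "pathstart \<gamma> \<notin> x_axes Y" "pathfinish \<gamma> \<notin> x_axes Y"
    and meets: "path_image \<gamma> \<inter> x_axes Y \<noteq> {}"
  shows "\<exists>\<sigma>. curve_in U \<sigma> \<and> pathstart \<sigma> = pathstart \<gamma> \<and> pathfinish \<sigma> = pathfinish \<gamma> \<and>
      curve_length g \<sigma> < curve_length g \<gamma>"
proof -
  have \<gamma>c: "continuous_on {0..1} \<gamma>"
    using \<gamma> by (simp add: curve_in_def piecewise_C1_on_Icc_iff)
  let ?Z = "{t \<in> {0..1}. radius_norm Y (\<gamma> t) = 0}"
  have "closed ?Z"
    by (rule continuous_closed_preimage_constant) (auto intro!: continuous_intros \<gamma>c)
  moreover have "bounded ?Z"
    by (rule bounded_subset[of "{0..1}"]) auto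
  ultimately have comp: "compact ?Z"
    by (simp add: compact_eq_bounded_closed)
  have ne: "?Z \<noteq> {}"
    using meets by (auto simp: path_image_def radius_norm_eq_0_iff)
  obtain ts where ts: "ts \<in> ?Z" "\<forall>t\<in>?Z. ts \<le> t"
    using compact_attains_inf[OF comp ne] by blast
  define q where "q = \<gamma> ts"
  have q: "q \<in> x_axes Y" "q \<in> U"
    using ts(1) \<gamma> by (auto simp: q_def radius_norm_eq_0_iff curve_in_def path_image_def)
  have ts01: "0 < ts" "ts < 1"
    using ts(1) ends q(1) by (auto simp: q_def pathstart_def pathfinish_def less_le)
  obtain \<kappa> C where "cuspidal_ball Y U g q \<kappa> C"
    by (rule cuspidal_ball_exists[OF g q(2,1)])
  then interpret cuspidal_ball Y U g q \<kappa> C .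
  let ?d = "\<lambda>t. dist q (\<gamma> t)"
  have dc: "continuous_on {0..1} ?d"
    by (intro continuous_intros \<gamma>c)
  define r where "r = min (\<kappa> / 2) (min (?d 0) (?d 1))"
  have "\<gamma> 0 \<noteq> q" "\<gamma> 1 \<noteq> q"
    using ends q(1) by (auto simp: pathstart_def pathfinish_def)
  then have r: "0 < r" "r \<le> \<kappa> / 2" "r \<le> ?d 0" "r \<le> ?d 1"
    using \<kappa>_pos by (auto simp: r_def)
  have d0: "?d ts = 0" by (simp add: q_def)
  have dc1: "continuous_on {0..ts} ?d" and dc2: "continuous_on {ts..1} ?d"
    by (rule continuous_on_subset[OF dc]; use ts01 in auto)+
  obtain t1 where t1: "0 \<le> t1" "t1 < ts" "?d t1 = r" "\<And>t. t \<in> {t1..ts} \<Longrightarrow> ?d t \<le> r"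
    using last_crossing[OF _ dc1, of r] ts01 r d0 by auto
  obtain t2 where t2: "ts < t2" "t2 \<le> 1" "?d t2 = r" "\<And>t. t \<in> {ts..t2} \<Longrightarrow> ?d t \<le> r"
    using first_crossing[OF _ dc2, of r] ts01 r d0 by auto
  show ?thesis
  proof (rule shorten_through_center[OF \<gamma> fin t1(1,2) t2(1,2) q_def[symmetric]])
    show "dist q (\<gamma> t) \<le> \<kappa> / 2" if "t \<in> {t1..t2}" for t
      using t1(4)[of t] t2(4)[of t] that r(2) by (cases "t \<le> ts") auto
    show "\<gamma> t1 \<noteq> q" "\<gamma> t2 \<noteq> q" using t1(3) t2(3) r(1) by auto
    show "0 < radius_norm Y (\<gamma> t)" if "t \<in> {t1..<ts}" for t
    proof -
      have "t \<notin> ?Z" using ts(2) that by auto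
      then have "radius_norm Y (\<gamma> t) \<noteq> 0" using that t1 ts01 by auto
      then show ?thesis using radius_norm_nonneg[of Y "\<gamma> t"] by linarith
    qed
  qed
qed

section \<open>Connections of finite length\<close>

lemma open_regular_set: "open (regular_set Y)"
proof -
  have "regular_set Y = (\<Inter>j\<in>Y. {p. p $ j \<noteq> 0})"
    by (auto simp: regular_set_def)
  also have "open \<dots>"
    by (intro open_INT ballI open_Collect_neq continuous_intros) auto
  finally show ?thesis .
qed

text \<open>
  The locus where one plane coordinate vanishes has codimension two: the projection of a smooth curve to a
  plane is a null set, so almost every small translation moves the curve off the origin of that
  plane.
\<close>

lemma translate_into_regular_set:
  fixes \<pi> :: "real \<Rightarrow> real^2^'k::finite"
  assumes "polynomial_function \<pi>" "0 < e"
  obtains v where "norm v < e" "\<And>t. t \<in> {0..1} \<Longrightarrow> \<pi> t + v \<in> regular_set Y"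
proof -
  define d where "d = e / (2 * CARD('k))"
  have d: "0 < d" using assms(2) by (simp add: d_def)
  obtain \<pi>' where \<pi>': "\<And>t. (\<pi> has_vector_derivative \<pi>' t) (at t)"
    using has_vector_derivative_polynomial_function[OF assms(1)] by metis
  have "\<exists>z::real^2. norm z < d \<and> (\<forall>t\<in>{0..1}. \<pi> t $ j + z \<noteq> 0)" for j
  proof -
    let ?f = "\<lambda>t. - (\<pi> t $ j)"
    have "?f differentiable_on {0..1}"
    proof (rule differentiable_at_imp_differentiable_on)
      fix t
      have "((\<lambda>t. \<pi> t $ j) has_vector_derivative \<pi>' t $ j) (at t)"
        by (rule bounded_linear.has_vector_derivative[OF bounded_linear_vec_nth \<pi>'])
      then show "?f differentiable at t"
        by (intro differentiable_minus) (rule differentiableI_vector)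
    qed
    then have "negligible (?f ` {0..1})"
      by (intro negligible_differentiable_image_lowdim) auto
    moreover have "\<not> negligible (ball (0::real^2) d)"
      using d by (intro open_not_negligible) auto
    ultimately have "\<not> ball (0::real^2) d \<subseteq> ?f ` {0..1}"
      using negligible_subset by blast
    then obtain z where z: "z \<in> ball (0::real^2) d" "z \<notin> ?f ` {0..1}" by blast
    have "\<pi> t $ j + z \<noteq> 0" if "t \<in> {0..1}" for t
    proof
      assume "\<pi> t $ j + z = 0"
      then have "z = ?f t" by (metis add_eq_0_iff)
      with z(2) that show False by blast
    qed
    with z(1) show ?thesis by auto
  qed
  then obtain z :: "'k \<Rightarrow> real^2" where z: "\<And>j. norm (z j) < d" "\<And>j t. t \<in> {0..1} \<Longrightarrow> \<pi> t $ j + z j \<noteq> 0"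
    by metis
  define v where "v = (\<chi> j. z j)"
  have "norm v \<le> (\<Sum>j\<in>UNIV. norm (v $ j))"
    unfolding norm_vec_def by (rule L2_set_le_sum) auto
  also have "\<dots> \<le> (\<Sum>j\<in>(UNIV :: 'k set). d)"
    using z(1) by (intro sum_mono) (auto simp: v_def less_imp_le)
  also have "\<dots> < e" using assms(2) by (simp add: d_def)
  finally show thesis
    by (rule that) (auto simp: regular_set_def v_def z)
qed

text \<open>
  The regular part of a component of \<open>U\<close> is connected: translate a path in \<open>U\<close> slightly into the regular
  set and join the ends inside small balls. Polynomial paths have bounded derivatives, which general
  piecewise smooth ones need not have.
\<close>

lemma polynomial_path_in_regular_set:
  fixes x y :: "real^2^'k::finite"
  assumes U: "open U" and xy: "x \<in> U \<inter> regular_set Y" "y \<in> U \<inter> regular_set Y"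
    and conn: "connected_component U x y"
  obtains \<omega> :: "real \<Rightarrow> real^2^'k" where "polynomial_function \<omega>" "\<omega> 0 = x" "\<omega> 1 = y" "\<omega> ` {0..1} \<subseteq> U \<inter> regular_set Y"
proof -
  let ?W = "U \<inter> regular_set Y"
  have W: "open ?W" using U open_regular_set by blast
  let ?U0 = "connected_component_set U x"
  have U0: "open ?U0" "connected ?U0" "?U0 \<subseteq> U"
    using U by (auto intro: open_connected_component connected_component_subset[THEN subsetD])
  have "x \<in> ?U0" "y \<in> ?U0" using xy conn by auto
  then obtain \<pi> where \<pi>: "polynomial_function \<pi>" "path_image \<pi> \<subseteq> ?U0" "pathstart \<pi> = x" "pathfinish \<pi> = y"
    using connected_open_polynomial_connected[OF U0(1,2)] by metis
  have c\<pi>: "continuous_on {0..1} \<pi>"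
    using \<pi>(1) continuous_on_polymonial_function by blast
  then have "compact (path_image \<pi>)" by (intro compact_path_image) (simp add: path_def)
  then obtain e1 where e1: "e1 > 0" "(\<Union>p\<in>path_image \<pi>. ball p e1) \<subseteq> U"
    using compact_subset_open_imp_ball_epsilon_subset[of "path_image \<pi>" U] U \<pi>(2) U0(3) by blast
  obtain e2 where e2: "e2 > 0" "ball x e2 \<subseteq> ?W" using W xy(1) open_contains_ball by blast
  obtain e3 where e3: "e3 > 0" "ball y e3 \<subseteq> ?W" using W xy(2) open_contains_ball by blast
  define e where "e = min e1 (min e2 e3)"
  have "e > 0" using e1 e2 e3 by (simp add: e_def)
  then obtain v where v: "norm v < e" "\<And>t. t \<in> {0..1} \<Longrightarrow> \<pi> t + v \<in> regular_set Y"
    using translate_into_regular_set[OF \<pi>(1)] by metis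
  have ve: "norm v < e1" "norm v < e2" "norm v < e3" using v(1) by (auto simp: e_def)
  let ?\<pi>v = "\<lambda>t. \<pi> t + v"
  have "connected (?\<pi>v ` {0..1})"
    by (intro connected_continuous_image continuous_intros c\<pi>) auto
  moreover have "?\<pi>v ` {0..1} \<subseteq> ?W"
  proof (rule image_subsetI, rule IntI)
    fix t :: real assume t: "t \<in> {0..1}"
    show "\<pi> t + v \<in> regular_set Y" by (rule v(2)[OF t])
    have "\<pi> t \<in> path_image \<pi>" using t by (simp add: path_image_def)
    moreover have "\<pi> t + v \<in> ball (\<pi> t) e1" using ve by (simp add: dist_norm)
    ultimately show "\<pi> t + v \<in> U" using e1(2) by blast
  qed
  moreover have "x + v \<in> ?\<pi>v ` {0..1}" "y + v \<in> ?\<pi>v ` {0..1}"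
    using \<pi>(3,4) by (force simp: pathstart_def pathfinish_def)+
  ultimately have "connected_component ?W (x + v) (y + v)"
    unfolding connected_component_def by blast
  moreover have "connected_component ?W x (x + v)"
    unfolding connected_component_def
    using e2 ve by (intro exI[of _ "ball x e2"]) (auto simp: dist_norm)
  moreover have "connected_component ?W (y + v) y"
    unfolding connected_component_def
    using e3 ve by (intro exI[of _ "ball y e3"]) (auto simp: dist_norm)
  ultimately have "connected_component ?W x y"
    using connected_component_trans by meson
  then obtain \<omega> where "polynomial_function \<omega>" "path_image \<omega> \<subseteq> connected_component_set ?W x"
    "pathstart \<omega> = x" "pathfinish \<omega> = y"
    using connected_open_polynomial_connected[OF open_connected_component[OF W], of x x y] xy by auto
  then show thesis
    using connected_component_subset[of ?W x] by (intro that[of \<omega>]) (auto simp: path_image_def pathstart_def pathfinish_def)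
qed

lemma arc_length_finite:
  assumes "a \<le> b" and d: "\<And>t. t \<in> {a<..<b} \<Longrightarrow> (\<gamma> has_vector_derivative \<gamma>' t) (at t)"
    and M: "\<And>t. t \<in> {a<..<b} \<Longrightarrow> g (\<gamma> t) (\<gamma>' t) (\<gamma>' t) \<le> M"
  shows "arc_length g \<gamma> a b < \<infinity>"
proof -
  have "arc_length g \<gamma> a b \<le> ennreal (sqrt (max M 0) * b - sqrt (max M 0) * a)"
    unfolding arc_length_def
  proof (rule nn_integral_le_antiderivative[where S = "{}" and F' = "\<lambda>_. sqrt (max M 0)"])
    fix t assume t: "t \<in> {a<..<b} - {}"
    show "((\<lambda>t. sqrt (max M 0) * t) has_real_derivative sqrt (max M 0)) (at t)"
      by (auto intro!: derivative_eq_intros)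
    show "ennreal (sqrt (g (\<gamma> t) (vector_derivative \<gamma> (at t)) (vector_derivative \<gamma> (at t)))) \<le> ennreal (sqrt (max M 0))"
      using M[of t] t vector_derivative_at[OF d[of t]] by (intro ennreal_leI real_sqrt_le_mono) auto
  qed (use assms(1) in \<open>auto intro!: continuous_intros\<close>)
  then show ?thesis by (rule le_less_trans) simp
qed

text \<open>
  Boundedness of the speed comes from continuity of the metric in polar coordinates, as the segment is
  radial. A segment in general position could not be used, since the angular part of the metric is
  uncontrolled near strata away from the x-axes.
\<close>

lemma escape_segment:
  assumes g: "product_cuspidal_metric Y U g" and p: "p \<in> U"
  obtains b where "0 < b" "connected_component U p (p + b *\<^sub>R axis_escape Y p)"
    "\<forall>s\<in>{0..b}. p + s *\<^sub>R axis_escape Y p \<in> U"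
    "\<forall>k. \<exists>M. \<forall>s\<in>{0<..b}. g (p + s *\<^sub>R axis_escape Y p) (k *\<^sub>R axis_escape Y p) (k *\<^sub>R axis_escape Y p) \<le> M"
proof -
  let ?e = "axis_escape Y p"
  have "open U" and pol: "polar_continuous_on Y g U"
    using g by (auto simp: product_cuspidal_metric_def)
  then obtain d where d: "d > 0" "ball p d \<subseteq> U" using p open_contains_ball by blast
  define b where "b = d / (norm ?e + 1)"
  have b: "0 < b" using d(1) by (simp add: b_def add_nonneg_pos)
  have in_ball: "p + s *\<^sub>R ?e \<in> ball p d" if "s \<in> {0..b}" for s
  proof -
    have "s * norm ?e \<le> b * norm ?e" using that by (intro mult_right_mono) auto
    also have "\<dots> < b * (norm ?e + 1)" using b by simp
    also have "\<dots> = d" by (simp add: b_def add_nonneg_eq_0_iff)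
    finally show ?thesis using that by (simp add: dist_norm)
  qed
  have in_U: "p + s *\<^sub>R ?e \<in> U" if "s \<in> {0..b}" for s
    using in_ball[OF that] d(2) by blast
  have "\<exists>M. \<forall>s\<in>{0<..b}. g (p + s *\<^sub>R ?e) (k *\<^sub>R ?e) (k *\<^sub>R ?e) \<le> M" for k
  proof -
    have u2: "(k *\<^sub>R ?e) $ j $ 2 = 0" for j
      by (simp add: axis_escape_nth)
    obtain H where H: "continuous_on {0..b} H" and
      eq: "\<And>s. s \<in> {0..b} \<Longrightarrow> 0 < s \<or> k *\<^sub>R ?e \<in> stratum_tangent Y p \<Longrightarrow> g (p + s *\<^sub>R ?e) (k *\<^sub>R ?e) (k *\<^sub>R ?e) = H s"
      by (rule tensor_continuous_along_escape[OF pol in_U u2]) auto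
    have "compact (H ` {0..b})"
      by (intro compact_continuous_image H compact_Icc)
    then obtain M where "\<And>s. s \<in> {0..b} \<Longrightarrow> H s \<le> M"
      using bounded_imp_bdd_above[OF compact_imp_bounded] unfolding bdd_above_def by fastforce
    then show ?thesis using eq by (intro exI[of _ M]) auto
  qed
  moreover have "connected_component U p (p + b *\<^sub>R ?e)"
    unfolding connected_component_def
    using d in_ball[of b] b by (intro exI[of _ "ball p d"]) auto
  ultimately show thesis using that[of b] b in_U by blast
qed

text \<open>
  Leave the stratum of each end point radially and join the two regular points by a smooth path in the
  regular set, where the metric is smooth and thus bounded along the path.
\<close>

lemma finite_length_connection:
  fixes \<gamma> :: "real \<Rightarrow> real^2^'k::finite"
  assumes g: "product_cuspidal_metric Y U g" and \<gamma>: "curve_in U \<gamma>"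
  obtains \<sigma> where "curve_in U \<sigma>" "pathstart \<sigma> = pathstart \<gamma>" "pathfinish \<sigma> = pathfinish \<gamma>"
    "curve_length g \<sigma> < \<infinity>"
proof -
  have U: "open U" and smooth: "smooth_riemannian_on g (U \<inter> regular_set Y)" and sym: "symmetric_tensor_on g U"
    using g by (auto simp: product_cuspidal_metric_def)
  define p where "p = \<gamma> 0"
  define p' where "p' = \<gamma> 1"
  have pU: "p \<in> U" "p' \<in> U"
    using \<gamma> by (auto simp: curve_in_def path_image_def p_def p'_def)
  have "continuous_on {0..1} \<gamma>"
    using \<gamma> by (simp add: curve_in_def piecewise_C1_on_Icc_iff)
  then have "connected (path_image \<gamma>)" by (intro connected_path_image) (simp add: path_def)
  then have pp': "connected_component U p p'"
    unfolding connected_component_def using \<gamma>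
    by (intro exI[of _ "path_image \<gamma>"]) (auto simp: curve_in_def path_image_def p_def p'_def)
  let ?e = "axis_escape Y p" and ?e' = "axis_escape Y p'"
  obtain b where b: "0 < b" "connected_component U p (p + b *\<^sub>R ?e)"
    and bU: "\<forall>s\<in>{0..b}. p + s *\<^sub>R ?e \<in> U"
    and bM: "\<forall>k. \<exists>M. \<forall>s\<in>{0<..b}. g (p + s *\<^sub>R ?e) (k *\<^sub>R ?e) (k *\<^sub>R ?e) \<le> M"
    by (rule escape_segment[OF g pU(1)])
  obtain b' where b': "0 < b'" "connected_component U p' (p' + b' *\<^sub>R ?e')"
    and bU': "\<forall>s\<in>{0..b'}. p' + s *\<^sub>R ?e' \<in> U"
    and bM': "\<forall>k. \<exists>M. \<forall>s\<in>{0<..b'}. g (p' + s *\<^sub>R ?e') (k *\<^sub>R ?e') (k *\<^sub>R ?e') \<le> M"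
    by (rule escape_segment[OF g pU(2)])
  have conn: "connected_component U (p + b *\<^sub>R ?e) (p' + b' *\<^sub>R ?e')"
    using b(2) pp' b'(2) by (meson connected_component_sym connected_component_trans)
  have reg: "p + b *\<^sub>R ?e \<in> U \<inter> regular_set Y" "p' + b' *\<^sub>R ?e' \<in> U \<inter> regular_set Y"
    using regular_axis_escape[OF b(1)] regular_axis_escape[OF b'(1)] bU b b'(1) bU' by auto
  obtain \<omega> :: "real \<Rightarrow> real^2^'k" where \<omega>: "polynomial_function \<omega>" "\<omega> 0 = p + b *\<^sub>R ?e" "\<omega> 1 = p' + b' *\<^sub>R ?e'"
    "\<omega> ` {0..1} \<subseteq> U \<inter> regular_set Y"
    by (rule polynomial_path_in_regular_set[OF U reg conn])
  obtain \<omega>' where \<omega>': "polynomial_function \<omega>'" "\<And>t. (\<omega> has_vector_derivative \<omega>' t) (at t)"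
    using has_vector_derivative_polynomial_function[OF \<omega>(1)] by metis
  have \<omega>c: "continuous_on S \<omega>" and \<omega>'c: "continuous_on S \<omega>'" for S
    using \<omega>(1) \<omega>'(1) continuous_on_polymonial_function by blast+

  define \<tau>1 where "\<tau>1 t = p + (3 * b * t) *\<^sub>R ?e" for t
  define \<tau>2 where "\<tau>2 t = \<omega> (3 * t - 1)" for t
  define \<tau>3 where "\<tau>3 t = p' + (3 * b' * (1 - t)) *\<^sub>R ?e'" for t
  have d1: "(\<tau>1 has_vector_derivative (3 * b) *\<^sub>R ?e) (at t)" for t
    unfolding \<tau>1_def by (auto intro!: derivative_eq_intros)
  have d3: "(\<tau>3 has_vector_derivative (- 3 * b') *\<^sub>R ?e') (at t)" for t
    unfolding \<tau>3_def by (auto intro!: derivative_eq_intros)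
  have d2: "(\<tau>2 has_vector_derivative 3 *\<^sub>R \<omega>' (3 * t - 1)) (at t)" for t
  proof -
    have "((\<lambda>t::real. 3 * t - 1) has_vector_derivative 3) (at t)"
      by (auto intro!: derivative_eq_intros)
    from vector_diff_chain_at[OF this, of \<omega> "\<omega>' (3 * t - 1)"] \<omega>'(2)[of "3 * t - 1"]
    show ?thesis by (simp add: \<tau>2_def[abs_def] o_def)
  qed
  have c2: "continuous_on S (\<lambda>t. 3 *\<^sub>R \<omega>' (3 * t - 1))" for S
    by (intro continuous_intros continuous_on_compose2[OF \<omega>'c[of UNIV]]) auto
  have C1_I: "f C1_differentiable_on S" if "\<And>t. (f has_vector_derivative f' t) (at t)" "continuous_on S f'"
    for f f' :: "real \<Rightarrow> real^2^'k" and S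
    using that unfolding C1_differentiable_on_def by blast
  have C1: "\<tau>1 C1_differentiable_on S" "\<tau>2 C1_differentiable_on S" "\<tau>3 C1_differentiable_on S" for S
    by (rule C1_I[OF d1 continuous_on_const] C1_I[OF d2 c2] C1_I[OF d3 continuous_on_const])+
  have cont: "continuous_on S \<tau>1" "continuous_on S \<tau>2" "continuous_on S \<tau>3" for S
    by (rule C1_differentiable_imp_continuous_on[OF C1(1)] C1_differentiable_imp_continuous_on[OF C1(2)]
        C1_differentiable_imp_continuous_on[OF C1(3)])+

  have len1: "arc_length g \<tau>1 0 (1/3) < \<infinity>"
  proof -
    obtain M where M: "\<And>s. s \<in> {0<..b} \<Longrightarrow> g (p + s *\<^sub>R ?e) ((3 * b) *\<^sub>R ?e) ((3 * b) *\<^sub>R ?e) \<le> M"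
      using bM[rule_format, of "3 * b"] by blast
    show ?thesis
    proof (rule arc_length_finite[OF _ d1])
      show "g (\<tau>1 t) ((3 * b) *\<^sub>R ?e) ((3 * b) *\<^sub>R ?e) \<le> M" if "t \<in> {0<..<1/3}" for t
        unfolding \<tau>1_def by (rule M) (use that b(1) in auto)
    qed simp
  qed
  have len3: "arc_length g \<tau>3 (2/3) 1 < \<infinity>"
  proof -
    obtain M where M: "\<And>s. s \<in> {0<..b'} \<Longrightarrow> g (p' + s *\<^sub>R ?e') ((- 3 * b') *\<^sub>R ?e') ((- 3 * b') *\<^sub>R ?e') \<le> M"
      using bM'[rule_format, of "- 3 * b'"] by blast
    show ?thesis
    proof (rule arc_length_finite[OF _ d3])
      show "g (\<tau>3 t) ((- 3 * b') *\<^sub>R ?e') ((- 3 * b') *\<^sub>R ?e') \<le> M" if "t \<in> {2/3<..<1}" for t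
        unfolding \<tau>3_def by (rule M) (use that b'(1) in auto)
    qed simp
  qed
  have \<tau>2W: "\<tau>2 t \<in> U \<inter> regular_set Y" if "t \<in> {1/3..2/3}" for t
    using \<omega>(4) that unfolding \<tau>2_def by (rule_tac subsetD[OF _ imageI]) auto
  have len2: "arc_length g \<tau>2 (1/3) (2/3) < \<infinity>"
  proof -
    let ?h = "\<lambda>t. g (\<tau>2 t) (3 *\<^sub>R \<omega>' (3 * t - 1)) (3 *\<^sub>R \<omega>' (3 * t - 1))"
    have "continuous_on {1/3..2/3} ?h"
    proof (rule continuous_on_tensor[where t = g and f = \<tau>2, OF _ _ c2 c2])
      show "bilinear (g (\<tau>2 s))" if "s \<in> {1/3..2/3}" for s
        using sym \<tau>2W[OF that] by (auto simp: symmetric_tensor_on_def)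
      show "continuous_on {1/3..2/3} (\<lambda>s. g (\<tau>2 s) u v)" for u v
      proof (rule continuous_on_compose2[OF smooth_on_imp_continuous_on cont(2)])
        show "smooth_on (\<lambda>p. g p u v) (U \<inter> regular_set Y)"
          using smooth by (auto simp: smooth_riemannian_on_def)
        show "\<tau>2 ` {1/3..2/3} \<subseteq> U \<inter> regular_set Y" using \<tau>2W by blast
      qed
    qed
    then have "compact (?h ` {1/3..2/3})"
      by (rule compact_continuous_image) simp
    then obtain M where M: "\<And>t. t \<in> {1/3..2/3} \<Longrightarrow> ?h t \<le> M"
      using bounded_imp_bdd_above[OF compact_imp_bounded] unfolding bdd_above_def by fastforce
    show ?thesis
      by (rule arc_length_finite[OF _ d2, of _ _ _ M]) (use M in auto)
  qed
  define \<tau>12 where "\<tau>12 = (\<lambda>t::real. if t \<le> 1/3 then \<tau>1 t else \<tau>2 t)"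
  define \<sigma> where "\<sigma> = (\<lambda>t::real. if t \<le> 2/3 then \<tau>12 t else \<tau>3 t)"
  have j12: "\<tau>1 (1/3) = \<tau>2 (1/3)" by (simp add: \<tau>1_def \<tau>2_def \<omega>)
  have "\<tau>12 (2/3) = \<tau>3 (2/3)" by (simp add: \<tau>12_def \<tau>2_def \<tau>3_def \<omega>)
  have lt: "(0::real) < 1/3" "(1/3::real) < 2/3" "(0::real) < 2/3" "(2/3::real) < 1" by auto
  note A = concat_arcs[OF lt(1,2) finite.emptyI finite.emptyI cont(1) C1(1) cont(2) C1(2) j12, folded \<tau>12_def]
  have fin: "finite ({} \<union> {} \<union> {1/3::real})" by simp
  note B = concat_arcs[OF lt(3,4) fin finite.emptyI A(1,2) cont(3) C1(3) \<open>\<tau>12 (2/3) = \<tau>3 (2/3)\<close>, folded \<sigma>_def]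
  have "\<sigma> t \<in> U" if t: "t \<in> {0..1}" for t
  proof -
    have "\<tau>1 t \<in> U" if "t \<le> 1/3"
      unfolding \<tau>1_def by (rule bU[rule_format]) (use t that b(1) in auto)
    moreover have "\<tau>2 t \<in> U" if "1/3 \<le> t" "t \<le> 2/3"
      using \<tau>2W[of t] that by simp
    moreover have "\<tau>3 t \<in> U" if "2/3 \<le> t"
      unfolding \<tau>3_def by (rule bU'[rule_format]) (use t that b'(1) in auto)
    ultimately show ?thesis by (auto simp: \<sigma>_def \<tau>12_def)
  qed
  then have "curve_in U \<sigma>"
    unfolding curve_in_def piecewise_C1_on_Icc_iff using B(1,2)
    by (intro conjI exI[of _ "{} \<union> {} \<union> {1/3} \<union> {} \<union> {2/3}"]) (auto simp: path_image_def)
  moreover have "pathstart \<sigma> = pathstart \<gamma>" "pathfinish \<sigma> = pathfinish \<gamma>"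
    by (auto simp: \<sigma>_def \<tau>12_def \<tau>1_def \<tau>3_def pathstart_def pathfinish_def p_def p'_def)
  moreover have "curve_length g \<sigma> < \<infinity>"
    unfolding curve_length_eq_arc_length B(3) A(3) using len1 len2 len3 by simp
  ultimately show thesis by (rule that)
qed

section \<open>Shortening a curve through the origin\<close>

theorem proposition12:
  fixes Y A B :: "'k::finite set"
    and U :: "(real^2^'k) set"
    and g :: "(real^2^'k) tensor2"
    and \<gamma> :: "real \<Rightarrow> real^2^'k"
  assumes "product_cuspidal_metric Y U g"
    and "A \<union> B = Y" "A \<inter> B = {}" "A \<noteq> {}" "B \<noteq> {}"
    and "curve_in U \<gamma>"
    and "pathstart \<gamma> \<in> coord_subspace A - {0}"
    and "pathfinish \<gamma> \<in> coord_subspace B - {0}"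
    and "0 \<in> \<gamma> ` {0<..<1}"
  shows "\<not> length_minimizing U g \<gamma> \<and>
    (\<exists>\<sigma>. curve_in U \<sigma> \<and> pathstart \<sigma> = pathstart \<gamma> \<and> pathfinish \<sigma> = pathfinish \<gamma> \<and>
         curve_length g \<sigma> < curve_length g \<gamma> \<and> 0 \<notin> path_image \<sigma>)"
proof -
  note g = assms(1) and \<gamma> = assms(6)
  have off_axes: "p \<notin> x_axes Y" if "p \<in> coord_subspace D - {0}" "D \<subseteq> Y" for p D
    using that by (auto simp: coord_subspace_def vec_eq_iff)
  have ends: "pathstart \<gamma> \<notin> x_axes Y" "pathfinish \<gamma> \<notin> x_axes Y"
    using off_axes[OF assms(7)] off_axes[OF assms(8)] assms(2) by auto
  have zero_axes: "0 \<in> x_axes Y" by (simp add: x_axes_iff)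
  have "0 \<in> path_image \<gamma>" using assms(9) by (auto simp: path_image_def)
  obtain \<sigma>1 where \<sigma>1: "curve_in U \<sigma>1" "pathstart \<sigma>1 = pathstart \<gamma>" "pathfinish \<sigma>1 = pathfinish \<gamma>"
    "curve_length g \<sigma>1 < curve_length g \<gamma>"
  proof (cases "curve_length g \<gamma> < \<infinity>")
    case True
    then show thesis
      using shorten_curve_meeting_x_axes[OF g \<gamma> True ends] \<open>0 \<in> path_image \<gamma>\<close> zero_axes that by blast
  next
    case False
    then show thesis
      using finite_length_connection[OF g \<gamma>] that by (metis not_less_iff_gr_or_eq infinity_ennreal_def top.not_eq_extremum)
  qed
  \<comment> \<open>The detour around the origin may use up part of the saving only.\<close>
  obtain e where e: "0 < e" "curve_length g \<sigma>1 + ennreal e < curve_length g \<gamma>"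
  proof -
    obtain z where z: "curve_length g \<sigma>1 < z" "z < curve_length g \<gamma>"
      using dense[OF \<sigma>1(4)] by blast
    obtain s where s: "curve_length g \<sigma>1 = ennreal s" "0 \<le> s"
      using z by (cases "curve_length g \<sigma>1") auto
    obtain w where w: "z = ennreal w" "0 \<le> w"
      using z by (cases z) auto
    have "s < w" using z(1) s w by (simp add: ennreal_less_iff)
    then show thesis
      using z(2) s w by (intro that[of "w - s"]) (auto simp flip: ennreal_plus)
  qed
  have "0 \<in> U" using g by (simp add: product_cuspidal_metric_def)
  obtain \<kappa> C where "cuspidal_ball Y U g 0 \<kappa> C"
    by (rule cuspidal_ball_exists[OF g \<open>0 \<in> U\<close> zero_axes])
  then interpret cuspidal_ball Y U g 0 \<kappa> C .
  have "Y \<noteq> {}" using assms(2,4) by auto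
  moreover have "pathstart \<sigma>1 \<noteq> 0" "pathfinish \<sigma>1 \<noteq> 0" using assms(7,8) \<sigma>1 by auto
  ultimately obtain \<sigma> where \<sigma>: "curve_in U \<sigma>" "pathstart \<sigma> = pathstart \<gamma>" "pathfinish \<sigma> = pathfinish \<gamma>"
    "0 \<notin> path_image \<sigma>" "curve_length g \<sigma> \<le> curve_length g \<sigma>1 + ennreal e"
    using detour_around_center[OF refl _ e(1) \<sigma>1(1)] \<sigma>1(2,3) by auto
  then have "curve_length g \<sigma> < curve_length g \<gamma>"
    using e(2) by (meson le_less_trans)
  then show ?thesis
    using \<sigma> unfolding length_minimizing_def by (meson not_le)
qed

end
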